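(* Let $n\ge 1$ be an integer. There exists a family $(\sigma_2,\ldots,\sigma_n)$ of relative $n$-cycles with rational coefficients in $(\mathbb{C}^* )^n-\{x_1\cdots x_n=1\}$ such that for every integrable $\omega$ we have $$\int_{[0,1]^n}\omega=a_0(\omega)+a_2(\omega)\zeta(2)+\cdots+a_n(\omega)\zeta(n),$$ with $a_k(\omega)$ a rational number for every $k\in\{0,2,\ldots,n\}$, given for $k=2,\ldots,n$ by the formula $$a_k(\omega)=(2\pi i)^{-k}\int_{\sigma_k}\omega .$$
   Context: The forms considered are $\omega=\dfrac{P(x_1,\ldots,x_n)}{(1-x_1\cdots x_n)^{N}}\,dx_1\cdots dx_n$ with $N\ge 0$ an integer and $P\in\mathbb{Q}[x_1,\ldots,x_n]$. Such an $\omega$ is called integrable if $\int_{[0,1]^n}\omega$ is absolutely convergent. A relative $n$-cycle with rational coefficients in $(\mathbb{C}^* )^n-\{x_1\cdots x_n=1\}$ is a (piecewise smooth) singular $n$-chain with rational coefficients in $(\mathbb{C}^* )^n-\{x_1\cdots x_n=1\}$ whose boundary is supported on $\bigcup_{1\le i\le n}\{x_i=1\}$. The cycles $\sigma_k$ depend on $n$ but not on $\omega$. $\zeta(k)=\sum_{m\ge1}m^{-k}$. *)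

theory Defs
  imports
    "HOL-Homology.Homology"
    "HOL-Analysis.Analysis"
    "Jordan_Normal_Form.Determinant"
begin

text \<open>
  Points of affine \<open>n\<close>-space are extensional functions on the index set \<open>{1..n}\<close>.  A polynomial in
  \<open>x\<^sub>1, x\<^sub>2, \<dots>\<close> over the rationals is a finitely supported map from exponent vectors to
  coefficients.
\<close>

type_synonym rat_mpoly = "(nat \<Rightarrow>\<^sub>0 nat) \<Rightarrow>\<^sub>0 rat"

definition rat_mpolys :: "nat \<Rightarrow> rat_mpoly set" where
  "rat_mpolys n = {P. \<forall>m\<in>Poly_Mapping.keys P. Poly_Mapping.keys m \<subseteq> {1..n}}"

definition eval_rat_mpoly :: "nat \<Rightarrow> rat_mpoly \<Rightarrow> (nat \<Rightarrow> 'a::field_char_0) \<Rightarrow> 'a" where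
  "eval_rat_mpoly n P x =
     (\<Sum>m\<in>Poly_Mapping.keys P.
        of_rat (Poly_Mapping.lookup P m) * (\<Prod>i\<in>{1..n}. x i ^ Poly_Mapping.lookup m i))"

text \<open>
  The differential form \<open>\<omega> = P / (1 - x\<^sub>1 \<cdots> x\<^sub>n)^N dx\<^sub>1 \<cdots> dx\<^sub>n\<close> is represented by the coefficient of
  \<open>dx\<^sub>1 \<cdots> dx\<^sub>n\<close>.  It is used with real arguments on the cube and with complex ones on cycles.
\<close>

definition form_coeff :: "nat \<Rightarrow> rat_mpoly \<Rightarrow> nat \<Rightarrow> (nat \<Rightarrow> 'a::field_char_0) \<Rightarrow> 'a" where
  "form_coeff n P N x = eval_rat_mpoly n P x / (1 - (\<Prod>i\<in>{1..n}. x i)) ^ N"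

text \<open>
  The completion of the product measure is Lebesgue measure on \<open>n\<close>-space; completing it makes the
  values of an integrand on a null set irrelevant for measurability.
\<close>

definition lebesgue_n :: "nat \<Rightarrow> (nat \<Rightarrow> real) measure" where
  "lebesgue_n n = completion (PiM {1..n} (\<lambda>_. lborel))"

definition unit_cube :: "nat \<Rightarrow> (nat \<Rightarrow> real) set" where
  "unit_cube n = {1..n} \<rightarrow>\<^sub>E {0..1}"

definition integrable_form :: "nat \<Rightarrow> rat_mpoly \<Rightarrow> nat \<Rightarrow> bool" where
  "integrable_form n P N \<longleftrightarrow> set_integrable (lebesgue_n n) (unit_cube n) (form_coeff n P N)"

definition cube_integral :: "nat \<Rightarrow> rat_mpoly \<Rightarrow> nat \<Rightarrow> real" where
  "cube_integral n P N = (LINT x:unit_cube n|lebesgue_n n. form_coeff n P N x)"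

text \<open>\<open>zeta_val k\<close> is only meant for \<open>k \<ge> 2\<close>, where the series converges.\<close>

definition zeta_val :: "nat \<Rightarrow> real" where
  "zeta_val k = suminf (\<lambda>m. 1 / real (Suc m) ^ k)"

definition form_domain :: "nat \<Rightarrow> (nat \<Rightarrow> complex) topology" where
  "form_domain n =
     subtopology (product_topology (\<lambda>_. euclidean) {1..n})
       {x. (\<forall>i\<in>{1..n}. x i \<noteq> 0) \<and> (\<Prod>i\<in>{1..n}. x i) \<noteq> 1}"

definition one_divisors :: "nat \<Rightarrow> (nat \<Rightarrow> complex) set" where
  "one_divisors n = (\<Union>i\<in>{1..n}. {x. x i = 1})"

text \<open>
  \<open>standard_simplex n\<close> consists of barycentric coordinates \<open>(t\<^sub>0, \<dots>, t\<^sub>n)\<close>.  Smoothness and integrals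
  use the affine chart \<open>(t\<^sub>1, \<dots>, t\<^sub>n)\<close>, which also fixes the orientation.
\<close>

definition chart_simplex :: "nat \<Rightarrow> (nat \<Rightarrow> real) set" where
  "chart_simplex n = {t \<in> {1..n} \<rightarrow>\<^sub>E {0..}. (\<Sum>i\<in>{1..n}. t i) \<le> 1}"

definition barycentric :: "nat \<Rightarrow> (nat \<Rightarrow> real) \<Rightarrow> (nat \<Rightarrow> real)" where
  "barycentric n t =
     (\<lambda>i. if i = 0 then 1 - (\<Sum>j\<in>{1..n}. t j) else if i \<le> n then t i else 0)"

definition partial_deriv :: "nat \<Rightarrow> ((nat \<Rightarrow> real) \<Rightarrow> complex) \<Rightarrow> (nat \<Rightarrow> real) \<Rightarrow> complex" where
  "partial_deriv j g t = vector_derivative (\<lambda>s. g (t(j := s))) (at (t j))"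

text \<open>
  A function is \<open>C\<^sup>\<infinity>\<close> on an open set \<open>U\<close> of \<open>n\<close>-space if all its iterated partial derivatives exist and are
  continuous on \<open>U\<close>.  For \<open>js = []\<close> the function itself is meant.
\<close>

definition smooth_fun_on :: "nat \<Rightarrow> (nat \<Rightarrow> real) set \<Rightarrow> ((nat \<Rightarrow> real) \<Rightarrow> complex) \<Rightarrow> bool" where
  "smooth_fun_on n U g \<longleftrightarrow>
     (\<forall>js\<in>lists {1..n}.
        continuous_map (subtopology (powertop_real {1..n}) U) euclidean (foldr partial_deriv js g) \<and>
        (\<forall>j\<in>{1..n}. \<forall>t\<in>U.
           (\<lambda>s. foldr partial_deriv js g (t(j := s))) differentiable (at (t j))))"

definition smooth_simplex :: "nat \<Rightarrow> ((nat \<Rightarrow> real) \<Rightarrow> (nat \<Rightarrow> complex)) \<Rightarrow> bool" where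
  "smooth_simplex n f \<longleftrightarrow>
     (\<exists>U g. openin (powertop_real {1..n}) U \<and> chart_simplex n \<subseteq> U \<and>
        (\<forall>i\<in>{1..n}. smooth_fun_on n U (\<lambda>t. g t i)) \<and>
        (\<forall>t\<in>chart_simplex n. \<forall>i\<in>{1..n}. f (barycentric n t) i = g t i))"

text \<open>
  Piecewise smooth: the standard simplex is a finite union of affine simplices, given by their
  vertices \<open>l 0, \<dots>, l n\<close>, on each of which the map is smooth.  Degenerate pieces are harmless, as
  the nondegenerate ones already cover.  Continuity is part of being a singular simplex.
\<close>

definition piecewise_smooth_simplex :: "nat \<Rightarrow> ((nat \<Rightarrow> real) \<Rightarrow> (nat \<Rightarrow> complex)) \<Rightarrow> bool" where
  "piecewise_smooth_simplex n f \<longleftrightarrow>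
     (\<exists>L. finite L \<and>
        (\<Union>l\<in>L. oriented_simplex n l ` standard_simplex n) = standard_simplex n \<and>
        (\<forall>l\<in>L. smooth_simplex n (f \<circ> oriented_simplex n l)))"

text \<open>
  Singular chains in the library have integer coefficients; the rational boundary is the rational
  linear extension of the library's boundary of a single simplex.
\<close>

type_synonym rat_chain = "((nat \<Rightarrow> real) \<Rightarrow> (nat \<Rightarrow> complex)) \<Rightarrow>\<^sub>0 rat"

definition rat_chain_boundary :: "nat \<Rightarrow> rat_chain \<Rightarrow> rat_chain" where
  "rat_chain_boundary p c =
     (\<Sum>f\<in>Poly_Mapping.keys c.
        Poly_Mapping.map (\<lambda>z. Poly_Mapping.lookup c f * of_int z) (chain_boundary p (frag_of f)))"

definition relative_cycle :: "nat \<Rightarrow> rat_chain \<Rightarrow> bool" where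
  "relative_cycle n c \<longleftrightarrow>
     (\<forall>f\<in>Poly_Mapping.keys c.
        singular_simplex n (form_domain n) f \<and> piecewise_smooth_simplex n f) \<and>
     (\<forall>f\<in>Poly_Mapping.keys (rat_chain_boundary n c).
        singular_simplex (n - 1) (subtopology (form_domain n) (one_divisors n)) f)"

text \<open>
  The pullback of \<open>dx\<^sub>1 \<and> \<dots> \<and> dx\<^sub>n\<close> is the Jacobian determinant times \<open>dt\<^sub>1 \<cdots> dt\<^sub>n\<close>.  Matrices are
  indexed from \<open>0\<close>, hence the shifts.  For a piecewise smooth simplex the partial derivatives exist
  almost everywhere.
\<close>

definition jacobian_det :: "nat \<Rightarrow> ((nat \<Rightarrow> real) \<Rightarrow> (nat \<Rightarrow> complex)) \<Rightarrow> (nat \<Rightarrow> real) \<Rightarrow> complex" where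
  "jacobian_det n f t =
     Determinant.det (Matrix.mat n n
       (\<lambda>(i, j). partial_deriv (Suc j) (\<lambda>s. f (barycentric n s) (Suc i)) t))"

definition simplex_integral ::
    "nat \<Rightarrow> rat_mpoly \<Rightarrow> nat \<Rightarrow> ((nat \<Rightarrow> real) \<Rightarrow> (nat \<Rightarrow> complex)) \<Rightarrow> complex" where
  "simplex_integral n P N f =
     (LINT t:chart_simplex n|lebesgue_n n.
        form_coeff n P N (f (barycentric n t)) * jacobian_det n f t)"

definition chain_integral :: "nat \<Rightarrow> rat_mpoly \<Rightarrow> nat \<Rightarrow> rat_chain \<Rightarrow> complex" where
  "chain_integral n P N c =
     (\<Sum>f\<in>Poly_Mapping.keys c. of_rat (Poly_Mapping.lookup c f) * simplex_integral n P N f)"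

end

theory Submission
  imports
    Defs
    "HOL-Complex_Analysis.Complex_Analysis"
    "HOL-Real_Asymp.Real_Asymp"
begin

text \<open>
  Expanding \<open>1 / (1 - x\<^sub>1 \<cdots> x\<^sub>n)^N\<close> turns the integral over the cube into the series
      of the rational function
  \<open>R(m)\<close> that is the sum over the monomials \<open>q x^e\<close> of \<open>P\<close> of
  \<open>q (m + N - 1 choose N - 1) / \<Prod>\<^sub>i (m + e\<^sub>i + 1)\<close>, and
      \<open>a\<^sub>k\<close> is the sum of the coefficients of the terms
  \<open>1 / (m + j)^k\<close> in its partial fraction decomposition.  Integrability forces the polynomial part of
      \<open>R\<close> and
  the sum \<open>a\<^sub>1\<close> to vanish.

  For the cycles, put \<open>x\<^sub>i = e^(s\<^sub>i L)\<close> with \<open>s\<close> in the standard simplex.  The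
      faces \<open>s\<^sub>i = 0\<close> lie in
  \<open>{x\<^sub>i = 1}\<close>, and \<open>x\<^sub>1 \<cdots> x\<^sub>n = e^L\<close>,
      so letting \<open>L\<close> run through a circle around \<open>2 \<pi> i p\<close> gives a relative
  cycle \<open>c\<^sub>p\<close>.  Integrating out \<open>s\<close> leaves the residue of \<open>(1 -
      e^L)^(-N)\<close> times an exponential polynomial in
  \<open>L\<close> with the same partial fraction coefficients as \<open>\<Prod>\<^sub>i 1 / (m + e\<^sub>i +
      1)\<close>.  Shifting \<open>L\<close> by \<open>2 \<pi> i p\<close> shows
  that this is a polynomial in \<open>p\<close> whose coefficient of \<open>p^(k - 1)\<close> is \<open>(2 \<pi> i)^k
      a\<^sub>k / (k - 1)!\<close> up to sign.
  Rational combinations of \<open>c\<^sub>0, \<dots>, c\<^sub>n\<^sub>-\<^sub>1\<close> extract these coefficients.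
\<close>

section \<open>Partial fractions\<close>

text \<open>The two computations meet in \<open>pf_coeff\<close>: multiplying c / (m + j)^l by a
  polynomial expanded in powers of m + j, and taking the residue of e^(j z) z^(l - 1) / (1 - e^z)^N,
  read off the same coefficients of \<open>binom_poly N j\<close>, up to signs and powers of 2 pi i.
  The shift of L by 2 pi i p leaves the exponentials unchanged and acts only on the powers of L, so
  the dependence on p is polynomial of degree at most n - 1 and n values of p suffice. The radius 1
  is below 2 pi, so each circle encloses a single pole.

  Two obstacles shape the rest. A single monomial of an integrable form may have a divergent
  integral, so everything is damped by r < 1 and the monomials are summed before r tends to 1. The
  cycles have to be chains of simplices, while a loop times a simplex is a prism; its triangulation
  brings in the walls, the permuted coordinates and the signs \<open>(-1) ^ (i - 1)\<close>, which
  occur both in the chain and in the Jacobian and cancel in the integral.\<close>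

abbreviation two_pi_i :: complex where
  "two_pi_i \<equiv> 2 * of_real pi * \<i>"

type_synonym pf_list = "(rat \<times> nat \<times> nat) list"

abbreviation "lookup \<equiv> Poly_Mapping.lookup"
abbreviation "keys \<equiv> Poly_Mapping.keys"

text \<open>
  A list entry \<open>(c, j, k)\<close> stands for the term \<open>c / (m +
      j)^k\<close> of a partial fraction decomposition; \<open>pf_exp\<close>
  replaces \<open>1 / (m + j)^k\<close> by \<open>(-1)^k e^(j z) z^(k - 1) / (k - 1)!\<close>,
      its inverse Laplace transform at \<open>-z\<close>
  up to sign.  Exponent \<open>k = 0\<close> only occurs in the decomposition of the empty product.
\<close>

definition pf_val :: "pf_list \<Rightarrow> nat \<Rightarrow> rat" where
  "pf_val d m = (\<Sum>(c, j, k)\<leftarrow>d. c / of_nat (m + j) ^ k)"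

fun exp_mono :: "nat \<Rightarrow> nat \<Rightarrow> complex \<Rightarrow> complex" where
  "exp_mono j 0 z = 0"
| "exp_mono j (Suc k) z = exp (of_nat j * z) * z ^ k / fact k"

definition pf_exp :: "pf_list \<Rightarrow> complex \<Rightarrow> complex" where
  "pf_exp d z = (\<Sum>(c, j, k)\<leftarrow>d. of_rat c * (-1) ^ k * exp_mono j k z)"

text \<open>Divides one term by m + b. For j \<noteq> b the recursion is 1 / ((m + j)^(k + 1) (m +
  b)) = (1 / (m + j)^(k + 1) - 1 / ((m + j)^k (m + b))) / (b - j).\<close>

fun pf_div :: "nat \<Rightarrow> rat \<Rightarrow> nat \<Rightarrow> nat \<Rightarrow> pf_list" where
  "pf_div b c j 0 = [(c, b, 1)]"
| "pf_div b c j (Suc k) =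
    (if j = b then [(c, j, Suc (Suc k))]
     else (c / (of_nat b - of_nat j), j, Suc k) # pf_div b (- c / (of_nat b - of_nat j)) j k)"

abbreviation pf_divs :: "nat \<Rightarrow> pf_list \<Rightarrow> pf_list" where
  "pf_divs b d \<equiv> concat (map (\<lambda>(c, j, k). pf_div b c j k) d)"

fun pf_prod :: "nat list \<Rightarrow> pf_list" where
  "pf_prod [] = [(1, 0, 0)]"
| "pf_prod (b # bs) = pf_divs b (pf_prod bs)"

lemma pf_val_simps [simp]:
  "pf_val [] m = 0" "pf_val ((c, j, k) # d) m = c / of_nat (m + j) ^ k + pf_val d m"
  "pf_val (d @ d') m = pf_val d m + pf_val d' m"
  by (simp_all add: pf_val_def)

lemma pf_exp_simps [simp]:
  "pf_exp [] z = 0"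
  "pf_exp ((c, j, k) # d) z = of_rat c * (-1) ^ k * exp_mono j k z + pf_exp d z"
  "pf_exp (d @ d') z = pf_exp d z + pf_exp d' z"
  by (simp_all add: pf_exp_def)

lemma pf_div_entries:
  "(c', j', k') \<in> set (pf_div b c j k) \<Longrightarrow> j' \<in> {b, j} \<and> 1 \<le> k' \<and> k' \<le> Suc k"
  by (induction b c j k rule: pf_div.induct) (auto split: if_splits)

lemma pf_div_entries_pos:
  assumes "(c', j', k') \<in> set (pf_div b c j k)" "b > 0" "k = 0 \<or> j > 0"
  shows "j' > 0"
  using assms by (induction b c j k rule: pf_div.induct) (auto split: if_splits)

text \<open>Each division raises an exponent by at most one, which is why no zeta value beyond the
  number of factors can occur. Positive shifts keep all denominators nonzero at m = 0; a term of
  exponent 0 is constant, so its shift is harmless.\<close>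

lemma pf_prod_entries:
  assumes "(c, j, k) \<in> set (pf_prod bs)" "\<forall>b\<in>set bs. b > 0"
  shows "k \<le> length bs" "bs \<noteq> [] \<Longrightarrow> 1 \<le> k" "k = 0 \<or> j > 0"
proof -
  have "k \<le> length bs \<and> (bs \<noteq> [] \<longrightarrow> 1 \<le> k) \<and> (k = 0 \<or> j > 0)"
    using assms
  proof (induction bs arbitrary: c j k)
    case (Cons b bs)
    then obtain c' j' k' where *: "(c', j', k') \<in> set (pf_prod bs)"
      "(c, j, k) \<in> set (pf_div b c' j' k')" by auto
    have "k' \<le> length bs" "k' = 0 \<or> j' > 0" using Cons.IH[OF *(1)] Cons.prems by auto
    moreover have "1 \<le> k" "k \<le> Suc k'" using pf_div_entries[OF *(2)] by auto
    ultimately show ?case using pf_div_entries_pos[OF *(2)] Cons.prems by auto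
  qed simp
  then show "k \<le> length bs" "bs \<noteq> [] \<Longrightarrow> 1 \<le> k" "k = 0 \<or> j > 0" by auto
qed

lemma pf_val_div:
  assumes "b > 0" "k = 0 \<or> j > 0"
  shows "pf_val (pf_div b c j k) m = c / of_nat (m + j) ^ k / of_nat (m + b)"
  using assms
proof (induction b c j k rule: pf_div.induct)
  case (2 b c j k)
  let ?x = "of_nat (m + j) :: rat" and ?y = "of_nat (m + b) :: rat"
  have nz: "?x \<noteq> 0" "?y \<noteq> 0" using 2 by (metis add_is_0 gr_implies_not0 of_nat_eq_0_iff nat.distinct(1))+
  show ?case
  proof (cases "j = b")
    case False
    then have d: "(of_nat b - of_nat j :: rat) \<noteq> 0" by simp
    have e: "of_nat b - of_nat j = ?y - ?x" by simp
    have "pf_val (pf_div b c j (Suc k)) m =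
      c / (?y - ?x) / ?x ^ Suc k + - c / (?y - ?x) / ?x ^ k / ?y"
      using 2 False unfolding e[symmetric] by simp
    also have "\<dots> = c / (?x ^ k * (?y - ?x)) * (1 / ?x - 1 / ?y)"
      by (simp add: right_diff_distrib diff_divide_distrib mult.commute mult.left_commute)
    also have "1 / ?x - 1 / ?y = (?y - ?x) / (?x * ?y)" using nz by (rule diff_frac_eq[THEN trans]) simp
    also have "c / (?x ^ k * (?y - ?x)) * ((?y - ?x) / (?x * ?y)) = c / ?x ^ Suc k / ?y"
      using d unfolding e by (simp add: mult.commute mult.left_commute)
    finally show ?thesis .
  qed (simp add: field_simps)
qed simp

lemma pf_val_prod:
  assumes "\<forall>b\<in>set bs. b > 0"
  shows "pf_val (pf_prod bs) m = (\<Prod>b\<leftarrow>bs. 1 / of_nat (m + b))"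
  using assms
proof (induction bs)
  case (Cons b bs)
  have "pf_val (pf_divs b d) m = pf_val d m / of_nat (m + b)"
    if "\<forall>(c, j, k)\<in>set d. k = 0 \<or> j > 0" for d
    using that
  proof (induction d)
    case (Cons a d)
    obtain c j k where "a = (c, j, k)" by (cases a)
    then show ?case using Cons pf_val_div[of b k j c m] \<open>\<forall>b\<in>set (b # bs). b > 0\<close>
      by (simp add: add_divide_distrib)
  qed simp
  moreover have "\<forall>(c, j, k)\<in>set (pf_prod bs). k = 0 \<or> j > 0"
    using pf_prod_entries(3)[of _ _ _ bs] Cons.prems by auto
  ultimately show ?case using Cons by simp
qed simp

section \<open>Differential equations for the transforms of partial fractions\<close>

lemma power_fact_deriv:
  "((\<lambda>z::complex. z ^ k / fact k) has_field_derivative (if k = 0 then 0 else z ^ (k - 1) / fact (k - 1))) (at z)"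
proof (cases k)
  case (Suc l)
  have "((\<lambda>z. z ^ Suc l / fact (Suc l)) has_field_derivative (of_nat (Suc l) * z ^ l) / fact (Suc l)) (at z)"
    using DERIV_power[OF DERIV_ident, where n = "Suc l" and x = z] by (intro DERIV_cdivide) simp
  moreover have "(of_nat (Suc l) * z ^ l) / fact (Suc l) = z ^ l / fact l"
    unfolding fact_Suc by (simp del: of_nat_Suc)
  ultimately show ?thesis unfolding Suc by simp
qed simp

text \<open>The operator d/dz - j lowers the exponent; the value 0 of \<open>exp_mono j 0\<close>
  makes this hold down to the lowest one.\<close>

lemma exp_mono_deriv:
  "(exp_mono j (Suc k) has_field_derivative of_nat j * exp_mono j (Suc k) z + exp_mono j k z) (at z)"
proof -
  have eq: "exp_mono j (Suc k) = (\<lambda>z. exp (of_nat j * z) * (z ^ k / fact k))" for k by auto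
  have "((\<lambda>z. exp (of_nat j * z)) has_field_derivative of_nat j * exp (of_nat j * z)) (at z)"
    by (auto intro!: derivative_eq_intros)
  then have "((\<lambda>z. exp (of_nat j * z) * (z ^ k / fact k)) has_field_derivative
    of_nat j * exp (of_nat j * z) * (z ^ k / fact k) +
    (if k = 0 then 0 else z ^ (k - 1) / fact (k - 1)) * exp (of_nat j * z)) (at z)"
    using power_fact_deriv by (rule DERIV_mult)
  moreover have "(if k = 0 then 0 else z ^ (k - 1) / fact (k - 1)) * exp (of_nat j * z) = exp_mono j k z"
    by (cases k) simp_all
  ultimately show ?thesis unfolding eq by (simp only: mult.assoc)
qed

text \<open>Multiplication by m + b corresponds to the operator b - d/dz, so the transform of a
  quotient by m + b solves a first-order linear equation whose source is the transform of the
  dividend.\<close>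

lemma pf_exp_div_deriv:
  "(pf_exp (pf_div b c j k) has_field_derivative
     of_nat b * pf_exp (pf_div b c j k) z - of_rat c * (-1) ^ k * exp_mono j k z) (at z)"
proof (induction b c j k rule: pf_div.induct)
  case (1 b c j)
  have "((\<lambda>z. - of_rat c * exp_mono b 1 z) has_field_derivative
      - of_rat c * (of_nat b * exp_mono b 1 z)) (at z)"
    using DERIV_cmult[OF exp_mono_deriv[of b 0 z], of "- of_rat c"] by simp
  moreover have "pf_exp (pf_div b c j 0) = (\<lambda>z. - of_rat c * exp_mono b 1 z)" by auto
  ultimately show ?case by (simp add: algebra_simps)
next
  case (2 b c j k)
  show ?case
  proof (cases "j = b")
    case True
    have "pf_exp (pf_div b c j (Suc k)) = (\<lambda>z. of_rat c * (-1) ^ k * exp_mono b (Suc (Suc k)) z)"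
      using True by auto
    moreover have "((\<lambda>z. of_rat c * (-1) ^ k * exp_mono b (Suc (Suc k)) z) has_field_derivative
      of_rat c * (-1) ^ k * (of_nat b * exp_mono b (Suc (Suc k)) z + exp_mono b (Suc k) z)) (at z)"
      by (rule DERIV_cmult[OF exp_mono_deriv])
    ultimately show ?thesis using True by (simp add: algebra_simps)
  next
    case False
    define C where "C = c / (of_nat b - of_nat j)"
    have c: "of_rat c = (of_rat C * (of_nat b - of_nat j) :: complex)"
      using False unfolding C_def by (simp add: of_rat_divide of_rat_diff)
    have d: "pf_div b c j (Suc k) = (C, j, Suc k) # pf_div b (- C) j k"
      using False by (simp add: C_def)
    have "pf_exp (pf_div b c j (Suc k)) =
      (\<lambda>z. of_rat C * (-1) ^ Suc k * exp_mono j (Suc k) z + pf_exp (pf_div b (- C) j k) z)"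
      unfolding d by auto
    moreover have "((\<lambda>z. of_rat C * (-1) ^ Suc k * exp_mono j (Suc k) z + pf_exp (pf_div b (- C) j k) z)
      has_field_derivative of_rat C * (-1) ^ Suc k * (of_nat j * exp_mono j (Suc k) z + exp_mono j k z)
       + (of_nat b * pf_exp (pf_div b (- C) j k) z - of_rat (- C) * (-1) ^ k * exp_mono j k z)) (at z)"
      using 2[OF False] by (intro DERIV_add DERIV_cmult[OF exp_mono_deriv]) (simp add: C_def)
    ultimately show ?thesis unfolding c by (simp add: algebra_simps of_rat_minus d)
  qed
qed

lemma pf_exp_div_0: "pf_exp (pf_div b c j k) 0 = (if k = 0 then - of_rat c else 0)"
proof (induction b c j k rule: pf_div.induct)
  case (2 b c j k)
  then show ?case by (cases k) (auto simp: of_rat_minus of_rat_divide)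
qed simp

lemma pf_exp_prod_deriv:
  "(pf_exp (pf_prod (b # bs)) has_field_derivative
     of_nat b * pf_exp (pf_prod (b # bs)) z - pf_exp (pf_prod bs) z) (at z)"
proof -
  have "(pf_exp (pf_divs b d) has_field_derivative
     of_nat b * pf_exp (pf_divs b d) z - pf_exp d z) (at z)" for d
  proof (induction d)
    case Nil
    have "pf_exp [] = (\<lambda>_. 0)" by auto
    then show ?case by simp
  next
    case (Cons a d)
    obtain c j k where a: "a = (c, j, k)" by (cases a)
    have "pf_exp (pf_divs b (a # d)) = 
      (\<lambda>z. pf_exp (pf_div b c j k) z + pf_exp (pf_divs b d) z)"
      by (auto simp: a)
    then show ?case using DERIV_add[OF pf_exp_div_deriv[of b c j k z] Cons]
      by (simp add: a algebra_simps)
  qed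
  then show ?thesis by simp
qed

text \<open>The initial condition for the equation of \<open>pf_exp_prod_deriv\<close>: with
  \<open>bs\<close> nonempty all exponents to be divided are positive, and such a division gives a
  transform vanishing at 0. A single factor has the value -1 there instead.\<close>

lemma pf_exp_prod_0:
  assumes "\<forall>b\<in>set bs. b > 0" "bs \<noteq> []"
  shows "pf_exp (pf_prod (b # bs)) 0 = 0"
proof -
  have "pf_exp (pf_divs b d) 0 = 0"
    if "\<forall>(c, j, k)\<in>set d. k \<noteq> 0" for d
    using that
  proof (induction d)
    case (Cons a d)
    then show ?case by (cases a) (auto simp: pf_exp_div_0)
  qed simp
  from this[of "pf_prod bs"] show ?thesis
    using pf_prod_entries(2)[of _ _ _ bs] assms by fastforce
qed

text \<open>Dividing by \<open>m + b\<close> corresponds to convolution with \<open>e^(b z)\<close>.\<close>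

lemma pf_exp_prod_integral:
  assumes "\<forall>b\<in>set bs. b > 0" "bs \<noteq> []" "\<tau> \<ge> 0"
  shows "pf_exp (pf_prod (b # bs)) (z * of_real \<tau>) =
    - z * (LBINT w:{0..\<tau>}. exp (of_nat b * z * of_real (\<tau> - w)) * pf_exp (pf_prod bs) (z * of_real w))"
proof -
  let ?E = "pf_exp (pf_prod (b # bs))" and ?F = "pf_exp (pf_prod bs)"
  \<comment> \<open>Variation of constants: with this integrating factor, G is a primitive of -z
    times the convolution integrand, so the fundamental theorem of calculus gives the claim.\<close>
  define G where "G w = exp (of_nat b * z * (of_real \<tau> - w)) * ?E (z * w)" for w
  define g where "g w = exp (of_nat b * z * (of_real \<tau> - w)) * ?F (z * w)" for w
  have cF: "isCont ?F w" for w
  proof -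
    obtain b' bs' where "bs = b' # bs'" using assms(2) by (cases bs) auto
    then show ?thesis using DERIV_isCont[OF pf_exp_prod_deriv[of b' bs' w]] by simp
  qed
  have dG: "(G has_field_derivative - z * g w) (at w)" for w
  proof -
    have "((\<lambda>w. ?E (z * w)) has_field_derivative
        (of_nat b * ?E (z * w) - ?F (z * w)) * z) (at w)"
      by (rule DERIV_chain2[OF pf_exp_prod_deriv]) (auto intro!: derivative_eq_intros)
    then show ?thesis unfolding G_def g_def
      by (auto intro!: derivative_eq_intros simp: algebra_simps)
  qed
  have "((\<lambda>w. G (of_real w)) has_vector_derivative - z * g (of_real w)) (at w within {0..\<tau>})" for w
    by (rule has_vector_derivative_real_field[OF dG])
  moreover have "continuous_on {0..\<tau>} (\<lambda>w. ?F (z * of_real w))"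
    by (rule continuous_on_compose2[OF continuous_at_imp_continuous_on[of UNIV ?F]])
      (auto intro!: cF continuous_intros)
  then have "continuous_on {0..\<tau>} (\<lambda>w. - z * g (of_real w))"
    unfolding g_def by (intro continuous_intros)
  ultimately have "(LBINT w. indicator {0..\<tau>} w *\<^sub>R (- z * g (of_real w))) = G (of_real \<tau>) - G (of_real 0)"
    using assms(3) by (intro integral_FTC_Icc) auto
  moreover have "G (of_real 0) = 0" using pf_exp_prod_0[OF assms(1,2), of b] by (simp add: G_def)
  moreover have "G (of_real \<tau>) = ?E (z * of_real \<tau>)" by (simp add: G_def)
  ultimately have "?E (z * of_real \<tau>) = (LBINT w:{0..\<tau>}. - z * g (of_real w))"
    by (simp add: set_lebesgue_integral_def)
  also have "\<dots> = - z * (LBINT w:{0..\<tau>}. g (of_real w))"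
    by (rule set_integral_mult_right)
  finally show ?thesis by (simp add: g_def)
qed

section \<open>Residues\<close>

text \<open>
  The expansion of the polynomial \<open>m \<mapsto> (m + N - 1 choose N - 1)\<close> in powers of \<open>m +
      j\<close>; the value for
  \<open>N = 0\<close> makes the residue formula below hold there, too.
\<close>

fun binom_poly :: "nat \<Rightarrow> int \<Rightarrow> rat poly" where
  "binom_poly 0 j = 0"
| "binom_poly (Suc 0) j = 1"
| "binom_poly (Suc (Suc N)) j =
    smult (1 / of_nat (Suc N)) ([:1 - of_int j, 1:] * binom_poly (Suc N) (j - 1))"

text \<open>At m + j the linear factor of the recursion has the value m + 1, and passing from (m, j)
  to (m + 1, j - 1) does not change m + j. What is left is the absorption identity for binomial
  coefficients.\<close>

lemma poly_binom_poly:
  "poly (binom_poly (Suc N) j) (of_nat m + of_int j) = of_nat ((m + N) choose m)"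
proof (induction N arbitrary: m j)
  case (Suc N)
  have "Suc m * (Suc m + N choose Suc m) = Suc N * (m + Suc N choose m)"
    using binomial_absorb_comp[of "m + Suc N" m] Suc_times_binomial[of m "m + N"]
    by (simp add: algebra_simps del: binomial_Suc_Suc)
  then have "(of_nat (Suc m) :: rat) * of_nat (Suc m + N choose Suc m) =
      of_nat (Suc N) * of_nat (m + Suc N choose m)"
    by (metis of_nat_mult)
  moreover have "poly (binom_poly (Suc N) (j - 1)) (of_nat m + of_int j) = of_nat (Suc m + N choose Suc m)"
    using Suc[of "j - 1" "Suc m"] by (simp add: algebra_simps del: binomial_Suc_Suc)
  ultimately show ?case by (simp add: field_simps del: binomial_Suc_Suc)
qed simp

text \<open>Separates 0 from the other poles of 1 / (1 - exp z). The bound 6 stands in for 2 * pi,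
  so that \<open>pi > 3\<close> is enough.\<close>

lemma exp_neq_1:
  fixes l :: complex
  assumes "l \<noteq> 0" "norm l < 6"
  shows "exp l \<noteq> 1"
proof
  assume "exp l = 1"
  then obtain n :: int where n: "Re l = 0" "Im l = of_int (2 * n) * pi" by (auto simp: exp_eq_1)
  with assms have "n \<noteq> 0" by (auto simp: complex_eq_iff)
  then have "\<bar>real_of_int n\<bar> \<ge> 1" by linarith
  then have "\<bar>Im l\<bar> \<ge> 2 * pi" by (simp add: n abs_mult)
  moreover have "\<bar>Im l\<bar> < 6" using assms(2) abs_Im_le_cmod[of l] by linarith
  ultimately show False using pi_gt3 by linarith
qed

text \<open>The shift is an integer because each integration by parts lowers it by one, possibly
  below 0.\<close>

definition exp_quot :: "nat \<Rightarrow> int \<Rightarrow> nat \<Rightarrow> complex \<Rightarrow> complex" where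
  "exp_quot N j r z = exp (of_int j * z) * (z ^ r / fact r) / (1 - exp z) ^ N"

lemma exp_quot_1_integral:
  "(exp_quot 1 j r has_contour_integral (if r = 0 then - 2 * of_real pi * \<i> else 0)) (circlepath 0 1)"
proof -
  \<comment> \<open>z / (1 - exp z) with its removable singularity filled in; Cauchy's integral
    formula for h then yields the residue at the simple pole.\<close>
  define h where "h z = (if z = 0 then -1 else z / (1 - exp z))" for z :: complex
  have nz: "1 - exp z \<noteq> 0" if "z \<in> ball 0 2 - {0}" for z :: complex
    using that exp_neq_1[of z] by (auto simp: dist_norm)
  have hol: "h holomorphic_on ball 0 2 - {0}"
  proof -
    have "(\<lambda>z. z / (1 - exp z)) holomorphic_on ball 0 2 - {0}"
      using nz by (intro holomorphic_intros) auto
    then show ?thesis by (rule holomorphic_transform) (auto simp: h_def)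
  qed
  have "((\<lambda>z::complex. - inverse ((exp z - 1) / z)) \<longlongrightarrow> - inverse 1) (at 0)"
    by (intro tendsto_intros lim_exp_minus_1) auto
  then have "((\<lambda>z. - inverse ((exp z - 1) / z)) \<longlongrightarrow> h 0) (at 0)" unfolding h_def by simp
  moreover have "\<forall>\<^sub>F z in at 0. - inverse ((exp z - 1) / z) = h z"
    unfolding eventually_at by (rule exI[of _ 1]) (auto simp: h_def minus_divide_right)
  ultimately have "(h \<longlongrightarrow> h 0) (at 0)" by (rule Lim_transform_eventually)
  then have "isCont h 0" by (simp add: isCont_def)
  moreover have "isCont h z" if "z \<in> ball 0 2 - {0}" for z
    using holomorphic_on_imp_continuous_on[OF hol] that continuous_on_eq_continuous_at[of "ball 0 2 - {0}" h]
    by (auto simp: open_delete)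
  ultimately have "continuous_on (ball 0 2) h"
    by (intro continuous_at_imp_continuous_on) blast
  then have "h holomorphic_on ball 0 2"
    by (rule no_isolated_singularity[of _ _ "{0}"]) (use hol in auto)
  then have "(\<lambda>z. exp (of_int j * z) * (z ^ r / fact r) * h z) holomorphic_on ball 0 2"
    by (intro holomorphic_intros) auto
  then have "(\<lambda>z. exp (of_int j * z) * (z ^ r / fact r) * h z) holomorphic_on cball 0 1"
    by (rule holomorphic_on_subset) auto
  from Cauchy_integral_circlepath_simple[OF this, of 0]
  have "((\<lambda>z. exp (of_int j * z) * (z ^ r / fact r) * h z / (z - 0)) has_contour_integral
      two_pi_i * (exp (of_int j * 0) * (0 ^ r / fact r) * h 0)) (circlepath 0 1)" by simp
  moreover have "two_pi_i * (exp (of_int j * 0) * (0 ^ r / fact r) * h 0) =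
      (if r = 0 then - 2 * of_real pi * \<i> else 0)" by (simp add: h_def)
  ultimately have "((\<lambda>z. exp (of_int j * z) * (z ^ r / fact r) * h z / (z - 0)) has_contour_integral
      (if r = 0 then - 2 * of_real pi * \<i> else 0)) (circlepath 0 1)" by simp
  then show ?thesis
  proof (rule has_contour_integral_eq)
    fix z :: complex assume "z \<in> path_image (circlepath 0 1)"
    then have "z \<noteq> 0" by (auto simp: path_image_circlepath)
    then show "exp (of_int j * z) * (z ^ r / fact r) * h z / (z - 0) = exp_quot 1 j r z"
      by (simp add: h_def exp_quot_def)
  qed
qed

text \<open>Integration by parts: F is the derivative of \<open>exp_quot (Suc N) (j - 1) r\<close>,
  so its integral over the closed circle is 0. Solved for the term with the higher pole order, this
  is the recursion of \<open>binom_poly\<close>, the factor \<open>(-1) ^ r\<close> accounting for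
  the sign of the term with r - 1. For N = 0 the integrand is entire.\<close>

lemma exp_quot_integral:
  "(exp_quot N j r has_contour_integral
     - 2 * of_real pi * \<i> * (-1) ^ r * of_rat (coeff (binom_poly N j) r)) (circlepath 0 1)"
proof (induction N j arbitrary: r rule: binom_poly.induct)
  case (1 j)
  have "(\<lambda>z. exp (of_int j * z) * (z ^ r / fact r)) holomorphic_on UNIV"
    by (intro holomorphic_intros) auto
  then have "((\<lambda>z. exp (of_int j * z) * (z ^ r / fact r)) has_contour_integral 0) (circlepath 0 1)"
    by (rule Cauchy_theorem_convex_simple) auto
  then show ?case by (simp add: exp_quot_def[abs_def])
next
  case (2 j)
  show ?case using exp_quot_1_integral[of j r] by (cases "r = 0") simp_all
next
  case (3 N j)
  define q where "q = (if r = 0 then (\<lambda>_. 0) else exp_quot (Suc N) (j - 1) (r - 1))"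
  define F where "F z = (of_int (j - 1) * exp_quot (Suc N) (j - 1) r z + q z
      + of_nat (Suc N) * exp_quot (Suc (Suc N)) j r z)" for z
  have nz: "1 - exp z \<noteq> 0" if "z \<in> sphere 0 1" for z :: complex
    using that exp_neq_1[of z] by (cases "z = 0") auto
  have "(exp_quot (Suc N) (j - 1) r has_field_derivative F z) (at z within sphere 0 1)"
    if z: "z \<in> sphere 0 1" for z
  proof -
    note n = nz[OF z]
    have 1: "((\<lambda>z. inverse ((1 - exp z) ^ Suc N)) has_field_derivative
      of_nat (Suc N) * exp z / (1 - exp z) ^ Suc (Suc N)) (at z)"
    proof -
      have "((\<lambda>z. (1 - exp z) ^ Suc N) has_field_derivative of_nat (Suc N) * (- exp z * (1 - exp z) ^ N)) (at z)"
      proof -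
        have "((\<lambda>z. 1 - exp z) has_field_derivative - exp z) (at z)"
          by (auto intro!: derivative_eq_intros)
        from DERIV_power[OF this, of "Suc N"] show ?thesis by simp
      qed
      from DERIV_inverse'[OF this] n show ?thesis
        by (simp add: divide_simps del: of_nat_Suc)
    qed
    have 2: "((\<lambda>z. exp (of_int (j - 1) * z)) has_field_derivative
      of_int (j - 1) * exp (of_int (j - 1) * z)) (at z)"
      by (auto intro!: derivative_eq_intros)
    have e: "exp (of_int j * z) = exp (of_int (j - 1) * z) * exp z"
      by (simp add: exp_add[symmetric] algebra_simps)
    have "((\<lambda>z. exp (of_int (j - 1) * z) * (z ^ r / fact r) * inverse ((1 - exp z) ^ Suc N)) has_field_derivative
      (of_int (j - 1) * exp (of_int (j - 1) * z) * (z ^ r / fact r) +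
       (if r = 0 then 0 else z ^ (r - 1) / fact (r - 1)) * exp (of_int (j - 1) * z)) * inverse ((1 - exp z) ^ Suc N)
       + of_nat (Suc N) * exp z / (1 - exp z) ^ Suc (Suc N) * (exp (of_int (j - 1) * z) * (z ^ r / fact r))) (at z)"
      by (intro DERIV_mult 1 2 power_fact_deriv)
    moreover have "(of_int (j - 1) * exp (of_int (j - 1) * z) * (z ^ r / fact r) +
       (if r = 0 then 0 else z ^ (r - 1) / fact (r - 1)) * exp (of_int (j - 1) * z)) * inverse ((1 - exp z) ^ Suc N)
       + of_nat (Suc N) * exp z / (1 - exp z) ^ Suc (Suc N) * (exp (of_int (j - 1) * z) * (z ^ r / fact r)) = F z"
      unfolding F_def q_def exp_quot_def e
      by (simp add: divide_inverse algebra_simps del: of_nat_Suc power_Suc of_int_diff)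
    moreover have "exp_quot (Suc N) (j - 1) r =
      (\<lambda>z. exp (of_int (j - 1) * z) * (z ^ r / fact r) * inverse ((1 - exp z) ^ Suc N))"
      by (auto simp: exp_quot_def divide_inverse)
    ultimately show ?thesis by (auto intro: has_field_derivative_at_within)
  qed
  then have F0: "(F has_contour_integral 0) (circlepath 0 1)"
    by (rule Cauchy_theorem_primitive) auto
  define C where "C r = - 2 * of_real pi * \<i> * (-1) ^ r * of_rat (coeff (binom_poly (Suc N) (j - 1)) r)" for r
  define D where "D = (if r = 0 then 0 else C (r - 1))"
  have "(q has_contour_integral D) (circlepath 0 1)"
    using 3[of "r - 1"] by (auto simp: q_def D_def C_def intro: has_contour_integral_0)
  then have "((\<lambda>z. 1 / of_nat (Suc N) * (F z - of_int (j - 1) * exp_quot (Suc N) (j - 1) r z - q z))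
     has_contour_integral 1 / of_nat (Suc N) * (0 - of_int (j - 1) * C r - D)) (circlepath 0 1)"
    using F0 3[of r] unfolding C_def
    by (intro has_contour_integral_lmul has_contour_integral_diff)
  moreover have "(\<lambda>z. 1 / of_nat (Suc N) * (F z - of_int (j - 1) * exp_quot (Suc N) (j - 1) r z - q z)) =
      exp_quot (Suc (Suc N)) j r" by (auto simp: F_def simp del: of_nat_Suc)
  moreover have "1 / of_nat (Suc N) * (0 - of_int (j - 1) * C r - D) =
      - 2 * of_real pi * \<i> * (-1) ^ r * of_rat (coeff (binom_poly (Suc (Suc N)) j) r)"
    by (cases r) (simp_all add: C_def D_def of_rat_mult of_rat_add of_rat_diff of_rat_divide field_simps del: of_nat_Suc)
  ultimately show ?case by simp
qed

definition unit_loop :: "real \<Rightarrow> complex" where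
  "unit_loop \<theta> = exp (two_pi_i * of_real \<theta>)"

text \<open>Passes from the gauge integral behind contour integrals to the Lebesgue integral over
  [0, 1], in which the later Fubini arguments live; continuity on the circle provides
  integrability.\<close>

lemma unit_loop_integral:
  assumes "(f has_contour_integral I) (circlepath 0 1)" "continuous_on (sphere 0 1) f"
  shows "(LBINT \<theta>:{0..1}. two_pi_i * unit_loop \<theta> * f (unit_loop \<theta>)) = I"
    "set_integrable lborel {0..1} (\<lambda>\<theta>. two_pi_i * unit_loop \<theta> * f (unit_loop \<theta>))"
proof -
  let ?h = "\<lambda>\<theta>. two_pi_i * unit_loop \<theta> * f (unit_loop \<theta>)"
  have cu: "continuous_on {0..1} unit_loop" unfolding unit_loop_def by (intro continuous_intros)
  have "continuous_on {0..1} (\<lambda>\<theta>. f (unit_loop \<theta>))"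
    by (rule continuous_on_compose2[OF assms(2) cu]) (auto simp: unit_loop_def norm_exp_eq_Re)
  then have c: "continuous_on {0..1} ?h"
    using cu by (intro continuous_intros)
  then show i: "set_integrable lborel {0..1} ?h"
    unfolding set_integrable_def by (intro borel_integrable_compact) auto
  have "((\<lambda>x. f (circlepath 0 1 x) * vector_derivative (circlepath 0 1) (at x within {0..1})) has_integral I) {0..1}"
    using assms(1) by (simp add: has_contour_integral_def)
  then have "(?h has_integral I) {0..1}"
  proof (rule has_integral_eq[rotated])
    fix x :: real assume "x \<in> {0..1}"
    then show "f (circlepath 0 1 x) * vector_derivative (circlepath 0 1) (at x within {0..1}) =
        ?h x"
      by (simp add: vector_derivative_circlepath01) (simp add: circlepath unit_loop_def mult_ac)
  qed
  then show "(LBINT \<theta>:{0..1}. ?h \<theta>) = I"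
    using set_borel_integral_eq_integral(2)[OF i] by (simp add: integral_unique)
qed

section \<open>Series of rational functions\<close>

text \<open>A Tauberian converse to Abel's theorem. Beyond M the terms are nonnegative, so damped
  partial sums stay below the damped series; letting \<open>r i\<close> tend to 1 bounds the partial
  sums of R by I.\<close>

lemma power_series_limit_nonneg:
  fixes R :: "nat \<Rightarrow> real" and r :: "nat \<Rightarrow> real"
  assumes nn: "\<And>m. m \<ge> M \<Longrightarrow> R m \<ge> 0" and r: "\<And>i. 0 \<le> r i" "r \<longlonglongrightarrow> 1"
    and sm: "\<And>i. summable (\<lambda>m. r i ^ m * R m)"
    and lim: "(\<lambda>i. suminf (\<lambda>m. r i ^ m * R m)) \<longlonglongrightarrow> I"
  shows "summable R"
proof -
  have "(\<Sum>m<K. R m) \<le> I" if "K \<ge> M" for K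
  proof (rule LIMSEQ_le)
    have "(\<lambda>i. \<Sum>m<K. r i ^ m * R m) \<longlonglongrightarrow> (\<Sum>m<K. 1 ^ m * R m)"
      by (intro tendsto_intros r)
    then show "(\<lambda>i. \<Sum>m<K. r i ^ m * R m) \<longlonglongrightarrow> (\<Sum>m<K. R m)" by simp
    show "\<exists>N. \<forall>i\<ge>N. (\<Sum>m<K. r i ^ m * R m) \<le> (suminf (\<lambda>m. r i ^ m * R m))"
      using nn r(1) that by (intro exI[of _ 0] allI impI sum_le_suminf sm) auto
  qed (rule lim)
  then have b: "(\<Sum>m<K. R (m + M)) \<le> I - (\<Sum>m<M. R m)" for K
    using sum.atLeastLessThan_shift_bounds[of R 0 M K]  sum_up_index_split[of R]
      sum.nat_group[of R] sum.atLeastLessThan_concat[of 0 M "M + K" R]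
    by (smt (verit, best) add.commute le_add1 lessThan_atLeast0 add_0 zero_le sum.cong comp_apply)
  have "summable (\<lambda>m. R (m + M))"
    by (rule summableI_nonneg_bounded[OF _ b]) (use nn in auto)
  then show ?thesis by (simp add: summable_iff_shift)
qed

lemma power_series_limit_abs:
  fixes R :: "nat \<Rightarrow> real" and r :: "nat \<Rightarrow> real"
  assumes "summable (\<lambda>m. \<bar>R m\<bar>)" and r: "\<And>i. 0 \<le> r i" "\<And>i. r i \<le> 1" "r
      \<longlonglongrightarrow> 1"
  shows "(\<lambda>i. suminf (\<lambda>m. r i ^ m * R m)) \<longlonglongrightarrow> suminf R"
proof -
  have "(\<lambda>i. r i ^ m * R m) \<longlonglongrightarrow> R m" for m
    using tendsto_mult_right[OF tendsto_power[OF r(3), of m], of "R m"] by simp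
  moreover have "norm (r i ^ m * R m) \<le> \<bar>R m\<bar>" for i m
    using power_le_one[OF r(1)[of i] r(2)[of i], of m] r(1)[of i] by (simp add: abs_mult mult_left_le_one_le)
  ultimately show ?thesis
    using tannerys_theorem[where M = "\<lambda>m. \<bar>R m\<bar>" and a = "\<lambda>m i. r i ^ m * R m" and b = R
        and F = sequentially] assms(1)
    by (auto intro!: always_eventually)
qed

definition pf_sum :: "nat \<Rightarrow> pf_list \<Rightarrow> rat" where
  "pf_sum k d = (\<Sum>(c, j, l)\<leftarrow>d. if l = k then c else 0)"

lemma pf_sum_simps [simp]:
  "pf_sum k [] = 0" "pf_sum k ((c, j, l) # d) = (if l = k then c else 0) + pf_sum k d"
  "pf_sum k (d @ d') = pf_sum k d + pf_sum k d'"
  by (simp_all add: pf_sum_def)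

text \<open>A shift j does not affect the leading behaviour, and exponents above 1 disappear in the
  limit.\<close>

lemma pf_val_asymp:
  assumes "\<forall>(c, j, k)\<in>set d. k \<ge> 1 \<and> j \<ge> 1"
  shows "(\<lambda>m. real (Suc m) * of_rat (pf_val d m)) \<longlonglongrightarrow> of_rat (pf_sum 1 d)"
  using assms
proof (induction d)
  case (Cons a d)
  obtain c j k where a: "a = (c, j, k)" by (cases a)
  have j: "j \<ge> 1" and k: "k \<ge> 1" using Cons.prems by (auto simp: a)
  have q: "(\<lambda>m. real (Suc m) / real (m + j)) \<longlonglongrightarrow> 1" by real_asymp
  have "(\<lambda>m. inverse (real (m + j))) \<longlonglongrightarrow> 0" by real_asymp
  then have "(\<lambda>m. of_rat c * (real (Suc m) / real (m + j)) * inverse (real (m + j)) ^ (k - 1))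
      \<longlonglongrightarrow> of_rat c * 1 * 0 ^ (k - 1)"
    by (intro tendsto_intros q)
  also have "(\<lambda>m. of_rat c * (real (Suc m) / real (m + j)) * inverse (real (m + j)) ^ (k - 1)) =
     (\<lambda>m. real (Suc m) * of_rat (c / of_nat (m + j) ^ k))"
  proof
    fix m
    obtain l where l: "k = Suc l" using k by (cases k) auto
    show "of_rat c * (real (Suc m) / real (m + j)) * inverse (real (m + j)) ^ (k - 1) =
      real (Suc m) * of_rat (c / of_nat (m + j) ^ k)"
      by (simp add: l of_rat_divide of_rat_mult of_rat_inverse of_rat_power divide_inverse power_inverse mult_ac del:
          of_nat_Suc of_nat_add)
  qed
  also have "of_rat c * 1 * 0 ^ (k - 1) = (of_rat (if k = 1 then c else 0) :: real)" using k by auto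
  finally have "(\<lambda>m. real (Suc m) * of_rat (c / of_nat (m + j) ^ k) + real (Suc m) * of_rat (pf_val d m))
    \<longlonglongrightarrow> of_rat (if k = 1 then c else 0) + of_rat (pf_sum 1 d)"
    using Cons by (intro tendsto_add) auto
  then show ?case by (simp add: a of_rat_add distrib_left)
qed simp

text \<open>Multiplying by m + 1 collects the polynomial part and the 1/m coefficient of R in one
  polynomial Q. A positive leading coefficient would bound R below by a multiple of 1 / (m + 1),
  hence make R eventually nonnegative, hence summable by the Tauberian lemma, and the harmonic
  series would converge.\<close>

lemma rational_sum_no_divergence:
  fixes R :: "nat \<Rightarrow> real" and r :: "nat \<Rightarrow> real"
  assumes asymp: "(\<lambda>m. real (Suc m) * R m - poly Q (real m)) \<longlonglongrightarrow> 0"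
    and r: "\<And>i. 0 \<le> r i" "r \<longlonglongrightarrow> 1"
    and sm: "\<And>i. summable (\<lambda>m. r i ^ m * R m)"
    and lim: "(\<lambda>i. suminf (\<lambda>m. r i ^ m * R m)) \<longlonglongrightarrow> I"
  shows "\<not> lead_coeff Q > 0"
proof
  assume lc: "lead_coeff Q > 0"
  \<comment> \<open>Eventually Q is at least 2 * c; one c absorbs the error in the asymptotics and
    the other remains as the lower bound.\<close>
  define c where "c = lead_coeff Q / 2"
  have c: "c > 0" using lc by (simp add: c_def)
  obtain x0 where x0: "\<And>x. x \<ge> x0 \<Longrightarrow> poly Q x \<ge> lead_coeff Q" using poly_pinfty_gt_lc[OF lc] by blast
  obtain M1 where M1: "\<And>m. m \<ge> M1 \<Longrightarrow> norm (real (Suc m) * R m - poly Q (real m) - 0) < c"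
    using LIMSEQ_D[OF asymp c] by blast
  define M where "M = max M1 (nat \<lceil>x0\<rceil>)"
  have R: "R m \<ge> c / real (Suc m)" if "m \<ge> M" for m
  proof -
    have "real m \<ge> x0" using that unfolding M_def by linarith
    then have "poly Q (real m) \<ge> 2 * c" using x0 by (simp add: c_def)
    then have "real (Suc m) * R m \<ge> c" using M1[of m] that unfolding M_def by simp
    then show ?thesis by (simp add: divide_le_eq mult.commute del: of_nat_Suc)
  qed
  have "R m \<ge> 0" if "m \<ge> M" for m
    using R[OF that] c by (smt (verit) divide_nonneg_nonneg of_nat_0_le_iff)
  then have "summable R" using r sm lim by (rule power_series_limit_nonneg)
  then have "summable (\<lambda>m. c / real (Suc m))"
    by (rule summable_comparison_test'[where N = M]) (use R c in auto)
  from summable_mult[OF this, of "1 / c"] c have "summable (\<lambda>m. inverse (real (Suc m)))"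
    by (simp add: divide_inverse del: of_nat_Suc)
  then show False using not_summable_harmonic[where 'a = real] summable_Suc_iff[of "\<lambda>m. inverse (real m)"] by blast
qed

text \<open>Minus c times the initial segment of the zeta series that a shift by j skips. For k = 1
  the same expression is c times the sum of 1 / (m + j) - 1 / (m + 1).\<close>

definition zeta_tail_const :: "rat \<Rightarrow> nat \<Rightarrow> nat \<Rightarrow> rat" where
  "zeta_tail_const c j k = - c * (\<Sum>i<j - 1. 1 / of_nat (Suc i) ^ k)"

lemma zeta_summable: "k \<ge> 2 \<Longrightarrow> summable (\<lambda>m. 1 / real (Suc m) ^ k)"
  using inverse_power_summable[of k, where 'a = real] summable_Suc_iff[of "\<lambda>m. inverse (real m ^ k)"]
  by (simp add: inverse_eq_divide)

text \<open>Terms of exponent 1 are compared with c / (m + 1) so that each of them is summable by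
  itself; over a whole list the comparison terms add up to the sum of these coefficients, which
  turns out to be 0.\<close>

lemma pf_term_sums:
  fixes c :: rat
  assumes "j \<ge> 1" "k \<ge> 1"
  defines "t \<equiv> (\<lambda>m. of_rat c / real (m + j) ^ k - (if k = 1 then of_rat c / real (Suc m) else 0))"
  shows "t sums ((if k = 1 then 0 else of_rat c * zeta_val k) + of_rat (zeta_tail_const c j k))"
    and "summable (\<lambda>m. \<bar>t m\<bar>)"
proof -
  have "t sums ((if k = 1 then 0 else of_rat c * zeta_val k) + of_rat (zeta_tail_const c j k)) \<and>
    summable (\<lambda>m. \<bar>t m\<bar>)"
  proof (cases "k = 1")
    case True
    \<comment> \<open>A window of j - 1 consecutive reciprocals; moving it by one step turns the
      series into a telescoping one.\<close>
    define f where "f m = (\<Sum>i<j - 1. 1 / real (Suc (m + i)))" for m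
    have step: "f (Suc m) - f m = 1 / real (m + j) - 1 / real (Suc m)" for m
    proof -
      have "f m + 1 / real (Suc (m + (j - 1))) = (\<Sum>i<Suc (j - 1). 1 / real (Suc (m + i)))"
        by (simp add: f_def)
      also have "\<dots> = 1 / real (Suc m) + f (Suc m)"
        by (subst sum.lessThan_Suc_shift) (simp add: f_def)
      finally show ?thesis using assms(1) by simp
    qed
    have "f \<longlonglongrightarrow> (\<Sum>i<j - 1. 0)" unfolding f_def
      by (intro tendsto_sum) real_asymp
    then have "(\<lambda>m. f (Suc m) - f m) sums (0 - f 0)" by (intro telescope_sums) simp
    from sums_mult[OF this, of "of_rat c"]
    have s: "t sums (of_rat (zeta_tail_const c j k))"
      unfolding step by (simp add: True t_def f_def zeta_tail_const_def of_rat_mult of_rat_minus of_rat_sum of_rat_divide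
          right_diff_distrib of_rat_add)
    have "1 / real (m + j) \<le> 1 / real (Suc m)" for m using assms(1) by (simp add: frac_le)
    then have fm: "f (Suc m) - f m \<le> 0" for m unfolding step by (simp del: of_nat_Suc of_nat_add)
    have tm: "t m = of_rat c * (f (Suc m) - f m)" for m
      unfolding step by (simp add: True t_def right_diff_distrib)
    have a: "\<bar>t m\<bar> = - (\<bar>of_rat c\<bar> * (f (Suc m) - f m))" for m
      unfolding tm abs_mult abs_of_nonpos[OF fm] by (simp add: right_diff_distrib)
    have "summable (\<lambda>m. - (\<bar>of_rat c\<bar> * (f (Suc m) - f m)))"
      using \<open>(\<lambda>m. f (Suc m) - f m) sums (0 - f 0)\<close>
      by (intro summable_minus summable_mult) (rule sums_summable)
    then have "summable (\<lambda>m. \<bar>t m\<bar>)" unfolding a .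
    then show ?thesis using s True by simp
  next
    case False
    then have k: "k \<ge> 2" using assms(2) by simp
    let ?g = "\<lambda>m. 1 / real (Suc m) ^ k"
    have "?g sums zeta_val k" using zeta_summable[OF k] by (simp add: zeta_val_def summable_sums)
    from sums_split_initial_segment[OF this, of "j - 1"]
    have "(\<lambda>m. 1 / real (m + j) ^ k) sums (zeta_val k - (\<Sum>i<j - 1. ?g i))" using assms(1) by simp
    from sums_mult[OF this, of "of_rat c"]
    have "t sums (of_rat c * (zeta_val k - (\<Sum>i<j - 1. ?g i)))" using False by (simp add: t_def)
    moreover have "of_rat c * (zeta_val k - (\<Sum>i<j - 1. ?g i)) =
       of_rat c * zeta_val k + of_rat (zeta_tail_const c j k)"
      by (simp add: zeta_tail_const_def of_rat_mult of_rat_minus of_rat_sum of_rat_divide of_rat_power of_rat_add algebra_simps)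
    moreover have "summable (\<lambda>m. \<bar>t m\<bar>)"
      using summable_mult[OF sums_summable[OF \<open>(\<lambda>m. 1 / real (m + j) ^ k) sums _\<close>],
          of "\<bar>of_rat c\<bar>"] False
      by (simp add: t_def abs_mult)
    ultimately show ?thesis using False by simp
  qed
  then show "t sums ((if k = 1 then 0 else of_rat c * zeta_val k) + of_rat (zeta_tail_const c j k))"
    "summable (\<lambda>m. \<bar>t m\<bar>)" by auto
qed

abbreviation pf_bounded :: "nat \<Rightarrow> pf_list \<Rightarrow> bool" where
  "pf_bounded n d \<equiv> \<forall>(c, j, k)\<in>set d. k \<ge> 1 \<and> j \<ge> 1 \<and> k \<le> n"

lemma pf_sums:
  fixes d :: "pf_list"
  assumes "pf_bounded n d"
  defines "t \<equiv> (\<lambda>m. of_rat (pf_val d m) - of_rat (pf_sum 1 d) / real (Suc m))"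
  shows "t sums ((\<Sum>k=2..n. of_rat (pf_sum k d) * zeta_val k) +
      of_rat (\<Sum>(c, j, k)\<leftarrow>d. zeta_tail_const c j k)) \<and> summable (\<lambda>m. \<bar>t m\<bar>)"
  using assms(1) unfolding t_def
proof (induction d)
  case (Cons a d)
  obtain c j k where a: "a = (c, j, k)" by (cases a)
  have jk: "j \<ge> 1" "k \<ge> 1" "k \<le> n" using Cons.prems by (auto simp: a)
  define t1 where "t1 m = of_rat c / real (m + j) ^ k - (if k = 1 then of_rat c / real (Suc m) else 0)" for m
  define t2 where "t2 m = of_rat (pf_val d m) - of_rat (pf_sum 1 d) / real (Suc m)" for m
  have eq: "of_rat (pf_val (a # d) m) - of_rat (pf_sum 1 (a # d)) / real (Suc m) = t1 m + t2 m" for m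
    by (simp add: a t1_def t2_def of_rat_add of_rat_divide of_rat_power add_divide_distrib)
  have "(\<Sum>l=2..n. of_rat (if k = l then c else 0) * zeta_val l) =
    (if k = 1 then 0 else of_rat c * zeta_val k)"
  proof (cases "k = 1")
    case False
    then have "(\<Sum>l=2..n. of_rat (if k = l then c else 0) * zeta_val l) =
      (\<Sum>l\<in>{k}. of_rat (if k = l then c else 0) * zeta_val l)"
      using jk by (intro sum.mono_neutral_right) auto
    then show ?thesis using False by simp
  qed (auto intro!: sum.neutral)
  then have Z: "(\<Sum>l=2..n. of_rat (pf_sum l (a # d)) * zeta_val l) =
      (if k = 1 then 0 else of_rat c * zeta_val k) + (\<Sum>l=2..n. of_rat (pf_sum l d) * zeta_val l)"
    by (simp add: a of_rat_add distrib_right sum.distrib del: of_rat_0)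
  have s1: "t1 sums ((if k = 1 then 0 else of_rat c * zeta_val k) + of_rat (zeta_tail_const c j k))"
    "summable (\<lambda>m. \<bar>t1 m\<bar>)"
    using pf_term_sums[OF jk(1,2), of c] unfolding t1_def[abs_def] by auto
  have s2: "t2 sums ((\<Sum>k=2..n. of_rat (pf_sum k d) * zeta_val k) +
      of_rat (\<Sum>(c, j, k)\<leftarrow>d. zeta_tail_const c j k))" "summable (\<lambda>m. \<bar>t2 m\<bar>)"
    using Cons unfolding t2_def[abs_def] by auto
  have "summable (\<lambda>m. \<bar>t1 m + t2 m\<bar>)"
    by (rule summable_comparison_test'[OF summable_add[OF s1(2) s2(2)], where N = 0]) (auto simp: abs_triangle_ineq)
  moreover have "(\<lambda>m. t1 m + t2 m) sums ((\<Sum>l=2..n. of_rat (pf_sum l (a # d)) * zeta_val l) +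
      of_rat (\<Sum>(c, j, k)\<leftarrow>a # d. zeta_tail_const c j k))"
    using sums_add[OF s1(1) s2(1)] unfolding Z by (simp add: a of_rat_add add_ac)
  ultimately show ?case unfolding eq by simp
qed (simp add: sums_zero)

text \<open>The mere existence of the limit I, used for R and for -R, leaves no sign for the leading
  coefficient of Q, so Q = 0. Then R is absolutely summable and I is its ordinary sum.\<close>

lemma rational_sum_value:
  fixes r :: "nat \<Rightarrow> real" and P :: "rat poly" and d :: "pf_list"
  defines "R \<equiv> (\<lambda>m. of_rat (poly P (of_nat m) + pf_val d m) :: real)"
  assumes d: "pf_bounded n d"
    and r: "\<And>i. 0 \<le> r i" "\<And>i. r i \<le> 1" "r \<longlonglongrightarrow> 1"
    and sm: "\<And>i. summable (\<lambda>m. r i ^ m * R m)"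
    and lim: "(\<lambda>i. suminf (\<lambda>m. r i ^ m * R m)) \<longlonglongrightarrow> I"
  shows "I = (\<Sum>k=2..n. of_rat (pf_sum k d) * zeta_val k) + of_rat (\<Sum>(c, j, k)\<leftarrow>d. zeta_tail_const c j k)"
proof -
  define P' :: "real poly" where "P' = map_poly of_rat P"
  have P': "of_rat (poly P (of_nat m)) = poly P' (real m)" for m
  proof -
    have "of_rat (poly P x) = poly P' (of_rat x)" for x
      unfolding P'_def by (induction P) (simp_all add: map_poly_pCons of_rat_add of_rat_mult)
    then show ?thesis by (metis of_rat_of_nat_eq)
  qed
  define A :: real where "A = of_rat (pf_sum 1 d)"
  define Q where "Q = [:1, 1:] * P' + [:A:]"
  have asymp: "(\<lambda>m. real (Suc m) * R m - poly Q (real m)) \<longlonglongrightarrow> 0"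
  proof -
    have "(\<lambda>m. real (Suc m) * of_rat (pf_val d m) - A) \<longlonglongrightarrow> A - A"
      unfolding A_def by (intro tendsto_intros pf_val_asymp) (use d in auto)
    moreover have "real (Suc m) * R m - poly Q (real m) = real (Suc m) * of_rat (pf_val d m) - A" for m
      by (simp add: R_def Q_def of_rat_add P' algebra_simps)
    ultimately show ?thesis by simp
  qed
  have "\<not> lead_coeff Q > 0" by (rule rational_sum_no_divergence[OF asymp r(1,3) sm lim])
  moreover have "\<not> lead_coeff (- Q) > 0"
  proof (rule rational_sum_no_divergence[where R = "\<lambda>m. - R m" and I = "- I" and r = r])
    show "(\<lambda>m. real (Suc m) * - R m - poly (- Q) (real m)) \<longlonglongrightarrow> 0"
      using tendsto_minus[OF asymp] by simp
    show "summable (\<lambda>m. r i ^ m * - R m)" for i using summable_minus[OF sm[of i]] by simp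
    show "(\<lambda>i. suminf (\<lambda>m. r i ^ m * - R m)) \<longlonglongrightarrow> - I"
      using tendsto_minus[OF lim] by (simp add: suminf_minus[OF sm])
  qed (use r in auto)
  ultimately have "lead_coeff Q = 0" by simp
  then have "Q = 0" by (simp only: leading_coeff_0_iff)
  then have Q: "[:1, 1:] * P' = - [:A:]" unfolding Q_def by (rule eq_neg_iff_add_eq_0[THEN iffD2])
  \<comment> \<open>A nonzero multiple of x + 1 has positive degree and cannot equal the constant
    -A; afterwards A = 0 follows as well.\<close>
  have P0: "P' = 0"
  proof (rule ccontr)
    assume "P' \<noteq> 0"
    then have "degree ([:1, 1:] * P') = 1 + degree P'" by (subst degree_mult_eq) auto
    then show False by (simp only: Q) simp
  qed
  then have A0: "A = 0" using Q by simp
  have R: "R m = of_rat (pf_val d m) - of_rat (pf_sum 1 d) / real (Suc m)" for m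
    using P'[of m] A0 by (simp add: R_def A_def P0 of_rat_add)
  have s: "R sums ((\<Sum>k=2..n. of_rat (pf_sum k d) * zeta_val k) +
      of_rat (\<Sum>(c, j, k)\<leftarrow>d. zeta_tail_const c j k))" "summable (\<lambda>m. \<bar>R m\<bar>)"
    using pf_sums[OF d] unfolding R[symmetric] by auto
  have "(\<lambda>i. suminf (\<lambda>m. r i ^ m * R m)) \<longlonglongrightarrow> suminf R"
    by (rule power_series_limit_abs[OF s(2) r])
  then have "I = suminf R" using lim LIMSEQ_unique by blast
  then show ?thesis using s(1) sums_unique by metis
qed

section \<open>The integral over the cube\<close>

abbreviation lborel_on :: "'i set \<Rightarrow> ('i \<Rightarrow> real) measure" where
  "lborel_on I \<equiv> PiM I (\<lambda>_. lborel)"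

abbreviation lborel_n :: "nat \<Rightarrow> (nat \<Rightarrow> real) measure" where
  "lborel_n n \<equiv> lborel_on {1..n}"

lemma product_lborel: "product_sigma_finite (\<lambda>_::nat. lborel :: real measure)"
  by (simp add: product_sigma_finite_def lborel.sigma_finite_measure_axioms)

lemma AE_PiM_lborel_neq:
  assumes "finite I" "i \<in> I"
  shows "AE x in lborel_on I. x i \<noteq> (c::real)"
proof -
  interpret product_sigma_finite "\<lambda>_::'a. lborel :: real measure"
    by (simp add: product_sigma_finite_def lborel.sigma_finite_measure_axioms)
  let ?A = "Pi\<^sub>E I (\<lambda>j. if j = i then {c} else UNIV)"
  have "emeasure (lborel_on I) ?A = (\<Prod>j\<in>I. emeasure lborel (if j = i then {c} else UNIV))"
    using assms by (intro emeasure_PiM) auto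
  also have "\<dots> = 0" using assms by (intro prod_zero) auto
  finally have "?A \<in> null_sets (lborel_on I)"
    using assms by (auto intro!: null_setsI sets_PiM_I_finite)
  then show ?thesis
    by (rule AE_I') (auto simp: space_PiM PiE_iff extensional_def)
qed

lemma unit_cube_measurable [measurable]: "unit_cube n \<in> sets (lborel_n n)"
  unfolding unit_cube_def by (intro sets_PiM_I_finite) auto

lemma eval_rat_mpoly_measurable [measurable]:
  "(eval_rat_mpoly n P :: (nat \<Rightarrow> real) \<Rightarrow> real) \<in> borel_measurable (lborel_n n)"
  unfolding eval_rat_mpoly_def[abs_def] by measurable

lemma form_coeff_measurable [measurable]:
  "(form_coeff n P N :: (nat \<Rightarrow> real) \<Rightarrow> real) \<in> borel_measurable (lborel_n n)"
  unfolding form_coeff_def[abs_def] by measurable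

lemma cube_monomial_integral:
  shows "integrable (lborel_n n) (\<lambda>x. indicator (unit_cube n) x * (\<Prod>i\<in>{1..n}. x i ^ e i))"
    and "(\<integral>x. indicator (unit_cube n) x * (\<Prod>i\<in>{1..n}. x i ^ e i) \<partial>lborel_n n) =
      (\<Prod>i\<in>{1..n}. 1 / real (Suc (e i)))"
proof -
  interpret product_sigma_finite "\<lambda>_::nat. lborel :: real measure" by (rule product_lborel)
  let ?f = "\<lambda>i x. x ^ e i * indicator {0..1} x :: real"
  have i: "integrable lborel (?f i)" for i
  proof -
    have "integrable lborel (\<lambda>x::real. indicator {0..1} x *\<^sub>R (x ^ e i))"
      by (rule borel_integrable_compact) (auto intro!: continuous_intros)
    then show ?thesis by (simp add: mult.commute)
  qed
  have v: "(\<integral>x. ?f i x \<partial>lborel) = 1 / real (Suc (e i))" for i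
    by (subst integral_power) simp_all
  have eq: "indicator (unit_cube n) x * (\<Prod>i\<in>{1..n}. x i ^ e i) = (\<Prod>i\<in>{1..n}. ?f i (x i))"
    if xs: "x \<in> space (lborel_n n)" for x
  proof (cases "x \<in> unit_cube n")
    case True
    then show ?thesis by (auto simp: unit_cube_def PiE_iff intro!: prod.cong)
  next
    case False
    then obtain i where "i \<in> {1..n}" "x i \<notin> {0..1}"
      using xs by (auto simp: unit_cube_def PiE_def Pi_def space_PiM)
    then have "(\<Prod>i\<in>{1..n}. ?f i (x i)) = 0" by (intro prod_zero bexI[of _ i]) auto
    then show ?thesis using False by simp
  qed
  show "integrable (lborel_n n) (\<lambda>x. indicator (unit_cube n) x * (\<Prod>i\<in>{1..n}. x i ^ e i))"
    using product_integrable_prod[OF finite_atLeastAtMost i, of 1 n]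
    by (subst Bochner_Integration.integrable_cong[OF refl eq]) auto
  show "(\<integral>x. indicator (unit_cube n) x * (\<Prod>i\<in>{1..n}. x i ^ e i) \<partial>lborel_n n) =
      (\<Prod>i\<in>{1..n}. 1 / real (Suc (e i)))"
    using product_integral_prod[OF finite_atLeastAtMost i, of 1 n] v
    by (subst Bochner_Integration.integral_cong[OF refl eq]) auto
qed

lemma negative_binomial_series:
  fixes z :: real
  assumes "\<bar>z\<bar> < 1"
  shows "(\<lambda>m. real ((m + N) choose m) * z ^ m) sums (1 / (1 - z) ^ Suc N)"
proof -
  have "(\<lambda>m. (- real (Suc N) gchoose m) * (- z) ^ m) sums (1 + - z) powr (- real (Suc N))"
    by (rule gen_binomial_real) (use assms in simp)
  moreover have "(- real (Suc N) gchoose m) * (- z) ^ m = real ((m + N) choose m) * z ^ m" for m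
  proof -
    have "(- real (Suc N) gchoose m) = (-1) ^ m * real ((m + N) choose m)"
      by (subst gbinomial_minus) (simp add: binomial_gbinomial add_ac)
    moreover have "(- z) ^ m = (-1) ^ m * z ^ m" by (rule power_minus)
    ultimately show ?thesis by (simp add: mult_ac flip: power_mult_distrib)
  qed
  moreover have "(1 + - z) powr (- real (Suc N)) = 1 / (1 - z) ^ Suc N"
    using assms by (simp add: powr_minus powr_realpow divide_inverse del: of_nat_Suc power_Suc)
  ultimately show ?thesis by simp
qed

text \<open>The coefficient of r^m in the damped integral for the denominator exponent
  \<open>Suc N\<close>, not N; forms without denominator are integrated directly.\<close>

definition term_seq :: "nat \<Rightarrow> rat_mpoly \<Rightarrow> nat \<Rightarrow> nat \<Rightarrow> rat" where
  "term_seq n P N m = (\<Sum>e\<in>keys P. lookup P e *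
     (of_nat ((m + N) choose m) * (\<Prod>i\<in>{1..n}. 1 / of_nat (m + Suc (lookup e i)))))"

text \<open>For r < 1 the convergent series of r^m (m + N choose m) dominates the integrals of the
  terms, so summation and integration commute for every monomial, including those whose undamped
  integral diverges.\<close>

lemma damped_monomial_integral:
  assumes r: "0 \<le> r" "r < 1"
  shows "(\<lambda>m. r ^ m * (real ((m + N) choose m) * (\<Prod>i\<in>{1..n}. 1 / real (m + Suc (e i))))) sums
    (\<integral>x. indicator (unit_cube n) x * ((\<Prod>i\<in>{1..n}. x i ^ e i) / (1 - r *
        (\<Prod>i\<in>{1..n}. x i)) ^ Suc N) \<partial>lborel_n n)"
    "integrable (lborel_n n) (\<lambda>x. indicator (unit_cube n) x * ((\<Prod>i\<in>{1..n}. x i ^ e i) / (1 - r *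
        (\<Prod>i\<in>{1..n}. x i)) ^ Suc N))"
proof -
  let ?g = "\<lambda>x. indicator (unit_cube n) x * ((\<Prod>i\<in>{1..n}. x i ^ e i) / (1 - r *
      (\<Prod>i\<in>{1..n}. x i)) ^ Suc N)"
  let ?q = "\<lambda>m. \<Prod>i\<in>{1..n}. 1 / real (m + Suc (e i))"
  define f where "f m x = r ^ m * real ((m + N) choose m) *
    (indicator (unit_cube n) x * (\<Prod>i\<in>{1..n}. x i ^ (m + e i)))" for m and x :: "nat \<Rightarrow> real"
  have i: "integrable (lborel_n n) (f m)" for m
    unfolding f_def by (intro integrable_mult_right cube_monomial_integral)
  have v: "(\<integral>x. f m x \<partial>lborel_n n) = r ^ m * (real ((m + N) choose m) * ?q m)" for m
    unfolding f_def by (simp only: integral_mult_right_zero cube_monomial_integral(2) add_Suc_right mult.assoc)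
  have nn: "f m x \<ge> 0" for m x
    unfolding f_def using r
    by (cases "x \<in> unit_cube n") (auto simp: unit_cube_def PiE_iff intro!: mult_nonneg_nonneg prod_nonneg)
  have s: "(\<lambda>m. f m x) sums (?g x)" for x
  proof (cases "x \<in> unit_cube n")
    case True
    then have "0 \<le> (\<Prod>i\<in>{1..n}. x i)" "(\<Prod>i\<in>{1..n}. x i) \<le> 1"
      by (auto simp: unit_cube_def PiE_iff intro!: prod_nonneg prod_le_1)
    then have "\<bar>r * (\<Prod>i\<in>{1..n}. x i)\<bar> < 1"
      using r by (smt (verit, best) abs_of_nonneg mult_left_le mult_nonneg_nonneg)
    from sums_mult[OF negative_binomial_series[OF this, of N], of "\<Prod>i\<in>{1..n}. x i ^ e i"]
    show ?thesis using True
      by (simp add: f_def power_add prod.distrib power_mult_distrib prod_power_distrib mult_ac del: power_Suc)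
  qed (simp add: f_def)
  have sn: "summable (\<lambda>m. r ^ m * real ((m + N) choose m))"
    using negative_binomial_series[of r N] r by (simp add: sums_iff mult.commute)
  have A: "summable (\<lambda>m. \<integral>x. norm (f m x) \<partial>lborel_n n)"
  proof (rule summable_comparison_test'[OF sn, of 0])
    fix m
    have "?q m \<le> 1" by (intro prod_le_1) auto
    moreover have "?q m \<ge> 0" by (intro prod_nonneg) auto
    ultimately have "r ^ m * real ((m + N) choose m) * ?q m \<le> r ^ m * real ((m + N) choose m)"
       "0 \<le> r ^ m * real ((m + N) choose m) * ?q m"
      using r by (auto intro!: mult_left_le mult_nonneg_nonneg)
    then show "norm (\<integral>x. norm (f m x) \<partial>lborel_n n) \<le> r ^ m * real ((m + N) choose m)"
      using nn by (simp add: v mult.assoc del: of_nat_Suc One_nat_def)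
  qed
  have B: "AE x in lborel_n n. summable (\<lambda>m. norm (f m x))"
    using sums_summable[OF s] nn by simp
  have *: "(\<lambda>m. \<integral>x. f m x \<partial>lborel_n n) sums (\<integral>x. suminf (\<lambda>m. f m x)
      \<partial>lborel_n n)"
    "integrable (lborel_n n) (\<lambda>x. suminf (\<lambda>m. f m x))"
    by (rule sums_integral[OF i B A], rule integrable_suminf[OF i B A])
  have e: "suminf (\<lambda>m. f m x) = ?g x" for x
    using sums_unique[OF s] by simp
  show "(\<lambda>m. r ^ m * (real ((m + N) choose m) * ?q m)) sums
    (\<integral>x. ?g x \<partial>lborel_n n)"
    using *(1) unfolding e v .
  show "integrable (lborel_n n) (\<lambda>x. ?g x)"
    using *(2) unfolding e .
qed

lemma damped_cube_integral:
  assumes r: "0 \<le> r" "r < 1"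
  shows "(\<lambda>m. r ^ m * of_rat (term_seq n P N m)) sums
    (\<integral>x. indicator (unit_cube n) x * (eval_rat_mpoly n P x / (1 - r *
        (\<Prod>i\<in>{1..n}. x i)) ^ Suc N) \<partial>lborel_n n)"
proof -
  let ?g = "\<lambda>e x. indicator (unit_cube n) x * ((\<Prod>i\<in>{1..n}. x i ^ lookup e i) / (1 - r *
      (\<Prod>i\<in>{1..n}. x i)) ^ Suc N)"
  have "(\<lambda>m. \<Sum>e\<in>keys P. of_rat (lookup P e) *
      (r ^ m * (real ((m + N) choose m) * (\<Prod>i\<in>{1..n}. 1 / real (m + Suc (lookup e i)))))) sums
    (\<Sum>e\<in>keys P. of_rat (lookup P e) * (\<integral>x. ?g e x \<partial>lborel_n n))"
    by (intro sums_sum sums_mult damped_monomial_integral r)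
  also have "(\<Sum>e\<in>keys P. of_rat (lookup P e) * (\<integral>x. ?g e x \<partial>lborel_n n)) =
      (\<integral>x. (\<Sum>e\<in>keys P. of_rat (lookup P e) * ?g e x) \<partial>lborel_n n)"
  proof (subst Bochner_Integration.integral_sum)
    show "integrable (lborel_n n) (\<lambda>x. of_rat (lookup P e) * ?g e x)" for e
      by (intro integrable_mult_right damped_monomial_integral r)
  qed (simp only: integral_mult_right_zero)
  also have "(\<lambda>x. \<Sum>e\<in>keys P. of_rat (lookup P e) * ?g e x) =
     (\<lambda>x. indicator (unit_cube n) x * (eval_rat_mpoly n P x / (1 - r * (\<Prod>i\<in>{1..n}. x i)) ^ Suc N))"
    by (simp add: eval_rat_mpoly_def sum_distrib_left sum_divide_distrib mult_ac fun_eq_iff del: power_Suc)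
  also have "(\<lambda>m. \<Sum>e\<in>keys P. of_rat (lookup P e) *
      (r ^ m * (real ((m + N) choose m) * (\<Prod>i\<in>{1..n}. 1 / real (m + Suc (lookup e i)))))) =
     (\<lambda>m. r ^ m * of_rat (term_seq n P N m))"
    by (simp add: term_seq_def of_rat_sum of_rat_mult of_rat_prod of_rat_divide sum_distrib_left mult_ac fun_eq_iff
      of_rat_of_nat_eq del: of_nat_Suc of_nat_add)
  finally show ?thesis .
qed

lemma cube_integral_eq:
  "cube_integral n P N = (\<integral>x. indicator (unit_cube n) x * form_coeff n P N x \<partial>lborel_n n)"
proof -
  have "(\<lambda>x. indicator (unit_cube n) x *\<^sub>R form_coeff n P N x :: real) \<in> borel_measurable (lborel_n n)"
    by measurable
  from integral_completion[OF this] show ?thesis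
    by (simp add: cube_integral_def lebesgue_n_def set_lebesgue_integral_def)
qed

lemma cube_integral_0:
  "cube_integral n P 0 = of_rat (\<Sum>e\<in>keys P. lookup P e *
      (\<Prod>i\<in>{1..n}. 1 / of_nat (Suc (lookup e i))))"
proof -
  let ?g = "\<lambda>e x. indicator (unit_cube n) x * (\<Prod>i\<in>{1..n}. x i ^ lookup e i) :: real"
  have "cube_integral n P 0 = (\<integral>x. (\<Sum>e\<in>keys P. of_rat (lookup P e) * ?g e x) \<partial>lborel_n n)"
    unfolding cube_integral_eq
    by (simp add: form_coeff_def eval_rat_mpoly_def sum_distrib_left mult_ac)
  also have "\<dots> = (\<Sum>e\<in>keys P. of_rat (lookup P e) * (\<integral>x. ?g e x \<partial>lborel_n n))"
  proof (subst Bochner_Integration.integral_sum)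
    show "integrable (lborel_n n) (\<lambda>x. of_rat (lookup P e) * ?g e x)" for e
      by (intro integrable_mult_right cube_monomial_integral)
  qed (simp only: integral_mult_right_zero)
  also have "\<dots> = of_rat (\<Sum>e\<in>keys P. lookup P e *
      (\<Prod>i\<in>{1..n}. 1 / of_nat (Suc (lookup e i))))"
    by (simp only: cube_monomial_integral(2) of_rat_sum of_rat_mult of_rat_prod of_rat_divide of_rat_of_nat_eq of_rat_1)
  finally show ?thesis .
qed

text \<open>
  Only the sum over all monomials of \<open>P\<close> is integrable, so the geometric series is summed for the damped
  integrand, which is dominated by the original one since \<open>0 \<le> 1 - u \<le> 1 - r u\<close>.
\<close>

lemma cube_integral_limit:
  assumes "n \<ge> 1" "integrable_form n P (Suc N)" and r: "\<And>i. 0 \<le> r i" "\<And>i. r i < 1" "r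
      \<longlonglongrightarrow> 1"
  shows "(\<lambda>i. suminf (\<lambda>m. r i ^ m * of_rat (term_seq n P N m))) \<longlonglongrightarrow>
      cube_integral n P (Suc N)"
proof -
  let ?u = "\<lambda>x. \<Prod>i\<in>{1..n}. x i :: real"
  define s where "s i x = indicator (unit_cube n) x * (eval_rat_mpoly n P x / (1 - r i * ?u x) ^ Suc N)" for i x
  have s: "suminf (\<lambda>m. r i ^ m * of_rat (term_seq n P N m)) = (\<integral>x. s i x \<partial>lborel_n n)" for i
    using damped_cube_integral[OF r(1,2), of i n P N] unfolding s_def by (simp add: sums_iff)
  define w where "w x = indicator (unit_cube n) x * form_coeff n P (Suc N) x" for x :: "nat \<Rightarrow> real"
  have w_meas: "w \<in> borel_measurable (lborel_n n)" unfolding w_def by measurable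
  have w: "integrable (lborel_n n) w"
    using assms(2) w_meas integrable_completion[of w "lborel_n n"]
    unfolding integrable_form_def set_integrable_def lebesgue_n_def w_def by simp
  have meas: "s i \<in> borel_measurable (lborel_n n)" for i unfolding s_def by measurable
  \<comment> \<open>On the cube the product of the coordinates is 1 only if all of them are 1, so
    discarding the null set \<open>x 1 = 1\<close> keeps the denominator away from 0.\<close>
  have "AE x in lborel_n n. x 1 \<noteq> 1"
    by (rule AE_PiM_lborel_neq) (use assms(1) in auto)
  then have u1: "AE x in lborel_n n. x \<in> unit_cube n \<longrightarrow> ?u x < 1"
  proof eventually_elim
    case (elim x)
    show ?case
    proof
      assume x: "x \<in> unit_cube n"
      have "?u x = x 1 * (\<Prod>i\<in>{1..n} - {1}. x i)" using assms(1) by (intro prod.remove) auto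
      also have "\<dots> \<le> x 1 * 1"
        using x assms(1) by (intro mult_left_mono prod_le_1) (auto simp: unit_cube_def PiE_iff)
      also have "\<dots> < 1" using elim assms(1) x by (auto simp: unit_cube_def PiE_iff less_le)
      finally show "?u x < 1" .
    qed
  qed
  have u0: "?u x \<ge> 0" if "x \<in> unit_cube n" for x
    using that by (intro prod_nonneg) (auto simp: unit_cube_def PiE_iff)
  have "(\<lambda>i. \<integral>x. s i x \<partial>lborel_n n) \<longlonglongrightarrow> (\<integral>x. w x \<partial>lborel_n n)"
  proof (rule integral_dominated_convergence[where w = "\<lambda>x. norm (w x)"])
    show "integrable (lborel_n n) (\<lambda>x. norm (w x))" using w by simp
    show "AE x in lborel_n n. (\<lambda>i. s i x) \<longlonglongrightarrow> w x"
      using u1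
    proof eventually_elim
      case (elim x)
      show ?case
      proof (cases "x \<in> unit_cube n")
        case True
        then have "(\<lambda>i. eval_rat_mpoly n P x / (1 - r i * ?u x) ^ Suc N) \<longlonglongrightarrow>
          eval_rat_mpoly n P x / (1 - 1 * ?u x) ^ Suc N"
          using elim by (intro tendsto_intros r) auto
        then show ?thesis using True by (simp add: s_def w_def form_coeff_def)
      qed (simp add: s_def w_def)
    qed
    show "AE x in lborel_n n. norm (s i x) \<le> norm (w x)" for i
      using u1
    proof eventually_elim
      case (elim x)
      show ?case
      proof (cases "x \<in> unit_cube n")
        case True
        have "r i * ?u x \<le> ?u x" using u0[OF True] r(1,2)[of i] by (simp add: mult_left_le_one_le)
        then have "(1 - ?u x) ^ Suc N \<le> (1 - r i * ?u x) ^ Suc N" "0 < (1 - ?u x) ^ Suc N"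
          using elim True by (auto intro!: power_mono simp del: power_Suc)
        then have "\<bar>eval_rat_mpoly n P x\<bar> / (1 - r i *
            ?u x) ^ Suc N \<le> \<bar>eval_rat_mpoly n P x\<bar> / (1 - ?u x) ^ Suc N"
          by (intro divide_left_mono mult_pos_pos) auto
        then show ?thesis using True \<open>0 < (1 - ?u x) ^ Suc N\<close> \<open>(1 - ?u x) ^ Suc N \<le> (1 - r i *
            ?u x) ^ Suc N\<close>
          by (simp add: s_def w_def form_coeff_def abs_divide del: power_Suc)
      qed (simp add: s_def w_def)
    qed
  qed (use w_meas meas in auto)
  then show ?thesis unfolding s cube_integral_eq w_def .
qed

section \<open>Measure preserving maps\<close>

text \<open>Fubini with the new coordinate as the outer variable, the order needed to peel off the
  outermost variable of a simplex.\<close>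

lemma (in product_sigma_finite) product_integral_insert_rev:
  fixes f :: "_ \<Rightarrow> _::{banach, second_countable_topology}"
  assumes I: "finite I" "i \<notin> I" and f: "integrable (Pi\<^sub>M (insert i I) M) f"
  shows "integral\<^sup>L (Pi\<^sub>M (insert i I) M) f = (\<integral>y. (\<integral>x. f (x(i := y))
      \<partial>Pi\<^sub>M I M) \<partial>M i)"
proof -
  interpret finite_product_sigma_finite M I by standard fact
  have fm: "f \<in> borel_measurable (Pi\<^sub>M (insert i I) M)" using f by auto
  have "(\<lambda>p. f ((snd p)(i := fst p))) \<in> borel_measurable (M i \<Otimes>\<^sub>M Pi\<^sub>M I M)"
    by (rule measurable_compose[OF _ fm]) measurable
  then have m: "(\<lambda>y. \<integral>x. f (x(i := y)) \<partial>Pi\<^sub>M I M) \<in> borel_measurable (M i)"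
    by (intro borel_measurable_lebesgue_integral) (simp add: case_prod_beta)
  have "integral\<^sup>L (Pi\<^sub>M (insert i I) M) f = integral\<^sup>L (Pi\<^sub>M ({i} \<union> I) M) f" by simp
  also have "\<dots> = (\<integral>x. (\<integral>y. f (merge {i} I (x, y)) \<partial>Pi\<^sub>M I M) \<partial>Pi\<^sub>M {i} M)"
    using f I by (intro product_integral_fold) auto
  also have "\<dots> = (\<integral>x. (\<integral>y. f (y(i := x i)) \<partial>Pi\<^sub>M I M) \<partial>Pi\<^sub>M {i} M)"
    using I by (intro Bochner_Integration.integral_cong refl arg_cong[where f = f])
      (auto simp: merge_def space_PiM extensional_def PiE_def)
  also have "\<dots> = (\<integral>y. (\<integral>x. f (x(i := y)) \<partial>Pi\<^sub>M I M) \<partial>M i)"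
    by (rule product_integral_singleton[OF m])
  finally show ?thesis .
qed

text \<open>Tail sums are built from shears and their reordering from transpositions, so these two
  kinds of volume-preserving maps stand in for a general change of variables.\<close>

definition shear :: "nat \<Rightarrow> nat \<Rightarrow> (nat \<Rightarrow> real) \<Rightarrow> nat \<Rightarrow> real" where
  "shear i j t = t(i := t i + t j)"

lemma shear_measurable:
  assumes "i \<in> I" "j \<in> I"
  shows "shear i j \<in> lborel_on I \<rightarrow>\<^sub>M lborel_on I"
proof (rule measurable_PiM_single')
  have "(\<lambda>t. shear i j t k) \<in> borel_measurable (lborel_on I)" if "k \<in> I" for k
    using assms that by (cases "k = i") (simp_all add: shear_def[abs_def])
  then show "(\<lambda>t. shear i j t k) \<in> lborel_on I \<rightarrow>\<^sub>M lborel" if "k \<in> I" for k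
    using that by simp
  show "shear i j \<in> space (lborel_on I) \<rightarrow> (\<Pi>\<^sub>E i\<in>I. space lborel)"
    using assms by (auto simp: space_PiM shear_def PiE_iff extensional_def)
qed

lemma shear_measure_preserving:
  assumes "finite I" "i \<in> I" "j \<in> I" "i \<noteq> j"
  shows "distr (lborel_on I) (lborel_on I) (shear i j) = lborel_on I"
proof (rule measure_eqI)
  interpret product_sigma_finite "\<lambda>_::nat. lborel :: real measure" by (rule product_lborel)
  let ?M = "lborel_on I :: (nat \<Rightarrow> real) measure"
  fix A assume "A \<in> sets (distr ?M ?M (shear i j))"
  then have A[measurable]: "A \<in> sets ?M" by simp
  define J where "J = I - {i}"
  have J: "finite J" "i \<notin> J" "I = insert i J" using assms by (auto simp: J_def)
  have A': "A \<in> sets (lborel_on (insert i J))" using A J by simp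
  have 1: "(indicator A :: _ \<Rightarrow> ennreal) \<in> borel_measurable (lborel_on (insert i J))"
    using A' by (intro borel_measurable_indicator)
  have "shear i j \<in> ?M \<rightarrow>\<^sub>M ?M" by (rule shear_measurable) fact+
  from measurable_compose[OF this, of "indicator A :: _ \<Rightarrow> ennreal" borel]
  have 2: "(\<lambda>t. indicator A (shear i j t) :: ennreal) \<in> borel_measurable (lborel_on (insert i J))"
    using 1 unfolding J(3) by simp
  have upd: "(\<lambda>y. x(i := y)) \<in> borel \<rightarrow>\<^sub>M lborel_on (insert i J)" if "x \<in> space
      (lborel_on J)" for x
    using measurable_component_update[OF that J(2)] by simp
  have "emeasure (distr ?M ?M (shear i j)) A = (\<integral>\<^sup>+t. indicator A t \<partial>distr ?M ?M (shear i j))"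
    by simp
  also have "\<dots> = (\<integral>\<^sup>+t. indicator A (shear i j t) \<partial>?M)"
    using assms by (intro nn_integral_distr shear_measurable) auto
  also have "\<dots> = (\<integral>\<^sup>+x. (\<integral>\<^sup>+y. indicator A (shear i j (x(i := y)))
      \<partial>lborel) \<partial>lborel_on J)"
    using product_nn_integral_insert[OF J(1,2) 2] by (simp add: J(3))
  also have "\<dots> = (\<integral>\<^sup>+x. (\<integral>\<^sup>+y. indicator A (x(i := y)) \<partial>lborel)
      \<partial>lborel_on J)"
  proof (rule nn_integral_cong)
    fix x :: "nat \<Rightarrow> real" assume x: "x \<in> space (lborel_on J)"
    have m: "(\<lambda>y. indicator A (x(i := y)) :: ennreal) \<in> borel_measurable borel"
      using measurable_compose[OF upd[OF x] 1] .
    have "shear i j (x(i := y)) = x(i := x j + 1 * y)" for y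
      using assms by (auto simp: shear_def fun_eq_iff)
    then show "(\<integral>\<^sup>+y. indicator A (shear i j (x(i := y))) \<partial>lborel) =
        (\<integral>\<^sup>+y. indicator A (x(i := y)) \<partial>lborel)"
      using nn_integral_real_affine[OF m, of 1 "x j"] by simp
  qed
  also have "\<dots> = (\<integral>\<^sup>+t. indicator A t \<partial>?M)"
    using product_nn_integral_insert[OF J(1,2) 1] by (simp add: J(3))
  also have "\<dots> = emeasure ?M A" by simp
  finally show "emeasure (distr ?M ?M (shear i j)) A = emeasure ?M A" .
qed simp

lemma transpose_measurable:
  assumes "i \<in> I" "j \<in> I"
  shows "(\<lambda>t. t \<circ> Transposition.transpose i j) \<in> lborel_on I \<rightarrow>\<^sub>M PiM I
      (\<lambda>_. lborel :: real measure)"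
proof (rule measurable_PiM_single')
  show "(\<lambda>t. (t \<circ> Transposition.transpose i j) k) \<in> lborel_on I \<rightarrow>\<^sub>M (lborel ::
      real measure)" if "k \<in> I" for k
  proof -
    have "Transposition.transpose i j k \<in> I" using assms that by (auto simp: Transposition.transpose_def)
    then show ?thesis by simp
  qed
  show "(\<lambda>t. t \<circ> Transposition.transpose i j) \<in> space (lborel_on I) \<rightarrow> (\<Pi>\<^sub>E
      i\<in>I. space (lborel :: real measure))"
    using assms by (auto simp: space_PiM PiE_iff extensional_def Transposition.transpose_def)
qed

lemma transpose_measure_preserving:
  fixes i j :: nat
  assumes I: "finite I" "i \<in> I" "j \<in> I"
  shows "distr (lborel_on I) (lborel_on I) (\<lambda>t. t \<circ> Transposition.transpose i j) =
    PiM I (\<lambda>_. lborel :: real measure)"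
proof -
  interpret product_sigma_finite "\<lambda>_::nat. lborel :: real measure" by (rule product_lborel)
  let ?p = "Transposition.transpose i j"
  have p: "bij_betw ?p I I"
    using I by (intro bij_betwI[where g = ?p]) (auto simp: Transposition.transpose_def)
  have pI: "?p k \<in> I \<longleftrightarrow> k \<in> I" for k using I by (auto simp: Transposition.transpose_def)
  show ?thesis
  proof (rule PiM_eqI)
    fix A :: "nat \<Rightarrow> real set" assume A: "\<And>k. k \<in> I \<Longrightarrow> A k \<in> sets lborel"
    have "emeasure (distr (lborel_on I) (lborel_on I) (\<lambda>t. t \<circ> ?p)) (Pi\<^sub>E I A) =
       emeasure (lborel_on I) ((\<lambda>t. t \<circ> ?p) -` (Pi\<^sub>E I A) \<inter> space (lborel_on I))"
      using I A by (intro emeasure_distr transpose_measurable sets_PiM_I_finite) auto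
    also have "(\<lambda>t. t \<circ> ?p) -` (Pi\<^sub>E I A) \<inter> space (lborel_on I) = Pi\<^sub>E I (A \<circ> ?p)"
    proof (intro equalityI subsetI)
      fix t assume t: "t \<in> (\<lambda>t. t \<circ> ?p) -` (Pi\<^sub>E I A) \<inter> space (lborel_on I)"
      have "t k \<in> A (?p k)" if "k \<in> I" for k
      proof -
        have "(t \<circ> ?p) (?p k) \<in> A (?p k)" using t that pI by (intro PiE_mem[of _ I A]) auto
        then show ?thesis by simp
      qed
      then show "t \<in> Pi\<^sub>E I (A \<circ> ?p)" using t by (auto simp: space_PiM PiE_iff)
    next
      fix t assume t: "t \<in> Pi\<^sub>E I (A \<circ> ?p)"
      have "t (?p k) \<in> A k" if "k \<in> I" for k
        using PiE_mem[OF t, of "?p k"] that pI by simp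
      moreover have "t \<circ> ?p \<in> extensional I"
        using t pI by (auto simp: extensional_def PiE_iff)
      ultimately show "t \<in> (\<lambda>t. t \<circ> ?p) -` (Pi\<^sub>E I A) \<inter> space (lborel_on I)"
        using t by (auto simp: space_PiM PiE_iff)
    qed
    also have "emeasure (lborel_on I) (Pi\<^sub>E I (A \<circ> ?p)) = (\<Prod>k\<in>I. emeasure lborel ((A \<circ> ?p) k))"
      using I A pI by (intro emeasure_PiM) auto
    also have "\<dots> = (\<Prod>k\<in>I. emeasure lborel (A k))"
      using prod.reindex_bij_betw[OF p, of "\<lambda>k. emeasure lborel (A k)"] by simp
    finally show "emeasure (distr (lborel_on I) (lborel_on I) (\<lambda>t. t \<circ> ?p)) (Pi\<^sub>E I A) =
      (\<Prod>k\<in>I. emeasure lborel (A k))" .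
  qed (use I in auto)
qed

section \<open>Ordered coordinates on a simplex\<close>

definition tail :: "nat \<Rightarrow> (nat \<Rightarrow> real) \<Rightarrow> nat \<Rightarrow> real" where
  "tail n t m = (\<Sum>j\<in>{m..n}. t j)"

text \<open>Maps the chart of the i-th simplex of the prism to (theta, S_2, ..., S_n). Since S_1 is
  constantly 1, coordinate 1 is free to hold the loop parameter theta.\<close>

definition shuffle :: "nat \<Rightarrow> nat \<Rightarrow> (nat \<Rightarrow> real) \<Rightarrow> nat \<Rightarrow> real" where
  "shuffle n i t = (\<lambda>c\<in>{1..n}. if c = 1 then tail n t i else if c \<le> i then tail n t (c - 1) else tail n t c)"

definition measure_preserving :: "nat \<Rightarrow> ((nat \<Rightarrow> real) \<Rightarrow> nat \<Rightarrow> real)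
    \<Rightarrow> bool" where
  "measure_preserving n \<phi> \<longleftrightarrow> \<phi> \<in> lborel_n n \<rightarrow>\<^sub>M lborel_n n \<and>
      distr (lborel_n n) (lborel_n n) \<phi> = lborel_n n"

lemma measure_preserving_comp:
  assumes "measure_preserving n \<phi>" "measure_preserving n \<psi>"
  shows "measure_preserving n (\<lambda>t. \<phi> (\<psi> t))"
proof -
  have "distr (lborel_n n) (lborel_n n) (\<phi> \<circ> \<psi>) =
      distr (distr (lborel_n n) (lborel_n n) \<psi>) (lborel_n n) \<phi>"
    using assms by (intro distr_distr[symmetric]) (auto simp: measure_preserving_def)
  then show ?thesis using assms by (auto simp: measure_preserving_def comp_def)
qed

lemma measure_preserving_cong:
  assumes "measure_preserving n \<phi>" "\<And>t. t \<in> space (lborel_n n) \<Longrightarrow> \<psi> t = \<phi> t"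
  shows "measure_preserving n \<psi>"
  using assms measurable_cong[of "lborel_n n" \<psi> \<phi>] distr_cong[of "lborel_n n" "lborel_n n" "lborel_n n"
      "lborel_n n" \<psi> \<phi>]
  by (auto simp: measure_preserving_def)

text \<open>Downwards in k, the next tail sum is obtained by adding coordinate k + 1, which already
  is a tail sum, to coordinate k: one shear per step.\<close>

lemma tail_measure_preserving:
  assumes "k \<le> n" "1 \<le> k"
  shows "measure_preserving n (\<lambda>t. \<lambda>m\<in>{1..n}. if m \<ge> k then tail n t m else t m)"
  using assms
proof (induction k rule: inc_induct)
  case base
  have "measure_preserving n (\<lambda>t. t)" by (simp add: measure_preserving_def distr_id2)
  then show ?case
    by (rule measure_preserving_cong) (auto simp: space_PiM PiE_iff extensional_def fun_eq_iff tail_def)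
next
  case (step k)
  have "measure_preserving n (shear k (Suc k))"
    unfolding measure_preserving_def using step
    by (intro conjI shear_measurable shear_measure_preserving) auto
  moreover have "measure_preserving n (\<lambda>t. \<lambda>m\<in>{1..n}. if m \<ge> Suc k then tail n t m else t m)"
    by (rule step.IH) simp
  ultimately have "measure_preserving n (\<lambda>t. shear k (Suc k) (\<lambda>m\<in>{1..n}. if m \<ge> Suc k then
      tail n t m else t m))"
    by (rule measure_preserving_comp)
  then show ?case
  proof (rule measure_preserving_cong)
    fix t :: "nat \<Rightarrow> real"
    have "tail n t k = t k + tail n t (Suc k)"
      using step unfolding tail_def by (subst sum.atLeast_Suc_atMost) auto
    then show "(\<lambda>m\<in>{1..n}. if m \<ge> k then tail n t m else t m) =
      shear k (Suc k) (\<lambda>m\<in>{1..n}. if m \<ge> Suc k then tail n t m else t m)"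
      using step by (auto simp: shear_def fun_eq_iff)
  qed
qed

text \<open>\<open>shuffle n 1\<close> consists of the tail sums in their natural order, and going
  from i to i + 1 exchanges coordinates 1 and i + 1.\<close>

lemma shuffle_measure_preserving:
  assumes "1 \<le> i" "i \<le> n"
  shows "measure_preserving n (shuffle n i)"
  using assms
proof (induction i rule: dec_induct)
  case base
  have "shuffle n 1 = (\<lambda>t. \<lambda>m\<in>{1..n}. if m \<ge> 1 then tail n t m else t m)"
    by (auto simp: shuffle_def fun_eq_iff)
  then show ?case using tail_measure_preserving[of 1 n] base by (simp only:)
next
  case (step i)
  have "measure_preserving n (\<lambda>t. t \<circ> Transposition.transpose 1 (Suc i))"
    unfolding measure_preserving_def using step
    by (intro conjI transpose_measurable transpose_measure_preserving) auto
  from measure_preserving_comp[OF this, of "shuffle n i"] step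
  have "measure_preserving n (\<lambda>t. shuffle n i t \<circ> Transposition.transpose 1 (Suc i))" by auto
  moreover have "shuffle n (Suc i) = (\<lambda>t. shuffle n i t \<circ> Transposition.transpose 1 (Suc i))"
    using step by (auto simp: shuffle_def fun_eq_iff Transposition.transpose_def le_Suc_eq)
  ultimately show ?case by (simp only:)
qed

text \<open>The Jacobian matrix of the i-th simplex by the chain rule: \<open>D m j\<close> is the
  derivative of the m-th tail sum in direction j, \<open>dS m j\<close> that of S_m, and L' that of
  L in theta. The matrix factors into triangular matrices and a permuted triangular one, and only
  the latter contributes a sign.\<close>

lemma prism_det:
  fixes x S :: "nat \<Rightarrow> complex" and L L' :: complex
  assumes i: "1 \<le> i" "i \<le> n" and S: "S 1 = 1" "S (Suc n) = 0"
  defines "D \<equiv> \<lambda>m j. if 1 \<le> m \<and> m \<le> j then 1 else 0 :: complex"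
  defines "dS \<equiv> \<lambda>m j. if m \<le> i then D (m - 1) j else D m j"
  shows "Determinant.det (Matrix.mat n n (\<lambda>(a, b). x (Suc a) *
      ((dS (Suc a) (Suc b) - dS (Suc (Suc a)) (Suc b)) * L +
       (S (Suc a) - S (Suc (Suc a))) * L' * D i (Suc b)))) =
     (-1) ^ (i - 1) * (\<Prod>m\<in>{1..n}. x m) * L' * L ^ (n - 1)"
proof -
  \<comment> \<open>X carries the factors x_m from differentiating the exponentials, B forms
    differences of neighbours, T is the derivative of the S_m L(theta) with respect to (theta, S_2,
    ..., S_n), and C i is the Jacobian of \<open>shuffle n i\<close>. As S_1 = 1, the first row of T
    contains only L'.\<close>
  define X where "X = Matrix.mat n n (\<lambda>(a, b). if a = b then x (Suc a) else 0)"
  define B where "B = Matrix.mat n n (\<lambda>(a, b). if a = b then 1 else if b = Suc a then -1 else 0 :: complex)"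
  define T where "T = Matrix.mat n n (\<lambda>(a, b). if b = 0 then S (Suc a) * L' else if a = b then L else 0)"
  define C where "C = (\<lambda>i. Matrix.mat n n (\<lambda>(a, b).
    if a = 0 then D i (Suc b) else if Suc a \<le> i then D a (Suc b) else D (Suc a) (Suc b)))"
  have n: "0 < n" using i by simp
  have carr [simp]: "X \<in> carrier_mat n n" "B \<in> carrier_mat n n" "T \<in> carrier_mat n n" "C k \<in>
      carrier_mat n n" for k
    by (simp_all add: X_def B_def T_def C_def)
  have mm: "(A * M) $$ (a, b) = (\<Sum>k = 0..<n. A $$ (a, k) * M $$ (k, b))"
    if "A \<in> carrier_mat n n" "M \<in> carrier_mat n n" "a < n" "b < n" for A M :: "complex mat" and a b
    using that by (auto simp: scalar_prod_def intro!: sum.cong)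
  have R: "(T * C i) $$ (a, b) = dS (Suc a) (Suc b) * L + S (Suc a) * L' * D i (Suc b)" if "a < n" "b < n" for a b
  proof -
    have "(T * C i) $$ (a, b) = (\<Sum>k = 0..<n. T $$ (a, k) * C i $$ (k, b))"
      using that by (intro mm) auto
    also have "\<dots> = T $$ (a, 0) * C i $$ (0, b) + (\<Sum>k\<in>{0..<n} - {0}. T $$ (a, k) * C i $$ (k, b))"
      using n by (intro sum.remove) auto
    also have "(\<Sum>k\<in>{0..<n} - {0}. T $$ (a, k) * C i $$ (k, b)) =
        (\<Sum>k\<in>{0..<n} - {0}. if k = a then L * C i $$ (a, b) else 0)"
      using that by (intro sum.cong) (auto simp: T_def)
    also have "\<dots> = (if a = 0 then 0 else L * C i $$ (a, b))"
      using that by (simp add: sum.delta)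
    finally show ?thesis using that n i by (auto simp: T_def C_def dS_def D_def)
  qed
  have BR: "(B * (T * C i)) $$ (a, b) = (dS (Suc a) (Suc b) - dS (Suc (Suc a)) (Suc b)) * L +
       (S (Suc a) - S (Suc (Suc a))) * L' * D i (Suc b)" if ab: "a < n" "b < n" for a b
  proof -
    have "(B * (T * C i)) $$ (a, b) = (\<Sum>k = 0..<n. B $$ (a, k) * (T * C i) $$ (k, b))"
      using that by (intro mm mult_carrier_mat[of _ n n]) auto
    also have "\<dots> = (\<Sum>k = 0..<n. (if k = a then (T * C i) $$ (a, b) else 0)
        - (if k = Suc a then (T * C i) $$ (Suc a, b) else 0))"
      using that by (intro sum.cong) (auto simp: B_def)
    also have "\<dots> = (T * C i) $$ (a, b) - (if Suc a < n then (T * C i) $$ (Suc a, b) else 0)"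
      using that by (simp add: sum_subtractf sum.delta)
    also have "(if Suc a < n then (T * C i) $$ (Suc a, b) else 0) =
       dS (Suc (Suc a)) (Suc b) * L + S (Suc (Suc a)) * L' * D i (Suc b)"
    proof (cases "Suc a < n")
      case False
      then have "Suc a = n" using ab by simp
      moreover have "dS (Suc n) (Suc b) = 0" using ab i by (simp add: dS_def D_def)
      ultimately show ?thesis using S by simp
    qed (use R ab in simp)
    finally show ?thesis using R[OF ab] by (simp add: algebra_simps)
  qed
  have XBR: "(X * (B * (T * C i))) $$ (a, b) = x (Suc a) * (B * (T * C i)) $$ (a, b)" if "a < n" "b < n" for a b
  proof -
    have "(X * (B * (T * C i))) $$ (a, b) = (\<Sum>k = 0..<n. X $$ (a, k) * (B * (T * C i)) $$ (k, b))"
      using that by (intro mm mult_carrier_mat[of _ n n]) auto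
    also have "\<dots> = (\<Sum>k = 0..<n. if k = a then x (Suc a) * (B * (T * C i)) $$ (a, b) else 0)"
      using that by (intro sum.cong) (auto simp: X_def)
    also have "\<dots> = x (Suc a) * (B * (T * C i)) $$ (a, b)" using that by (simp add: sum.delta)
    finally show ?thesis .
  qed
  have "Matrix.mat n n (\<lambda>(a, b). x (Suc a) *
      ((dS (Suc a) (Suc b) - dS (Suc (Suc a)) (Suc b)) * L +
       (S (Suc a) - S (Suc (Suc a))) * L' * D i (Suc b))) = X * (B * (T * C i))"
  proof (rule eq_matI)
    fix a b assume "a < dim_row (X * (B * (T * C i)))" "b < dim_col (X * (B * (T * C i)))"
    then have "a < n" "b < n" by (simp_all add: X_def C_def)
    then show "Matrix.mat n n (\<lambda>(a, b). x (Suc a) *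
      ((dS (Suc a) (Suc b) - dS (Suc (Suc a)) (Suc b)) * L +
       (S (Suc a) - S (Suc (Suc a))) * L' * D i (Suc b))) $$ (a, b) = (X * (B * (T * C i))) $$ (a, b)"
      by (simp only: XBR BR index_mat split_conv)
  qed (simp_all add: X_def C_def)
  moreover have "Determinant.det (X * (B * (T * C i))) =
      Determinant.det X * (Determinant.det B * (Determinant.det T * Determinant.det (C i)))"
  proof -
    have "T * C i \<in> carrier_mat n n" "B * (T * C i) \<in> carrier_mat n n"
      by (intro mult_carrier_mat[of _ n n] carr)+
    then show ?thesis by (simp add: det_mult[of _ n])
  qed
  moreover have "Determinant.det X = (\<Prod>m\<in>{1..n}. x m)"
  proof -
    have "Determinant.det X = prod_list (diag_mat X)"
      by (rule det_upper_triangular[of _ n]) (auto simp: X_def)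
    also have "diag_mat X = map (\<lambda>a. x (Suc a)) [0..<n]"
      by (auto simp: diag_mat_def X_def)
    also have "prod_list \<dots> = (\<Prod>a\<in>{0..<n}. x (Suc a))"
      by (simp add: prod.distinct_set_conv_list[symmetric])
    also have "\<dots> = (\<Prod>m\<in>{1..n}. x m)"
      by (rule prod.reindex_bij_witness[where i = "\<lambda>m. m - 1" and j = Suc]) auto
    finally show ?thesis .
  qed
  moreover have "Determinant.det B = 1"
  proof -
    have "Determinant.det B = prod_list (diag_mat B)"
      by (rule det_upper_triangular[of _ n]) (auto simp: B_def)
    also have "diag_mat B = map (\<lambda>a. 1) [0..<n]"
      by (auto simp: diag_mat_def B_def)
    finally show ?thesis by (simp add: prod.distinct_set_conv_list[symmetric])
  qed
  moreover have "Determinant.det T = L' * L ^ (n - 1)"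
  proof -
    have "Determinant.det T = prod_list (diag_mat T)"
      by (rule det_lower_triangular[of n]) (auto simp: T_def)
    also have "diag_mat T = map (\<lambda>a. if a = 0 then L' else L) [0..<n]"
      using S by (auto simp: diag_mat_def T_def)
    also have "prod_list \<dots> = (\<Prod>a\<in>{0..<n}. if a = 0 then L' else L)"
      by (simp add: prod.distinct_set_conv_list[symmetric])
    also have "\<dots> = L' * (\<Prod>a\<in>{0..<n} - {0}. if a = 0 then L' else L)"
      using n by (subst prod.remove[of _ 0]) auto
    also have "(\<Prod>a\<in>{0..<n} - {0}. if a = 0 then L' else L) = (\<Prod>a\<in>{0..<n} - {0}. L)"
      by (intro prod.cong) auto
    finally show ?thesis using n by simp
  qed
  \<comment> \<open>C 1 is unitriangular, and each increase of i exchanges row 0 with one other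
    row.\<close>
  moreover have "Determinant.det (C i) = (-1) ^ (i - 1)"
    using i
  proof (induction i rule: dec_induct)
    case base
    have "Determinant.det (C 1) = prod_list (diag_mat (C 1))"
      by (rule det_upper_triangular[of _ n]) (auto simp: C_def D_def)
    also have "diag_mat (C 1) = map (\<lambda>a. 1) [0..<n]"
      by (auto simp: diag_mat_def C_def D_def)
    finally show ?case by (simp add: prod.distinct_set_conv_list[symmetric])
  next
    case (step k)
    have "C (Suc k) = swaprows 0 k (C k)"
      using step by (intro eq_matI) (auto simp: C_def D_def mat_swaprows_def)
    also have "Determinant.det \<dots> = - Determinant.det (C k)"
      using step by (intro det_swaprows[of _ n]) auto
    finally show ?case using step by (cases k) simp_all
  qed
  ultimately show ?thesis by (simp add: mult_ac)
qed

section \<open>The relative cycles\<close>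

text \<open>A class of expressions closed under partial derivatives and containing all components of
  the simplices, so that smoothness of every order needs only one differentiation lemma. The index
  set is \<open>UNIV\<close> for continuity in barycentric coordinates and \<open>{1..n}\<close> for
  smoothness in the chart.\<close>

inductive_set smooth_class :: "nat set \<Rightarrow> ((nat \<Rightarrow> real) \<Rightarrow> complex) set" for I where
  const: "(\<lambda>_. c) \<in> smooth_class I"
| coord: "j \<in> I \<Longrightarrow> (\<lambda>t. of_real (t j)) \<in> smooth_class I"
| add: "f \<in> smooth_class I \<Longrightarrow> g \<in> smooth_class I \<Longrightarrow> (\<lambda>t. f t +
    g t) \<in> smooth_class I"
| mult: "f \<in> smooth_class I \<Longrightarrow> g \<in> smooth_class I \<Longrightarrow> (\<lambda>t. f t *
    g t) \<in> smooth_class I"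
| exp: "f \<in> smooth_class I \<Longrightarrow> (\<lambda>t. exp (f t)) \<in> smooth_class I"

lemma smooth_class_continuous:
  "f \<in> smooth_class I \<Longrightarrow> continuous_map (powertop_real I) euclidean f"
proof (induction rule: smooth_class.induct)
  case (coord j)
  have "continuous_map (powertop_real I) euclideanreal (\<lambda>t. t j)"
    using coord by (rule continuous_map_product_projection)
  then show ?case by (simp add: continuous_map_atin tendsto_of_real)
qed (simp_all add: continuous_map_atin tendsto_add tendsto_mult tendsto_exp)

lemma smooth_class_deriv:
  assumes "f \<in> smooth_class I"
  shows "\<exists>f'\<in>smooth_class I. \<forall>t. ((\<lambda>s. f (t(j := s))) has_vector_derivative f' t) (at (t j))"
  using assms
proof (induction rule: smooth_class.induct)
  case (const c)
  show ?case by (intro bexI[of _ "\<lambda>_. 0"]) (auto intro: smooth_class.const)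
next
  case (coord i)
  show ?case
  proof (cases "i = j")
    case True
    have "((\<lambda>s. of_real s :: complex) has_vector_derivative 1) (at x)" for x
      using has_vector_derivative_of_real[OF DERIV_ident, of "at x"] by simp
    then show ?thesis using True by (intro bexI[of _ "\<lambda>_. 1"]) (auto intro: smooth_class.const)
  next
    case False
    then show ?thesis by (intro bexI[of _ "\<lambda>_. 0"]) (auto intro: smooth_class.const)
  qed
next
  case (add f g)
  then obtain f' g' where f': "f' \<in> smooth_class I" "\<And>t. ((\<lambda>s. f (t(j := s))) has_vector_derivative
      f' t) (at (t j))"
    and g': "g' \<in> smooth_class I" "\<And>t. ((\<lambda>s. g (t(j := s))) has_vector_derivative g' t) (at (t j))" by blast
  show ?case
    by (intro bexI[of _ "\<lambda>t. f' t + g' t"] allI has_vector_derivative_add f' g' smooth_class.add)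
next
  case (mult f g)
  then obtain f' g' where f': "f' \<in> smooth_class I" "\<And>t. ((\<lambda>s. f (t(j := s))) has_vector_derivative
      f' t) (at (t j))"
    and g': "g' \<in> smooth_class I" "\<And>t. ((\<lambda>s. g (t(j := s))) has_vector_derivative g' t) (at (t j))" by blast
  have "((\<lambda>s. f (t(j := s)) * g (t(j := s))) has_vector_derivative f t * g' t + f' t * g t) (at (t j))" for t
    using has_vector_derivative_mult[OF f'(2)[of t] g'(2)[of t]] by simp
  then show ?case
    by (intro bexI[of _ "\<lambda>t. f t * g' t + f' t * g t"] allI smooth_class.add smooth_class.mult f' g' mult)
next
  case (exp f)
  then obtain f' where f': "f' \<in> smooth_class I" "\<And>t. ((\<lambda>s. f (t(j := s))) has_vector_derivative f'
      t) (at (t j))" by blast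
  have "((\<lambda>s. exp (f (t(j := s)))) has_vector_derivative f' t * exp (f t)) (at (t j))" for t
    using field_vector_diff_chain_at[OF f'(2)[of t] DERIV_exp] by (simp add: comp_def)
  then show ?case
    by (intro bexI[of _ "\<lambda>t. f' t * exp (f t)"] allI smooth_class.mult smooth_class.exp f' exp)
qed

lemma partial_deriv_smooth_class:
  assumes "f \<in> smooth_class I"
  shows "partial_deriv j f \<in> smooth_class I"
proof -
  obtain f' where f': "f' \<in> smooth_class I" "\<And>t. ((\<lambda>s. f (t(j := s))) has_vector_derivative f' t) (at (t j))"
    using smooth_class_deriv[OF assms, of j] by blast
  have "partial_deriv j f = f'"
    unfolding partial_deriv_def using f'(2) by (auto intro!: vector_derivative_at)
  then show ?thesis using f'(1) by simp
qed

lemma smooth_class_smooth_fun_on: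
  assumes "f \<in> smooth_class {1..n}"
  shows "smooth_fun_on n U f"
proof -
  have c: "foldr partial_deriv js f \<in> smooth_class {1..n}" for js
    by (induction js) (simp_all add: assms partial_deriv_smooth_class del: One_nat_def)
  have "(\<lambda>s. foldr partial_deriv js f (t(j := s))) differentiable (at (t j))" for js t j
    using smooth_class_deriv[OF c, of js j] by (auto intro: differentiableI_vector)
  then show ?thesis unfolding smooth_fun_on_def
    using smooth_class_continuous[OF c] by (auto intro: continuous_map_from_subtopology)
qed

lemma smooth_class_sum:
  assumes "finite A" "\<And>a. a \<in> A \<Longrightarrow> f a \<in> smooth_class I"
  shows "(\<lambda>t. \<Sum>a\<in>A. f a t) \<in> smooth_class I"
  using assms by (induction A rule: finite_induct) (auto intro: smooth_class.const smooth_class.add)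

lemma smooth_class_diff:
  assumes "f \<in> smooth_class I" "g \<in> smooth_class I"
  shows "(\<lambda>t. f t - g t) \<in> smooth_class I"
  using smooth_class.add[OF assms(1) smooth_class.mult[OF smooth_class.const[of "-1"] assms(2)]] by simp

text \<open>
  The loop \<open>L\<close> of radius 1 around \<open>2 \<pi> i p\<close> times the simplex \<open>1 =
      S\<^sub>1 \<ge> S\<^sub>2 \<ge> \<dots> \<ge> S\<^sub>n \<ge> S\<^sub>n\<^sub>+\<^sub>1 = 0\<close> is mapped to
  \<open>x\<^sub>m = e^((S\<^sub>m - S\<^sub>m\<^sub>+\<^sub>1) L(\<theta>))\<close>.  The \<open>i\<close>-th
      simplex of the prism consists of the points with
  \<open>S\<^sub>i\<^sub>+\<^sub>1 \<le> \<theta> \<le> S\<^sub>i\<close>; the tail sums of its barycentric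
      coordinates are \<open>S\<^sub>1, \<dots>, S\<^sub>i, \<theta>, S\<^sub>i\<^sub>+\<^sub>1, \<dots>, S\<^sub>n\<close>.
\<close>

definition prism_seq :: "nat \<Rightarrow> nat \<Rightarrow> (nat \<Rightarrow> real) \<Rightarrow> nat \<Rightarrow> real" where
  "prism_seq n i t m = (if m \<le> i then tail n t (m - 1) else tail n t m)"

definition loop_log :: "nat \<Rightarrow> real \<Rightarrow> complex" where
  "loop_log p \<theta> = two_pi_i * of_nat p + unit_loop \<theta>"

definition prism_map :: "nat \<Rightarrow> nat \<Rightarrow> nat \<Rightarrow> (nat \<Rightarrow> real) \<Rightarrow>
    nat \<Rightarrow> complex" where
  "prism_map n p i t = (\<lambda>m\<in>{1..n}.
     exp (of_real (prism_seq n i t m - prism_seq n i t (Suc m)) * loop_log p (tail n t i)))"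

text \<open>Singular simplices are extensional, hence the cutoff; \<open>prism_map\<close> is the
  extension to the whole space that smoothness up to the boundary requires.\<close>

definition prism :: "nat \<Rightarrow> nat \<Rightarrow> nat \<Rightarrow> (nat \<Rightarrow> real) \<Rightarrow> nat
    \<Rightarrow> complex" where
  "prism n p i = restrict (prism_map n p i) (standard_simplex n)"

lemma prism_map_smooth_class:
  assumes h: "\<And>j. j \<le> n \<Longrightarrow> (\<lambda>t. of_real (h t j)) \<in> smooth_class I" and "m \<in> {1..n}"
  shows "(\<lambda>t. prism_map n p i (h t) m) \<in> smooth_class I"
proof -
  have t: "(\<lambda>t. of_real (tail n (h t) k)) \<in> smooth_class I" for k
    unfolding tail_def of_real_sum by (intro smooth_class_sum h) auto
  then have s: "(\<lambda>t. of_real (prism_seq n i (h t) k)) \<in> smooth_class I" for k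
    unfolding prism_seq_def by (cases "k \<le> i") simp_all
  show ?thesis using assms(2) unfolding prism_map_def loop_log_def unit_loop_def
    by (auto simp only: restrict_apply if_True of_real_diff
        intro!: smooth_class.exp smooth_class.mult smooth_class.add smooth_class.const smooth_class_diff s t)
qed

lemma tail_simplex: "t \<in> standard_simplex n \<Longrightarrow> tail n t 0 = 1"
  by (simp add: standard_simplex_def tail_def atLeast0AtMost)

lemma tail_beyond [simp]: "m > n \<Longrightarrow> tail n t m = 0"
  by (simp add: tail_def)

lemma norm_unit_loop [simp]: "norm (unit_loop \<theta>) = 1"
  by (simp add: unit_loop_def norm_exp_eq_Re)

lemma exp_loop_log: "exp (loop_log p \<theta>) = exp (unit_loop \<theta>)"
proof -
  have "exp (two_pi_i * of_nat p) = 1"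
    using exp_integer_2pi[of "of_nat p"] by (simp add: mult_ac)
  then show ?thesis by (simp add: loop_log_def exp_add)
qed

lemma exp_loop_log_neq_1: "exp (loop_log p \<theta>) \<noteq> 1"
  using exp_neq_1[of "unit_loop \<theta>"] norm_unit_loop[of \<theta>] by (cases "unit_loop \<theta> =
      0") (auto simp: exp_loop_log)

lemma prism_seq_ends:
  assumes "1 \<le> i" "i \<le> n"
  shows "prism_seq n i t 1 = tail n t 0" "prism_seq n i t (Suc n) = 0"
  using assms by (simp_all add: prism_seq_def)

text \<open>The exponents telescope from S_1 = 1 to S_(n+1) = 0. Hence the product depends on theta
  alone, and the simplex avoids the divisor where it equals 1.\<close>

lemma prism_map_prod:
  assumes "1 \<le> i" "i \<le> n" "tail n t 0 = 1"
  shows "(\<Prod>m\<in>{1..n}. prism_map n p i t m) = exp (loop_log p (tail n t i))"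
proof -
  have "(\<Prod>m\<in>{1..n}. prism_map n p i t m) =
    exp (\<Sum>m\<in>{1..n}. of_real (prism_seq n i t m - prism_seq n i t (Suc m)) * loop_log p (tail n t i))"
    by (simp add: exp_sum prism_map_def)
  also have "(\<Sum>m\<in>{1..n}. of_real (prism_seq n i t m - prism_seq n i t (Suc m)) * loop_log p (tail n t i)) =
    of_real (\<Sum>m\<in>{1..n}. prism_seq n i t m - prism_seq n i t (Suc m)) * loop_log p (tail n t i)"
    by (simp add: sum_distrib_right)
  also have "(\<Sum>m\<in>{1..n}. prism_seq n i t m - prism_seq n i t (Suc m)) = 1"
    using sum_Suc_diff[of 1 n "\<lambda>m. - prism_seq n i t m"] assms prism_seq_ends[of i n t]
    by (simp add: sum_subtractf sum_negf)
  finally show ?thesis by simp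
qed

lemma prism_singular_simplex:
  assumes "1 \<le> i" "i \<le> n"
  shows "singular_simplex n (form_domain n) (prism n p i)"
  unfolding singular_simplex_def
proof
  have "continuous_map (powertop_real UNIV) euclidean (\<lambda>t. prism_map n p i t m)" if "m \<in> {1..n}" for m
    using prism_map_smooth_class[of n "\<lambda>t. t" UNIV m p i] that
    by (intro smooth_class_continuous) (auto intro: smooth_class.coord)
  then have c: "continuous_map (subtopology (powertop_real UNIV) (standard_simplex n)) euclidean
      (\<lambda>t. prism n p i t m)" if "m \<in> {1..n}" for m
    by (rule continuous_map_eq[OF continuous_map_from_subtopology[of _ _ "\<lambda>t. prism_map n p i t m"]])
      (use that in \<open>auto simp: prism_def\<close>)
  have "prism n p i t \<in> extensional {1..n} \<and> (\<forall>m\<in>{1..n}. prism n p i t m \<noteq> 0) \<and>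
      (\<Prod>m\<in>{1..n}. prism n p i t m) \<noteq> 1" if "t \<in> standard_simplex n" for t
    using that prism_map_prod[OF assms tail_simplex[OF that]] exp_loop_log_neq_1
    by (simp add: prism_def prism_map_def)
  then show "continuous_map (subtopology (powertop_real UNIV) (standard_simplex n)) (form_domain n) (prism n p i)"
    unfolding form_domain_def continuous_map_in_subtopology continuous_map_componentwise
    using c by (auto simp: image_subset_iff)
  show "prism n p i \<in> extensional (standard_simplex n)" by (simp add: prism_def)
qed

lemma barycentric_simplex:
  assumes "t \<in> chart_simplex n"
  shows "barycentric n t \<in> standard_simplex n"
proof -
  have nn: "\<And>j. j \<in> {1..n} \<Longrightarrow> t j \<ge> 0" and s: "(\<Sum>j\<in>{1..n}. t j) \<le> 1"
    using assms by (auto simp: chart_simplex_def PiE_iff)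
  have "t j \<le> 1" if "j \<in> {1..n}" for j
    using member_le_sum[of j "{1..n}" t] that nn s by force
  moreover have "(\<Sum>j\<in>{1..n}. t j) \<ge> 0" using nn by (rule sum_nonneg)
  moreover have "(\<Sum>i\<le>n. barycentric n t i) = 1"
  proof -
    have "(\<Sum>i\<le>n. barycentric n t i) = barycentric n t 0 + (\<Sum>i\<in>{1..n}. barycentric n t i)"
      by (simp add: sum.atLeast_Suc_atMost flip: atLeast0AtMost)
    also have "(\<Sum>i\<in>{1..n}. barycentric n t i) = (\<Sum>i\<in>{1..n}. t i)"
      by (intro sum.cong) (auto simp: barycentric_def)
    finally show ?thesis by (simp add: barycentric_def)
  qed
  ultimately show ?thesis using nn s by (auto simp: standard_simplex_def barycentric_def)
qed

lemma barycentric_smooth_class: "(\<lambda>t. of_real (barycentric n t j)) \<in> smooth_class {1..n}"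
proof -
  have "(\<lambda>t. of_real (1 - (\<Sum>j\<in>{1..n}. t j))) \<in> smooth_class {1..n}"
    unfolding of_real_diff of_real_sum
    by (intro smooth_class_diff smooth_class_sum smooth_class.const smooth_class.coord) auto
  moreover have "(\<lambda>t. of_real (t j)) \<in> smooth_class {1..n}" if "j \<noteq> 0" "j \<le> n"
    using that by (intro smooth_class.coord) auto
  ultimately show ?thesis
    using smooth_class.const[of 0 "{1..n}"] by (cases "j = 0"; cases "j \<le> n") (simp_all add: barycentric_def)
qed

lemma prism_piecewise_smooth: "piecewise_smooth_simplex n (prism n p i)"
proof -
  \<comment> \<open>The vertices of the standard simplex itself, so the single affine piece is the
    identity.\<close>
  define l :: "nat \<Rightarrow> nat \<Rightarrow> real" where "l j i = (if i = j then 1 else 0)" for j i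
  have l: "oriented_simplex n l x = x" if "x \<in> standard_simplex n" for x
  proof
    fix i
    have "oriented_simplex n l x i = (\<Sum>j\<le>n. if i = j then x j else 0)"
      using that by (simp add: oriented_simplex_def l_def if_distrib[of "\<lambda>a. a * _"] cong: if_cong)
    also have "\<dots> = x i" using that by (simp add: sum.delta' standard_simplex_def)
    finally show "oriented_simplex n l x i = x i" .
  qed
  have "smooth_simplex n (prism n p i \<circ> oriented_simplex n l)"
    unfolding smooth_simplex_def
  proof (intro exI conjI)
    show "openin (powertop_real {1..n}) (topspace (powertop_real {1..n}))" by (rule openin_topspace)
    show "chart_simplex n \<subseteq> topspace (powertop_real {1..n})"
      by (auto simp: chart_simplex_def PiE_iff extensional_def)
    show "\<forall>m\<in>{1..n}. smooth_fun_on n (topspace (powertop_real {1..n})) (\<lambda>t. prism_map n p i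
        (barycentric n t) m)"
      by (intro ballI smooth_class_smooth_fun_on prism_map_smooth_class barycentric_smooth_class)
    show "\<forall>t\<in>chart_simplex n. \<forall>m\<in>{1..n}. (prism n p i \<circ> oriented_simplex n l) (barycentric n t) m =
        prism_map n p i (barycentric n t) m"
      using barycentric_simplex l by (simp add: prism_def)
  qed
  then show ?thesis unfolding piecewise_smooth_simplex_def
    by (intro exI[of _ "{l}"]) (auto simp: l)
qed

text \<open>The k-th face inserts a zero at position k; for tail sums this duplicates an entry,
  making those at k and k + 1 equal.\<close>

lemma tail_face:
  assumes "1 \<le> n" "k \<le> n"
  shows "tail n (simplical_face k r) m = (if m \<le> k then tail (n - 1) r m else tail (n - 1) r (m - 1))"
proof -
  have shift: "(\<Sum>j\<in>{m..n}. r (j - 1)) = tail (n - 1) r (m - 1)" if "m \<ge> 1" for m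
    unfolding tail_def using that assms
    by (intro sum.reindex_bij_witness[where i = Suc and j = "\<lambda>j. j - 1"]) auto
  show ?thesis
  proof (cases "m \<le> k")
    case True
    have "tail n (simplical_face k r) m = (\<Sum>j\<in>{m..<k}. simplical_face k r j) +
        (\<Sum>j\<in>{k..n}. simplical_face k r j)"
      unfolding tail_def using True assms by (subst sum.union_disjoint[symmetric]) (auto intro!: sum.cong)
    also have "(\<Sum>j\<in>{k..n}. simplical_face k r j) = simplical_face k r k + (\<Sum>j\<in>{Suc k..n}. simplical_face k r j)"
      using assms(2) by (rule sum.atLeast_Suc_atMost)
    also have "(\<Sum>j\<in>{Suc k..n}. simplical_face k r j) = (\<Sum>j\<in>{Suc k..n}. r (j - 1))"
      by (intro sum.cong) (auto simp: simplical_face_def)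
    also have "\<dots> = (\<Sum>j\<in>{k..n - 1}. r j)" using shift[of "Suc k"] by (simp add: tail_def)
    also have "(\<Sum>j\<in>{m..<k}. simplical_face k r j) = (\<Sum>j\<in>{m..<k}. r j)"
      by (intro sum.cong) (auto simp: simplical_face_def)
    also have "simplical_face k r k = 0" by (simp add: simplical_face_def)
    also have "(\<Sum>j\<in>{m..<k}. r j) + (0 + (\<Sum>j\<in>{k..n - 1}. r j)) = tail (n - 1) r m"
      unfolding tail_def using True assms
      by (simp, subst sum.union_disjoint[symmetric]) (auto intro!: sum.cong)
    finally show ?thesis using True by simp
  next
    case False
    then have "tail n (simplical_face k r) m = (\<Sum>j\<in>{m..n}. r (j - 1))"
      unfolding tail_def by (intro sum.cong) (auto simp: simplical_face_def)
    then show ?thesis using False shift[of m] by simp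
  qed
qed

text \<open>The wall theta = S_(k+1) of the triangulated prism, with S_m the tail sum of r from m -
  1. For 1 \<le> k < n it is the common face of simplices k and k + 1.\<close>

definition prism_wall :: "nat \<Rightarrow> nat \<Rightarrow> nat \<Rightarrow> (nat \<Rightarrow> real)
    \<Rightarrow> nat \<Rightarrow> complex" where
  "prism_wall n p k = (\<lambda>r\<in>standard_simplex (n - 1). \<lambda>m\<in>{1..n}.
     exp (of_real (tail (n - 1) r (m - 1) - tail (n - 1) r m) * loop_log p (tail (n - 1) r k)))"

lemma prism_inner_faces:
  assumes "1 \<le> i" "i \<le> n"
  shows "singular_face n (i - 1) (prism n p i) = prism_wall n p (i - 1)"
    and "singular_face n i (prism n p i) = prism_wall n p i"
proof -
  have f: "simplical_face k r \<in> standard_simplex n" if "r \<in> standard_simplex (n - 1)" "k \<le> n" for k r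
    using simplical_face_in_standard_simplex[of n k r] that assms by simp
  have "prism_seq n i (simplical_face k r) m = tail (n - 1) r (m - 1)" if "k = i - 1 \<or> k = i" "m \<ge> 1" for k r m
    using that assms by (auto simp: prism_seq_def tail_face)
  then have "prism_map n p i (simplical_face k r) = (\<lambda>m\<in>{1..n}.
     exp (of_real (tail (n - 1) r (m - 1) - tail (n - 1) r m) * loop_log p (tail (n - 1) r k)))"
    if "k = i - 1 \<or> k = i" for k r
    using that assms by (auto simp: prism_map_def tail_face fun_eq_iff)
  then show "singular_face n (i - 1) (prism n p i) = prism_wall n p (i - 1)"
    "singular_face n i (prism n p i) = prism_wall n p i"
    using f assms by (auto simp: singular_face_def prism_def prism_wall_def fun_eq_iff)
qed

text \<open>These walls are the ends theta = 0 and theta = 1 of the prism, which are glued because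
  the loop closes.\<close>

lemma prism_wall_periodic:
  assumes "n \<ge> 1"
  shows "prism_wall n p n = prism_wall n p 0"
proof -
  have "loop_log p 1 = loop_log p 0"
    using exp_two_pi_i by (simp add: loop_log_def unit_loop_def)
  then show ?thesis using assms by (auto simp: prism_wall_def tail_simplex fun_eq_iff)
qed

lemma prism_outer_face:
  assumes "1 \<le> i" "i \<le> n" "k \<le> n" "k \<noteq> i - 1" "k \<noteq> i"
  shows "singular_simplex (n - 1) (subtopology (form_domain n) (one_divisors n)) (singular_face n k (prism n p i))"
proof -
  have "singular_simplex (n - 1) (form_domain n) (singular_face n k (prism n p i))"
    using singular_simplex_singular_face[OF prism_singular_simplex[OF assms(1,2)], of k p] assms by simp
  moreover have "singular_face n k (prism n p i) r \<in> one_divisors n" if r: "r \<in> standard_simplex (n - 1)" for r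
  proof -
    have f: "simplical_face k r \<in> standard_simplex n"
      using simplical_face_in_standard_simplex[of n k r] r assms by simp
    \<comment> \<open>The coinciding tail sums k and k + 1 are neighbours in the sequence S, one
      position later if they come before theta. Equal neighbours S_m = S_(m+1) give x_m = 1.\<close>
    define m where "m = (if k < i then Suc k else k)"
    have m: "m \<in> {1..n}" using assms by (auto simp: m_def)
    have "prism_seq n i (simplical_face k r) m = prism_seq n i (simplical_face k r) (Suc m)"
      using assms by (auto simp: m_def prism_seq_def tail_face)
    then have "singular_face n k (prism n p i) r m = 1"
      using r f m by (simp add: singular_face_def prism_def prism_map_def)
    then show ?thesis using m by (auto simp: one_divisors_def)
  qed
  ultimately show ?thesis by (auto simp: singular_simplex_subtopology)
qed

text \<open>Different indices could name the same simplex, so coefficients are collected along the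
  fibres of F; linear functionals can still be evaluated by the indexed sum.\<close>

lemma chain_functional:
  fixes G :: "((nat \<Rightarrow> real) \<Rightarrow> nat \<Rightarrow> complex) \<Rightarrow> 'b::field_char_0" and
      r :: "'x \<Rightarrow> rat"
    and F :: "'x \<Rightarrow> (nat \<Rightarrow> real) \<Rightarrow> nat \<Rightarrow> complex"
  assumes X: "finite X"
  defines "c \<equiv> (\<Sum>x\<in>X. Poly_Mapping.single (F x) (r x)) :: rat_chain"
  shows "(\<Sum>f\<in>keys c. of_rat (lookup c f) * G f) = (\<Sum>x\<in>X. of_rat (r x) * G (F x))"
    and "keys c \<subseteq> F ` X"
proof -
  have l: "lookup c f = (\<Sum>x\<in>X. if F x = f then r x else 0)" for f
    unfolding c_def lookup_sum lookup_single when_def by simp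
  show k: "keys c \<subseteq> F ` X"
  proof
    fix f assume "f \<in> keys c"
    then have "(\<Sum>x\<in>X. if F x = f then r x else 0) \<noteq> 0" by (simp add: l[symmetric] in_keys_iff)
    then obtain x where "x \<in> X" "(if F x = f then r x else 0) \<noteq> 0" by (rule sum.not_neutral_contains_not_neutral)
    then show "f \<in> F ` X" by (auto split: if_splits)
  qed
  have "(\<Sum>f\<in>keys c. of_rat (lookup c f) * G f) =
    (\<Sum>f\<in>F ` X. of_rat (lookup c f) * G f)"
    using X k by (intro sum.mono_neutral_left) (auto simp: in_keys_iff)
  also have "\<dots> = (\<Sum>f\<in>F ` X. \<Sum>x\<in>X. if F x = f then of_rat (r x) * G f else 0)"
    unfolding l by (simp add: of_rat_sum sum_distrib_right if_distrib[of of_rat] if_distrib[of "\<lambda>a. a * _"] cong: if_cong)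
  also have "\<dots> = (\<Sum>x\<in>X. \<Sum>f\<in>F ` X. if F x = f then of_rat (r x) * G f else 0)"
    by (rule sum.swap)
  also have "\<dots> = (\<Sum>x\<in>X. of_rat (r x) * G (F x))"
    using X by (intro sum.cong refl) (simp add: sum.delta)
  finally show "(\<Sum>f\<in>keys c. of_rat (lookup c f) * G f) = (\<Sum>x\<in>X. of_rat (r x) * G (F x))" .
qed

section \<open>The boundary of the prism chains\<close>

definition face_count :: "nat \<Rightarrow> ((nat \<Rightarrow> real) \<Rightarrow> nat \<Rightarrow> complex)
    \<Rightarrow> ((nat \<Rightarrow> real) \<Rightarrow> nat \<Rightarrow> complex) \<Rightarrow> rat" where
  "face_count n g f = (\<Sum>k\<le>n. if g = singular_face n k f then (-1) ^ k else 0)"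

lemma lookup_rat_chain_boundary:
  assumes "n \<ge> 1"
  shows "lookup (rat_chain_boundary n c) g =
    (\<Sum>f\<in>keys c. of_rat (lookup c f) * face_count n g f)"
proof -
  have l: "of_int (lookup (chain_boundary n (frag_of f)) g) = face_count n g f" for f
    using assms by (simp add: chain_boundary_of face_count_def lookup_sum if_distrib[of "\<lambda>a. _ *
        a"] if_distrib[of of_int] cong: if_cong)
  have "lookup (Poly_Mapping.map (\<lambda>z. lookup c f * of_int z) (chain_boundary n (frag_of f))) g =
     lookup c f * of_int (lookup (chain_boundary n (frag_of f)) g)" for f
    by (simp add: Poly_Mapping.map.rep_eq when_def)
  then show ?thesis
    unfolding rat_chain_boundary_def lookup_sum l by simp
qed

definition prism_chain :: "nat \<Rightarrow> (nat \<Rightarrow> rat) \<Rightarrow> rat_chain" where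
  "prism_chain n c = (\<Sum>(p, i)\<in>{..<n} \<times> {1..n}. Poly_Mapping.single (prism n p i) (c p * (-1) ^ (i - 1)))"

lemma prism_chain_functional:
  fixes G :: "((nat \<Rightarrow> real) \<Rightarrow> nat \<Rightarrow> complex) \<Rightarrow> 'b::field_char_0"
  shows "(\<Sum>f\<in>keys (prism_chain n c). of_rat (lookup (prism_chain n c) f) * G f) =
    (\<Sum>p<n. of_rat (c p) * (\<Sum>i\<in>{1..n}. (-1) ^ (i - 1) * G (prism n p i)))"
proof -
  have "(\<Sum>f\<in>keys (prism_chain n c). of_rat (lookup (prism_chain n c) f) * G f) =
    (\<Sum>x\<in>{..<n} \<times> {1..n}. of_rat (c (fst x) * (-1) ^ (snd x - 1)) * G (prism n (fst x) (snd x)))"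
    unfolding prism_chain_def case_prod_beta by (rule chain_functional) auto
  also have "\<dots> = (\<Sum>p<n. \<Sum>i\<in>{1..n}. of_rat (c p * (-1) ^ (i - 1)) * G (prism n p i))"
    by (simp add: sum.cartesian_product case_prod_beta)
  finally show ?thesis
    by (simp add: of_rat_mult of_rat_power of_rat_minus sum_distrib_left mult.assoc)
qed

text \<open>Away from the outer faces only walls count: with its sign, simplex i contributes wall i
  - 1 minus wall i, and the sum telescopes to the difference of the two glued ends.\<close>

lemma prism_boundary_telescope:
  assumes n: "n \<ge> 1" and g: "\<And>k i. 1 \<le> i \<Longrightarrow> i \<le> n \<Longrightarrow> k \<le> n
      \<Longrightarrow> k \<noteq> i - 1 \<Longrightarrow> k \<noteq> i \<Longrightarrow>
    singular_face n k (prism n p i) \<noteq> g"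
  shows "(\<Sum>i\<in>{1..n}. (-1) ^ (i - 1) * face_count n g (prism n p i)) = 0"
proof -
  define W where "W k = (if g = prism_wall n p k then 1 else 0 :: rat)" for k
  have "(-1) ^ (i - 1) * face_count n g (prism n p i) = W (i - 1) - W i" if "i \<in> {1..n}" for i
  proof -
    have i: "1 \<le> i" "i \<le> n" using that by auto
    have "face_count n g (prism n p i) = (\<Sum>k\<in>{i - 1, i}. if g = singular_face n k (prism n p i) then (-1) ^ k else 0)"
      unfolding face_count_def using i g[OF i] by (intro sum.mono_neutral_right) auto
    also have "\<dots> = (-1) ^ (i - 1) * W (i - 1) + (-1) ^ i * W i"
      using i by (simp add: prism_inner_faces W_def del: One_nat_def)
    finally have "(-1) ^ (i - 1) * face_count n g (prism n p i) =
      (-1) ^ (i - 1) * ((-1) ^ (i - 1) * W (i - 1) + (-1) ^ i * W i)" by simp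
    also have "(-1) ^ i = - ((-1) ^ (i - 1) :: rat)" using i by (cases i) auto
    also have "(-1) ^ (i - 1) * ((-1) ^ (i - 1) * W (i - 1) + - ((-1) ^ (i - 1)) * W i) =
      ((-1) ^ (i - 1) * (-1) ^ (i - 1)) * (W (i - 1) - W i)" by (simp only: algebra_simps)
    also have "(-1) ^ (i - 1) * (-1) ^ (i - 1) = (1 :: rat)" by (simp flip: power_mult_distrib)
    finally show ?thesis by simp
  qed
  then have "(\<Sum>i\<in>{1..n}. (-1) ^ (i - 1) * face_count n g (prism n p i)) = (\<Sum>i\<in>{1..n}. W (i - 1) - W i)"
    by (intro sum.cong) auto
  also have "\<dots> = (\<Sum>i<n. W i - W (Suc i))"
    by (rule sum.reindex_bij_witness[where i = Suc and j = "\<lambda>i. i - 1"]) auto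
  also have "\<dots> = W 0 - W n" by (rule sum_lessThan_telescope')
  also have "\<dots> = 0" using prism_wall_periodic[OF n, of p] by (simp add: W_def)
  finally show ?thesis .
qed

lemma prism_chain_relative_cycle:
  assumes "n \<ge> 1"
  shows "relative_cycle n (prism_chain n c)"
  unfolding relative_cycle_def
proof (intro conjI ballI)
  fix f assume f: "f \<in> keys (prism_chain n c)"
  have "keys (prism_chain n c) \<subseteq> (\<lambda>x. prism n (fst x) (snd x)) ` ({..<n} \<times> {1..n})"
    unfolding prism_chain_def case_prod_beta by (rule chain_functional) auto
  with f obtain p i where "i \<in> {1..n}" "f = prism n p i" by auto
  then show "singular_simplex n (form_domain n) f" "piecewise_smooth_simplex n f"
    using prism_singular_simplex prism_piecewise_smooth by auto
next
  fix g assume "g \<in> keys (rat_chain_boundary n (prism_chain n c))"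
  then have "lookup (rat_chain_boundary n (prism_chain n c)) g \<noteq> 0" by (simp add: in_keys_iff)
  then have "(\<Sum>p<n. of_rat (c p) * (\<Sum>i\<in>{1..n}. (-1) ^ (i - 1) * face_count n g (prism n p i))) \<noteq> 0"
    unfolding lookup_rat_chain_boundary[OF assms] prism_chain_functional .
  then obtain p where "(\<Sum>i\<in>{1..n}. (-1) ^ (i - 1) * face_count n g (prism n p i)) \<noteq> 0"
    by (metis (no_types, lifting) mult_zero_right sum.neutral)
  then obtain k i where "1 \<le> i" "i \<le> n" "k \<le> n" "k \<noteq> i - 1" "k \<noteq> i" "singular_face n k
      (prism n p i) = g"
    using prism_boundary_telescope[OF assms, of p g] by blast
  then show "singular_simplex (n - 1) (subtopology (form_domain n) (one_divisors n)) g"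
    using prism_outer_face by blast
qed

section \<open>Interpolation at the nodes 0, ..., n - 1\<close>

lemma inverse_vandermonde:
  "\<exists>v :: nat \<Rightarrow> nat \<Rightarrow> rat. \<forall>q<n. \<forall>r<n. (\<Sum>p<n. v q p *
      of_nat p ^ r) = (if q = r then 1 else 0)"
proof -
  \<comment> \<open>The Lagrange basis; its coefficients are the entries of the inverse Vandermonde
    matrix.\<close>
  define l :: "nat \<Rightarrow> rat poly" where "l p = (\<Prod>s\<in>{..<n} - {p}. smult (1 / (of_nat p - of_nat s))
      [:- of_nat s, 1:])" for p
  have deg: "degree (l p) < n" if "p < n" for p
  proof -
    have "degree (l p) \<le> (\<Sum>s\<in>{..<n} - {p}. degree (smult (1 / (of_nat p - of_nat s)) [:- of_nat s, 1 :: rat:]))"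
      unfolding l_def by (rule order_trans[OF degree_prod_sum_le]) (simp_all only: comp_def order_refl
          finite_lessThan finite_Diff)
    also have "\<dots> \<le> (\<Sum>s\<in>{..<n} - {p}. 1)" by (intro sum_mono) (auto intro: order_trans[OF degree_smult_le])
    also have "\<dots> < n" using that by simp
    finally show ?thesis .
  qed
  have val: "poly (l p) (of_nat s) = (if p = s then 1 else 0)" if "p < n" "s < n" for p s
  proof (cases "p = s")
    case True
    then show ?thesis using that by (auto simp: l_def poly_prod diff_divide_distrib[symmetric] intro!: prod.neutral)
  next
    case False
    then have "s \<in> {..<n} - {p}" using that by auto
    then show ?thesis using False by (auto simp: l_def poly_prod intro!: prod_zero bexI[of _ s])
  qed
  have "(\<Sum>p<n. coeff (l p) q * of_nat p ^ r) = (if q = r then 1 else 0)" if "r < n" for q r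
  proof -
    \<comment> \<open>Interpolating x^r is exact since r < n; comparing the coefficients of x^q
      gives the claim.\<close>
    have "(\<Sum>p<n. smult (of_nat p ^ r) (l p)) = monom 1 r"
    proof (rule poly_eqI_degree[where A = "of_nat ` {..<n}"])
      show "poly (\<Sum>p<n. smult (of_nat p ^ r) (l p)) x = poly (monom 1 r) x" if "x \<in> of_nat ` {..<n}" for x
      proof -
        obtain s where s: "s < n" "x = of_nat s" using \<open>x \<in> _\<close> by auto
        have "poly (\<Sum>p<n. smult (of_nat p ^ r) (l p)) x = (\<Sum>p<n. if p = s then of_nat s ^ r else 0)"
          unfolding s poly_sum using val s by (intro sum.cong) auto
        then show ?thesis using s by (simp add: poly_monom)
      qed
      have "inj_on (of_nat :: nat \<Rightarrow> rat) {..<n}" by (simp add: inj_on_def)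
      then have card: "card (of_nat ` {..<n} :: rat set) = n" by (simp add: card_image)
      have "degree (\<Sum>p<n. smult (of_nat p ^ r) (l p)) < n"
        using that deg by (intro degree_sum_less) (auto intro: le_less_trans[OF degree_smult_le])
      then show "degree (\<Sum>p<n. smult (of_nat p ^ r) (l p)) < card (of_nat ` {..<n} :: rat set)" using card by simp
      show "degree (monom 1 r :: rat poly) < card (of_nat ` {..<n} :: rat set)"
        using that card by (simp add: degree_monom_eq)
    qed
    then have "coeff (\<Sum>p<n. smult (of_nat p ^ r) (l p)) q = coeff (monom 1 r) q" by simp
    then show ?thesis by (simp add: coeff_sum coeff_monom mult.commute eq_commute[of q])
  qed
  then show ?thesis by (intro exI[of _ "\<lambda>q p. coeff (l p) q"]) auto
qed

section \<open>Integrals over the prism\<close>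

text \<open>The sum of the coefficients of exponent k after the terms of d have been multiplied by
  \<open>binom_poly N j\<close> expanded at m + j. The residues and the series both lead to this
  number.\<close>

definition pf_coeff :: "nat \<Rightarrow> nat \<Rightarrow> pf_list \<Rightarrow> rat" where
  "pf_coeff N k d = (\<Sum>(c, j, l)\<leftarrow>d. if k \<le> l then c * coeff (binom_poly N (int j)) (l - k) else 0)"

text \<open>The weight of exponent k in the integral over loop p. For p = 0 the convention 0^0 = 1
  leaves only k = 1.\<close>

definition loop_coeff :: "nat \<Rightarrow> nat \<Rightarrow> complex" where
  "loop_coeff p k = - ((-1) ^ k) * (two_pi_i) ^ k * of_nat p ^ (k - 1) / fact (k - 1)"

lemma exp_quot_continuous: "continuous_on (sphere 0 1) (exp_quot N j r)"
  unfolding exp_quot_def[abs_def]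
proof (intro continuous_intros)
  show "\<forall>z\<in>sphere 0 1. (1 - exp z) ^ N \<noteq> (0::complex)"
  proof
    fix z :: complex assume "z \<in> sphere 0 1"
    then show "(1 - exp z) ^ N \<noteq> 0" using exp_neq_1[of z] by (cases "z = 0") auto
  qed
qed auto

text \<open>By periodicity the centre c drops out of the exponential, so it enters only through the
  binomial expansion of the power.\<close>

lemma exp_mono_loop_expand:
  fixes u c :: complex
  assumes c: "exp (of_nat j * c) = 1"
  shows "exp_mono j (Suc q) (c + u) / (1 - exp u) ^ N =
    (\<Sum>s\<le>q. c ^ s / fact s * exp_quot N (int j) (q - s) u)"
proof -
  have "(c + u) ^ q / fact q = (\<Sum>s\<le>q. c ^ s / fact s * (u ^ (q - s) / fact (q - s)))"
    unfolding binomial_ring sum_divide_distrib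
    by (intro sum.cong refl) (simp add: binomial_fact field_simps)
  moreover have "exp (of_nat j * (c + u)) = exp (of_nat j * u)"
    using c by (simp add: distrib_left exp_add)
  moreover have "exp_mono j (Suc q) (c + u) / (1 - exp u) ^ N =
    exp (of_nat j * (c + u)) * ((c + u) ^ q / fact q) / (1 - exp u) ^ N" by simp
  ultimately show ?thesis
    by (simp add: exp_quot_def sum_distrib_left sum_divide_distrib mult_ac)
qed

lemma exp_mono_loop_integral:
  fixes j p q N :: nat
  defines "f \<equiv> (\<lambda>\<theta>. two_pi_i * unit_loop \<theta> *
      (exp_mono j (Suc q) (loop_log p \<theta>) / (1 - exp (loop_log p \<theta>)) ^ N))"
  shows "set_integrable lborel {0..1} f"
    and "(LBINT \<theta>:{0..1}. f \<theta>) = (\<Sum>s\<le>q. (two_pi_i * of_nat p) ^ s / fact s *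
      (- 2 * of_real pi * \<i> * (-1) ^ (q - s) * of_rat (coeff (binom_poly N (int j)) (q - s))))"
proof -
  let ?c = "two_pi_i * of_nat p :: complex"
  let ?F = "\<lambda>u. \<Sum>s\<le>q. ?c ^ s / fact s * exp_quot N (int j) (q - s) u"
  have c: "exp (of_nat j * ?c) = 1"
    using exp_integer_2pi[of "of_nat (j * p)"] by (simp add: mult_ac)
  have f: "f = (\<lambda>\<theta>. two_pi_i * unit_loop \<theta> * ?F (unit_loop \<theta>))"
    unfolding f_def exp_loop_log unfolding loop_log_def exp_mono_loop_expand[OF c] ..
  have h: "(?F has_contour_integral (\<Sum>s\<le>q. ?c ^ s / fact s *
      (- 2 * of_real pi * \<i> * (-1) ^ (q - s) * of_rat (coeff (binom_poly N (int j)) (q - s))))) (circlepath 0 1)"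
    by (intro has_contour_integral_sum has_contour_integral_lmul exp_quot_integral) auto
  have "continuous_on (sphere 0 1) ?F"
    by (intro continuous_intros exp_quot_continuous)
  from unit_loop_integral[OF h this] show "set_integrable lborel {0..1} f"
    "(LBINT \<theta>:{0..1}. f \<theta>) = (\<Sum>s\<le>q. ?c ^ s / fact s *
      (- 2 * of_real pi * \<i> * (-1) ^ (q - s) * of_rat (coeff (binom_poly N (int j)) (q - s))))"
    unfolding f by simp_all
qed

lemma pf_exp_loop_integral:
  fixes d :: "pf_list" and n p N :: nat
  assumes "\<forall>(c, j, l)\<in>set d. 1 \<le> l \<and> l \<le> n"
  defines "f \<equiv> (\<lambda>\<theta>. two_pi_i * unit_loop \<theta> *
      (pf_exp d (loop_log p \<theta>) / (1 - exp (loop_log p \<theta>)) ^ N))"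
  shows "set_integrable lborel {0..1} f \<and>
    (LBINT \<theta>:{0..1}. f \<theta>) = (\<Sum>k=1..n. loop_coeff p k * of_rat (pf_coeff N k d))"
  using assms(1) unfolding f_def
proof (induction d)
  case (Cons a d)
  obtain c j l where a: "a = (c, j, l)" by (cases a)
  then obtain q where l: "l = Suc q" using Cons.prems by (cases l) auto
  have qn: "q < n" using Cons.prems by (auto simp: a l)
  let ?g = "\<lambda>\<theta>. two_pi_i * unit_loop \<theta> * (exp_mono j (Suc q) (loop_log p \<theta>) / (1 - exp
      (loop_log p \<theta>)) ^ N)"
  let ?h = "\<lambda>\<theta>. two_pi_i * unit_loop \<theta> * (pf_exp d (loop_log p \<theta>) / (1 - exp (loop_log p
      \<theta>)) ^ N)"
  let ?C = "of_rat c * (-1) ^ Suc q :: complex"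
  have eq: "two_pi_i * unit_loop \<theta> * (pf_exp (a # d) (loop_log p \<theta>) / (1 - exp (loop_log p \<theta>)) ^ N) =
     ?C * ?g \<theta> + ?h \<theta>" for \<theta>
    unfolding a l pf_exp_simps by (simp only: ring_distribs add_divide_distrib times_divide_eq_right mult_ac)
  note g = exp_mono_loop_integral[of j q p N]
  have h: "set_integrable lborel {0..1} ?h" "(LBINT \<theta>:{0..1}. ?h \<theta>) = (\<Sum>k=1..n. loop_coeff p k *
      of_rat (pf_coeff N k d))"
    using Cons by auto
  have Cg: "set_integrable lborel {0..1} (\<lambda>\<theta>. ?C *
      ?g \<theta>)" using g(1) by (intro set_integrable_mult_right) simp
  have val: "?C * (LBINT \<theta>:{0..1}. ?g \<theta>) = (\<Sum>k=1..n. loop_coeff p k *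
      of_rat (if k \<le> l then c * coeff (binom_poly N (int j)) (l - k) else 0))"
  proof -
    let ?S = "\<lambda>s. (two_pi_i * of_nat p) ^ s / fact s *
      (- 2 * of_real pi * \<i> * (-1) ^ (q - s) * of_rat (coeff (binom_poly N (int j)) (q - s)))"
    have "(\<Sum>k=1..n. loop_coeff p k * of_rat (if k \<le> l then c * coeff (binom_poly N (int j)) (l - k) else 0)) =
      (\<Sum>k=1..Suc q. loop_coeff p k * of_rat (c * coeff (binom_poly N (int j)) (l - k)))"
      using qn by (intro sum.mono_neutral_cong_right) (auto simp: l)
    \<comment> \<open>The exponent k belongs to the power s = k - 1 of 2 pi i p in the binomial
      expansion; the factor 2 pi i of the residue completes the k-th power.\<close>
    also have "\<dots> = (\<Sum>s\<le>q. loop_coeff p (Suc s) * of_rat (c * coeff (binom_poly N (int j)) (q - s)))"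
      by (rule sum.reindex_bij_witness[where i = Suc and j = "\<lambda>k. k - 1"]) (auto simp: l)
    also have "\<dots> = (\<Sum>s\<le>q. ?C * ?S s)"
    proof (intro sum.cong refl)
      fix s assume "s \<in> {..q}"
      then obtain r where r: "q = s + r" using le_Suc_ex by auto
      have "(-1) ^ Suc (s + r) * (-1) ^ r = ((-1) ^ Suc s :: complex)"
        by (simp add: power_add flip: power_mult_distrib)
      then have "?C * ?S s = of_rat c * ((two_pi_i * of_nat p) ^ s / fact s *
         (- 2 * of_real pi * \<i> * of_rat (coeff (binom_poly N (int j)) r))) * (-1) ^ Suc s"
        unfolding r by (simp add: mult_ac)
      moreover have "loop_coeff p (Suc s) * of_rat (c * coeff (binom_poly N (int j)) (q - s)) =
         of_rat c * ((two_pi_i * of_nat p) ^ s / fact s *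
         (- 2 * of_real pi * \<i> * of_rat (coeff (binom_poly N (int j)) r))) * (-1) ^ Suc s"
        by (simp add: r loop_coeff_def of_rat_mult power_mult_distrib mult_ac)
      ultimately show "loop_coeff p (Suc s) * of_rat (c * coeff (binom_poly N (int j)) (q - s)) = ?C * ?S s"
        by (simp only:)
    qed
    finally show ?thesis using g(2) by (simp add: sum_distrib_left)
  qed
  show ?case unfolding eq
  proof
    show "set_integrable lborel {0..1} (\<lambda>\<theta>. ?C * ?g \<theta> +
        ?h \<theta>)" by (rule set_integral_add(1)[OF Cg h(1)])
    have "(LBINT \<theta>:{0..1}. ?C * ?g \<theta> + ?h \<theta>) = ?C * (LBINT \<theta>:{0..1}. ?g \<theta>) +
        (LBINT \<theta>:{0..1}. ?h \<theta>)"
      by (simp only: set_integral_add(2)[OF Cg h(1)] set_integral_mult_right)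
    also have "\<dots> = (\<Sum>k=1..n. loop_coeff p k * of_rat (pf_coeff N k (a # d)))"
      unfolding val h(2) by (simp add: pf_coeff_def a of_rat_add distrib_left sum.distrib)
    finally show "(LBINT \<theta>:{0..1}. ?C * ?g \<theta> + ?h \<theta>) = (\<Sum>k=1..n. loop_coeff p k *
        of_rat (pf_coeff N k (a # d)))" .
  qed
qed (simp add: pf_coeff_def set_integrable_def)

text \<open>
  \<open>wedge n k \<tau>\<close> is the open simplex \<open>\<tau> > v\<^sub>k\<^sub>+\<^sub>1 > \<dots> > v\<^sub>n
      > 0\<close>; peeling off its outermost variable turns
  \<open>wedge_int\<close> into an iterated convolution of exponentials.
\<close>

definition wseq :: "nat \<Rightarrow> nat \<Rightarrow> real \<Rightarrow> (nat \<Rightarrow> real) \<Rightarrow> nat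
    \<Rightarrow> real" where
  "wseq n k \<tau> v m = (if m = k then \<tau> else if m \<le> n then v m else 0)"

definition wedge :: "nat \<Rightarrow> nat \<Rightarrow> real \<Rightarrow> (nat \<Rightarrow> real) set" where
  "wedge n k \<tau> = {v. \<forall>m\<in>{k..n}. wseq n k \<tau> v (Suc m) < wseq n k \<tau> v m}"

definition wedge_form :: "nat \<Rightarrow> (nat \<Rightarrow> nat) \<Rightarrow> nat \<Rightarrow> real
    \<Rightarrow> (nat \<Rightarrow> real) \<Rightarrow> real" where
  "wedge_form n b k \<tau> v = (\<Sum>m\<in>{k..n}. of_nat (b m) * (wseq n k \<tau> v m - wseq n k \<tau> v (Suc m)))"

definition wedge_int :: "nat \<Rightarrow> (nat \<Rightarrow> nat) \<Rightarrow> complex \<Rightarrow> nat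
    \<Rightarrow> real \<Rightarrow> complex" where
  "wedge_int n b z k \<tau> = (\<integral>v. indicator (wedge n k \<tau>) v *\<^sub>R exp (z *
      of_real (wedge_form n b k \<tau> v)) \<partial>lborel_on {Suc k..n})"

lemma wedge_bounds:
  assumes v: "v \<in> wedge n k \<tau>" and m: "k \<le> m" "m \<le> n"
  shows "0 < wseq n k \<tau> v m" "wseq n k \<tau> v m \<le> \<tau>"
proof -
  have d: "wseq n k \<tau> v (Suc l) < wseq n k \<tau> v l" if "k \<le> l" "l \<le> n" for l
    using v that by (simp add: wedge_def)
  show "wseq n k \<tau> v m \<le> \<tau>"
    using m(1) m(2)
  proof (induction m rule: dec_induct)
    case (step l)
    then show ?case using d[of l] by simp
  qed (simp add: wseq_def)
  show "0 < wseq n k \<tau> v m"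
    using m(2) m(1)
  proof (induction m rule: inc_induct)
    case base
    then show ?case using d[of n] by (simp add: wseq_def split: if_splits)
  next
    case (step l)
    then show ?case using d[of l] by simp
  qed
qed

lemma wseq_measurable:
  assumes "{Suc k..n} \<subseteq> I" "k \<le> m"
  shows "(\<lambda>v. wseq n k \<tau> v m) \<in> borel_measurable (lborel_on I)"
proof (cases "m = k \<or> m > n")
  case True
  then show ?thesis by (cases "m = k") (auto simp: wseq_def[abs_def])
next
  case False
  then have "m \<in> I" using assms by auto
  then have "(\<lambda>v. v m) \<in> borel_measurable (PiM I (\<lambda>_. lborel :: real measure))" by simp
  then show ?thesis using False by (simp add: wseq_def[abs_def])
qed

lemma wedge_form_measurable:
  assumes "{Suc k..n} \<subseteq> I"
  shows "wedge_form n b k \<tau> \<in> borel_measurable (lborel_on I)"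
  unfolding wedge_form_def[abs_def] using assms
  by (intro borel_measurable_sum borel_measurable_times borel_measurable_diff wseq_measurable) auto

lemma wedge_sets:
  assumes "{Suc k..n} \<subseteq> I"
  shows "wedge n k \<tau> \<inter> space (lborel_on I) \<in> sets (lborel_on I)"
proof -
  have "{v \<in> space (lborel_on I). \<forall>m\<in>{k..n}. wseq n k \<tau> v (Suc m) < wseq n k \<tau> v m} \<in>
      sets (lborel_on I)"
    using assms by (intro sets.sets_Collect_finite_All borel_measurable_less wseq_measurable) auto
  also have "{v \<in> space (lborel_on I). \<forall>m\<in>{k..n}. wseq n k \<tau> v (Suc m) < wseq n k \<tau> v m} =
    wedge n k \<tau> \<inter> space (lborel_on I)" by (auto simp: wedge_def)
  finally show ?thesis .
qed

lemma wedge_form_bound: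
  assumes "v \<in> wedge n k \<tau>"
  shows "\<bar>wedge_form n b k \<tau> v\<bar> \<le> (\<Sum>m\<in>{k..n}. of_nat (b m)) * \<tau>"
proof -
  have "\<bar>wedge_form n b k \<tau> v\<bar> \<le> (\<Sum>m\<in>{k..n}. \<bar>of_nat (b m) *
      (wseq n k \<tau> v m - wseq n k \<tau> v (Suc m))\<bar>)"
    unfolding wedge_form_def by (rule sum_abs)
  also have "\<dots> \<le> (\<Sum>m\<in>{k..n}. of_nat (b m) * \<tau>)"
  proof (rule sum_mono)
    fix m assume m: "m \<in> {k..n}"
    have "wseq n k \<tau> v (Suc m) < wseq n k \<tau> v m" using assms m by (simp add: wedge_def)
    moreover have "wseq n k \<tau> v m \<le> \<tau>" using wedge_bounds[OF assms] m by simp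
    moreover have "0 \<le> wseq n k \<tau> v (Suc m)"
      using wedge_bounds(1)[OF assms, of "Suc m"] m by (cases "Suc m \<le> n") (auto simp: wseq_def)
    ultimately show "\<bar>of_nat (b m) * (wseq n k \<tau> v m - wseq n k \<tau> v (Suc m))\<bar> \<le> of_nat (b m) * \<tau>"
      by (auto simp: abs_mult intro!: mult_left_mono)
  qed
  finally show ?thesis by (simp add: sum_distrib_right)
qed

lemma box_finite:
  assumes "finite I" "A \<in> sets (lborel_on I)" "A \<subseteq> Pi\<^sub>E I (\<lambda>_. {0..c::real})"
  shows "emeasure (lborel_on I) A < \<infinity>"
proof -
  interpret product_sigma_finite "\<lambda>_::'a. lborel :: real measure"
    by (simp add: product_sigma_finite_def lborel.sigma_finite_measure_axioms)
  have "emeasure (lborel_on I) A \<le> emeasure (lborel_on I) (Pi\<^sub>E I (\<lambda>_. {0..c}))"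
    using assms by (intro emeasure_mono sets_PiM_I_finite) auto
  also have "\<dots> = (\<Prod>i\<in>I. emeasure lborel {0..c})" using assms by (intro emeasure_PiM) auto
  also have "\<dots> < \<infinity>" by (simp add: power_less_top_ennreal emeasure_lborel_Icc_eq)
  finally show ?thesis .
qed

lemma norm_exp_le: "norm (exp z) \<le> exp (norm (z::complex))"
  by (simp add: norm_exp_eq_Re complex_Re_le_cmod)

lemma wedge_integrable:
  fixes z :: complex
  shows
  "integrable (lborel_on {Suc k..n}) (\<lambda>v. indicator (wedge n k \<tau>) v *\<^sub>R exp (z *
      of_real (wedge_form n b k \<tau> v)))"
proof -
  let ?M = "lborel_on {Suc k..n} :: (nat \<Rightarrow> real) measure"
  let ?A = "wedge n k \<tau> \<inter> space ?M"
  have A: "?A \<in> sets ?M" by (rule wedge_sets) simp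
  have sub: "?A \<subseteq> Pi\<^sub>E {Suc k..n} (\<lambda>_. {0..\<tau>})"
  proof
    fix v assume v: "v \<in> ?A"
    have "0 \<le> v m \<and> v m \<le> \<tau>" if "m \<in> {Suc k..n}" for m
      using wedge_bounds[of v n k \<tau> m] v that by (simp add: wseq_def)
    then show "v \<in> Pi\<^sub>E {Suc k..n} (\<lambda>_. {0..\<tau>})" using v by (auto simp: space_PiM PiE_iff)
  qed
  have "integrable ?M (\<lambda>v. indicator ?A v *\<^sub>R exp (z * of_real (wedge_form n b k \<tau> v)))"
  proof (rule integrableI_bounded_set_indicator[OF A])
    have "(\<lambda>x. exp (z * of_real x)) \<in> borel_measurable borel"
      by (intro borel_measurable_continuous_onI continuous_intros)
    then show "(\<lambda>v. exp (z * of_real (wedge_form n b k \<tau> v))) \<in> borel_measurable ?M"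
      by (rule measurable_compose[OF wedge_form_measurable, rotated]) simp
    show "emeasure ?M ?A < \<infinity>" by (rule box_finite[OF _ A sub]) simp
    show "AE v in ?M. v \<in> ?A \<longrightarrow> norm (exp (z * of_real (wedge_form n b k \<tau> v))) \<le>
      exp (norm z * ((\<Sum>m\<in>{k..n}. of_nat (b m)) * \<tau>))"
    proof (intro AE_I2 impI)
      fix v assume "v \<in> ?A"
      then have "norm (z * of_real (wedge_form n b k \<tau> v)) \<le> norm z * ((\<Sum>m\<in>{k..n}. of_nat (b m)) * \<tau>)"
        using wedge_form_bound[of v n k \<tau> b] by (auto simp: norm_mult intro!: mult_left_mono)
      then show "norm (exp (z * of_real (wedge_form n b k \<tau> v))) \<le> exp (norm z *
          ((\<Sum>m\<in>{k..n}. of_nat (b m)) * \<tau>))"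
        using norm_exp_le order_trans exp_le_cancel_iff by blast
    qed
  qed
  then show ?thesis
    by (rule Bochner_Integration.integrable_cong[THEN iffD1, rotated -1]) (auto simp: indicator_def)
qed

lemma integral_Ioo_Icc:
  fixes f :: "real \<Rightarrow> complex"
  assumes "a \<le> b"
  shows "(\<integral>y. indicator {a<..<b} y *\<^sub>R f y \<partial>lborel) = (LBINT y:{a..b}. f y)"
proof -
  have "(LBINT y=ereal a..ereal b. f y) = (LBINT y:{a<..<b}. f y)"
    using interval_integral_Ioo[of "ereal a" "ereal b" f] assms by simp
  moreover have "(LBINT y=ereal a..ereal b. f y) = (LBINT y:{a..b}. f y)"
    using assms by (rule interval_integral_Icc)
  ultimately show ?thesis by (simp add: set_lebesgue_integral_def)
qed

lemma wseq_shift: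
  assumes "m \<ge> Suc k" "k < n"
  shows "wseq n k \<tau> (v(Suc k := y)) m = wseq n (Suc k) y v m"
  using assms by (auto simp: wseq_def)

text \<open>Fixing v_(k+1) = y splits the exponent into b k (\<tau> - y) and the form of the smaller
  wedge with top y. The integral thus satisfies the convolution recursion of
  \<open>pf_exp_prod_integral\<close>, whose factor z at each step is matched by
  \<open>z ^ (n - k)\<close>; no division by z is needed.\<close>

lemma wedge_int_eq_pf_exp:
  assumes "k \<le> n" "\<tau> > 0" "\<And>m. b m > 0"
  shows "z ^ (n - k) * wedge_int n b z k \<tau> =
    (-1) ^ Suc (n - k) * pf_exp (pf_prod (map b [k..<Suc n])) (z * of_real \<tau>)"
  using assms(1,2)
proof (induction k arbitrary: \<tau> rule: inc_induct)
  case base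
  interpret product_sigma_finite "\<lambda>_::nat. lborel :: real measure" by (rule product_lborel)
  have "(\<lambda>v. indicator (wedge n n \<tau>) v *\<^sub>R exp (z * of_real (wedge_form n b n \<tau> v))) =
      (\<lambda>_. exp (z * of_real (b n * \<tau>)))"
    using base by (auto simp: wedge_def wseq_def wedge_form_def indicator_def)
  then show ?case by (simp add: wedge_int_def measure_def space_PiM mult_ac)
next
  case (step k)
  interpret product_sigma_finite "\<lambda>_::nat. lborel :: real measure" by (rule product_lborel)
  let ?bs = "map b [Suc k..<Suc n]"
  let ?e = "\<lambda>y. exp (of_nat (b k) * z * of_real (\<tau> - y))"
  let ?c = "\<lambda>y. indicator {..<\<tau>} y * ?e y"
  let ?u = "\<lambda>y. (-1) ^ Suc (n - Suc k) * (?e y * pf_exp (pf_prod ?bs) (z * of_real y))"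
  have bs: "map b [k..<Suc n] = b k # ?bs" using step by (simp add: upt_conv_Cons del: upt_Suc)
  have ins: "{Suc k..n} = insert (Suc k) {Suc (Suc k)..n}" using step by auto
  define f where "f v = indicator (wedge n k \<tau>) v *\<^sub>R exp (z * of_real (wedge_form n b k \<tau> v))" for v
  have fi: "integrable (PiM (insert (Suc k) {Suc (Suc k)..n}) (\<lambda>_. lborel)) f"
    using wedge_integrable[of k n \<tau> z b] unfolding ins f_def .
  have fy: "f (v(Suc k := y)) = ?c y *
      (indicator (wedge n (Suc k) y) v *\<^sub>R exp (z * of_real (wedge_form n b (Suc k) y v)))" for v y
  proof -
    have Ico: "{k..n} = insert k {Suc k..n}" using step by auto
    have s: "wseq n k \<tau> (v(Suc k := y)) m = wseq n (Suc k) y v m" if "m \<ge> Suc k" for m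
      using that step by (intro wseq_shift) auto
    have s1: "wseq n k \<tau> (v(Suc k := y)) k = \<tau>" "wseq n (Suc k) y v (Suc k) = y" by (auto simp: wseq_def)
    have "v(Suc k := y) \<in> wedge n k \<tau> \<longleftrightarrow> y < \<tau> \<and> v \<in> wedge n (Suc k) y"
      unfolding wedge_def Ico by (simp add: s s1)
    moreover have "wedge_form n b k \<tau> (v(Suc k := y)) = of_nat (b k) * (\<tau> - y) + wedge_form n b (Suc k) y v"
      unfolding wedge_form_def Ico by (simp add: s s1)
    ultimately have i: "indicator (wedge n k \<tau>) (v(Suc k := y)) = (indicator {..<\<tau>} y *
        indicator (wedge n (Suc k) y) v :: real)"
      and e: "exp (z * of_real (wedge_form n b k \<tau> (v(Suc k := y)))) =
        ?e y * exp (z * of_real (wedge_form n b (Suc k) y v))"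
      by (auto simp: indicator_def exp_add[symmetric] distrib_left mult_ac add_ac)
    show ?thesis unfolding f_def i e by (simp add: indicator_def)
  qed
  have "wedge_int n b z k \<tau> = (\<integral>y. (\<integral>v. f (v(Suc k := y)) \<partial>lborel_on {Suc (Suc
      k)..n}) \<partial>lborel)"
    using product_integral_insert_rev[OF _ _ fi] unfolding wedge_int_def f_def ins by simp
  also have "\<dots> = (\<integral>y. ?c y * wedge_int n b z (Suc k) y \<partial>lborel)"
    unfolding fy wedge_int_def by (simp only: integral_mult_right_zero)
  finally have "z ^ (n - k) * wedge_int n b z k \<tau> =
     z ^ Suc (n - Suc k) * (\<integral>y. ?c y * wedge_int n b z (Suc k) y \<partial>lborel)"
    using step by (simp add: Suc_diff_Suc)
  also have "\<dots> = z * (\<integral>y. z ^ (n - Suc k) * (?c y * wedge_int n b z (Suc k) y) \<partial>lborel)"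
    by simp
  also have "(\<lambda>y. z ^ (n - Suc k) * (?c y * wedge_int n b z (Suc k) y)) =
    (\<lambda>y. indicator {0<..<\<tau>} y *\<^sub>R (?u y))"
  proof
    fix y
    show "z ^ (n - Suc k) * (?c y * wedge_int n b z (Suc k) y) =
      indicator {0<..<\<tau>} y *\<^sub>R (?u y)"
    proof (cases "y > 0")
      case True
      have "z ^ (n - Suc k) * (?c y * wedge_int n b z (Suc k) y) =
        ?c y * (z ^ (n - Suc k) * wedge_int n b z (Suc k) y)"
        by (simp only: mult_ac)
      also have "\<dots> = ?c y *
        ((-1) ^ Suc (n - Suc k) * pf_exp (pf_prod ?bs) (z * of_real y))"
        unfolding step.IH[OF True] ..
      finally show ?thesis using True by (simp add: indicator_def mult_ac del: upt_Suc)
    next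
      case False
      \<comment> \<open>For y \<le> 0 the integrand vanishes, so the induction hypothesis for
        positive tops suffices.\<close>
      have "wedge n (Suc k) y = {}"
        using False wedge_bounds(1)[of _ n "Suc k" y "Suc k"] step by (fastforce simp: wseq_def)
      then show ?thesis using False by (simp add: wedge_int_def)
    qed
  qed
  also have "(\<integral>y. indicator {0<..<\<tau>} y *\<^sub>R (?u y) \<partial>lborel) =
     (LBINT y:{0..\<tau>}. ?u y)"
    using step.prems by (intro integral_Ioo_Icc) simp
  also have "\<dots> = (-1) ^ Suc (n - Suc k) * (LBINT y:{0..\<tau>}. ?e y * pf_exp (pf_prod ?bs) (z * of_real y))"
    by (rule set_integral_mult_right)
  also have "z * \<dots> = (-1) ^ Suc (n - k) * pf_exp (pf_prod (b k # ?bs)) (z * of_real \<tau>)"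
    using assms(3) step by (subst pf_exp_prod_integral) (auto simp: Suc_diff_Suc[symmetric])
  finally show ?case unfolding bs .
qed

section \<open>The pulled-back form in the coordinates (theta, S_2, ..., S_n)\<close>

definition torus_coeff :: "nat \<Rightarrow> nat \<Rightarrow> nat \<Rightarrow> real \<Rightarrow> complex" where
  "torus_coeff n N p \<theta> = two_pi_i * unit_loop \<theta> *
      loop_log p \<theta> ^ (n - 1) / (1 - exp (loop_log p \<theta>)) ^ N"

text \<open>The pullback of one monomial: \<open>torus_coeff\<close> combines the Jacobian factors
  L' and L^(n - 1) with the denominator. Coordinate 1 is theta; \<open>wseq n 1 1\<close> puts S_1 =
  1 in its place, so the wedge form does not depend on theta.\<close>

definition torus_fun :: "nat \<Rightarrow> nat \<Rightarrow> nat \<Rightarrow> (nat \<Rightarrow> nat) \<Rightarrow>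
    (nat \<Rightarrow> real) \<Rightarrow> complex" where
  "torus_fun n N p b w = torus_coeff n N p (w 1) * exp (loop_log p (w 1) * of_real (wedge_form n b 1 1 w))"

definition open_prism :: "nat \<Rightarrow> (nat \<Rightarrow> real) set" where
  "open_prism n = {w \<in> wedge n 1 1. 0 < w 1 \<and> w 1 < 1} \<inter> space (lborel_n n)"

definition prism_cell :: "nat \<Rightarrow> nat \<Rightarrow> (nat \<Rightarrow> real) set" where
  "prism_cell n i = {w \<in> wedge n 1 1. wseq n 1 1 w (Suc i) < w 1 \<and> w 1 < wseq n 1 1 w i} \<inter> space (lborel_n n)"

lemma torus_coeff_props: "continuous_on UNIV (torus_coeff n N p)" "\<exists>C. \<forall>\<theta>. norm (torus_coeff n
    N p \<theta>) \<le> C"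
proof -
  define K where "K u = two_pi_i * u * (two_pi_i * of_nat p + u) ^ (n - 1) / (1 - exp u) ^ N" for u :: complex
  have nz: "(1 - exp z) ^ N \<noteq> 0" if "z \<in> sphere 0 1" for z :: complex
    using that exp_neq_1[of z] by (cases "z = 0") auto
  have K: "continuous_on (sphere 0 1) K"
    unfolding K_def using nz by (intro continuous_intros) auto
  have eq: "torus_coeff n N p \<theta> = K (unit_loop \<theta>)" for \<theta>
    unfolding torus_coeff_def exp_loop_log unfolding K_def loop_log_def ..
  have u: "continuous_on UNIV unit_loop" unfolding unit_loop_def[abs_def] by (intro continuous_intros)
  show "continuous_on UNIV (torus_coeff n N p)"
    unfolding eq[abs_def] by (rule continuous_on_compose2[OF K u]) auto
  have "bounded (K ` sphere 0 1)" by (intro compact_imp_bounded compact_continuous_image K compact_sphere)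
  then obtain C where "\<And>z. z \<in> sphere 0 1 \<Longrightarrow> norm (K z) \<le> C" unfolding bounded_iff by blast
  then show "\<exists>C. \<forall>\<theta>. norm (torus_coeff n N p \<theta>) \<le> C"
    unfolding eq by (intro exI[of _ C]) simp
qed

lemma loop_log_norm: "norm (loop_log p \<theta>) \<le> 2 * pi * p + 1"
proof -
  have "norm (loop_log p \<theta>) \<le> norm (two_pi_i * of_nat p :: complex) + norm (unit_loop \<theta>)"
    unfolding loop_log_def by (rule norm_triangle_ineq)
  then show ?thesis by (simp add: norm_mult)
qed

lemma component_borel_measurable:
  "i \<in> I \<Longrightarrow> (\<lambda>w. w i) \<in> borel_measurable (PiM I (\<lambda>_. lborel :: real measure))"
  by simp

lemma torus_fun_measurable:
  assumes "n \<ge> 1"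
  shows "torus_fun n N p b \<in> borel_measurable (lborel_n n)"
proof -
  have c: "torus_coeff n N p \<in> borel_measurable borel" "loop_log p \<in> borel_measurable borel"
    using torus_coeff_props(1) unfolding loop_log_def[abs_def] unit_loop_def[abs_def]
    by (auto intro!: borel_measurable_continuous_onI continuous_intros)
  have w1: "(\<lambda>w. w 1) \<in> borel_measurable (lborel_n n)"
    using assms by (intro component_borel_measurable) auto
  have "wedge_form n b 1 1 \<in> borel_measurable (lborel_n n)"
    by (rule wedge_form_measurable) auto
  then show ?thesis
    unfolding torus_fun_def[abs_def]
    by (intro borel_measurable_times measurable_compose[OF _ borel_measurable_exp] measurable_compose[OF w1] c
        measurable_compose[OF _ borel_measurable_of_real])
qed

lemma torus_fun_integrable:
  assumes n: "n \<ge> 1" and A: "A \<in> sets (lborel_n n)" "A \<subseteq> open_prism n"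
  shows "integrable (lborel_n n) (\<lambda>w. indicator A w *\<^sub>R torus_fun n N p b w)"
proof -
  obtain C where C: "\<And>\<theta>. norm (torus_coeff n N p \<theta>) \<le> C" using torus_coeff_props(2) by blast
  have C0: "C \<ge> 0" using C[of 0] norm_ge_zero order_trans by blast
  define E where "E = (2 * pi * p + 1) * (\<Sum>m\<in>{1..n}. real (b m))"
  have sub: "A \<subseteq> Pi\<^sub>E {1..n} (\<lambda>_. {0..1})"
  proof
    fix w assume w: "w \<in> A"
    then have w': "w \<in> wedge n 1 1" "0 < w 1" "w 1 < 1" "w \<in> space (lborel_n n)"
      using A(2) by (auto simp: open_prism_def)
    have "0 \<le> w m \<and> w m \<le> 1" if "m \<in> {1..n}" for m
      using wedge_bounds[OF w'(1), of m] w' that by (cases "m = 1") (auto simp: wseq_def)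
    then show "w \<in> Pi\<^sub>E {1..n} (\<lambda>_. {0..1})" using w'(4) by (auto simp: space_PiM PiE_iff)
  qed
  show ?thesis
  proof (rule integrableI_bounded_set_indicator[OF A(1) torus_fun_measurable[OF n]])
    show "emeasure (lborel_n n) A < \<infinity>" by (rule box_finite[OF _ A(1) sub]) simp
    show "AE w in lborel_n n. w \<in> A \<longrightarrow> norm (torus_fun n N p b w) \<le> C * exp E"
    proof (intro AE_I2 impI)
      fix w assume "w \<in> A"
      then have "w \<in> wedge n 1 1" using A(2) by (auto simp: open_prism_def)
      then have "norm (loop_log p (w 1) * of_real (wedge_form n b 1 1 w)) \<le> E"
        unfolding norm_mult norm_of_real E_def using loop_log_norm[of p "w 1"] wedge_form_bound[of w n 1 1 b]
        by (intro mult_mono) auto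
      then have "norm (exp (loop_log p (w 1) * of_real (wedge_form n b 1 1 w))) \<le> exp E"
        using norm_exp_le order_trans exp_le_cancel_iff by blast
      then show "norm (torus_fun n N p b w) \<le> C * exp E"
        unfolding torus_fun_def norm_mult using C C0 by (intro mult_mono) auto
    qed
  qed
qed

lemma open_prism_sets:
  assumes "n \<ge> 1"
  shows "open_prism n \<in> sets (lborel_n n)" "i \<ge> 1 \<Longrightarrow> prism_cell n i \<in> sets (lborel_n n)"
proof -
  have w1: "(\<lambda>w. w 1) \<in> borel_measurable (lborel_n n)"
    using assms by (intro component_borel_measurable) auto
  have W: "wedge n 1 1 \<inter> space (lborel_n n) \<in> sets (lborel_n n)" by (rule wedge_sets) auto
  have s: "(\<lambda>w. wseq n 1 1 w m) \<in> borel_measurable (lborel_n n)" if "m \<ge> 1" for m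
    using that by (intro wseq_measurable) auto
  have "{w \<in> space (lborel_n n). 0 < w 1} \<in> sets (lborel_n n)" "{w \<in> space (lborel_n n). w 1 < 1} \<in>
      sets (lborel_n n)"
    by (intro borel_measurable_less w1 borel_measurable_const)+
  moreover have "open_prism n = (wedge n 1 1 \<inter> space (lborel_n n)) \<inter>
      {w \<in> space (lborel_n n). 0 < w 1} \<inter> {w \<in> space (lborel_n n). w 1 < 1}"
    by (auto simp: open_prism_def)
  ultimately show "open_prism n \<in> sets (lborel_n n)" using W by auto
  assume i: "i \<ge> 1"
  have "{w \<in> space (lborel_n n). wseq n 1 1 w (Suc i) < w 1} \<in> sets (lborel_n n)"
    "{w \<in> space (lborel_n n). w 1 < wseq n 1 1 w i} \<in> sets (lborel_n n)"
    using i by (intro borel_measurable_less w1 s; simp)+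
  moreover have "prism_cell n i = (wedge n 1 1 \<inter> space (lborel_n n)) \<inter>
      {w \<in> space (lborel_n n). wseq n 1 1 w (Suc i) < w 1} \<inter> {w \<in> space (lborel_n n). w 1 < wseq n 1 1 w i}"
    by (auto simp: prism_cell_def)
  ultimately show "prism_cell n i \<in> sets (lborel_n n)" using W by auto
qed

lemma prism_cell_subset:
  assumes "i \<in> {1..n}"
  shows "prism_cell n i \<subseteq> open_prism n"
proof
  fix w assume w: "w \<in> prism_cell n i"
  then have v: "w \<in> wedge n 1 1" by (simp add: prism_cell_def)
  have "wseq n 1 1 w i \<le> 1" using wedge_bounds(2)[OF v, of i] assms by simp
  moreover have "0 \<le> wseq n 1 1 w (Suc i)"
    using wedge_bounds(1)[OF v, of "Suc i"] assms by (cases "Suc i \<le> n") (auto simp: wseq_def)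
  ultimately show "w \<in> open_prism n" using w by (auto simp: prism_cell_def open_prism_def)
qed

text \<open>The diagonal hyperplane is the image of the coordinate hyperplane \<open>t 1 = 0\<close>
  under a volume-preserving shear.\<close>

lemma AE_coordinates_neq:
  assumes "c \<in> {2..n}"
  shows "AE w in lborel_n n. w 1 \<noteq> w c"
proof -
  have mp: "measure_preserving n (shear 1 c)"
    unfolding measure_preserving_def using assms
    by (intro conjI shear_measurable shear_measure_preserving) auto
  have "AE t in lborel_n n. t 1 \<noteq> 0" by (rule AE_PiM_lborel_neq) (use assms in auto)
  then have "AE t in lborel_n n. shear 1 c t 1 \<noteq> shear 1 c t c"
    by eventually_elim (use assms in \<open>auto simp: shear_def\<close>)
  moreover have "{w \<in> space (lborel_n n). w 1 \<noteq> w c} \<in> sets (lborel_n n)"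
  proof -
    have "(\<lambda>w. w k) \<in> borel_measurable (lborel_n n)" if "k \<in> {1..n}" for k
      using that by (rule component_borel_measurable)
    then show ?thesis using assms by (intro borel_measurable_neq) auto
  qed
  ultimately have "AE w in distr (lborel_n n) (lborel_n n) (shear 1 c). w 1 \<noteq> w c"
    using mp by (subst AE_distr_iff) (auto simp: measure_preserving_def)
  then show ?thesis using mp unfolding measure_preserving_def by (simp only:)
qed

lemma AE_prism_cells:
  assumes "n \<ge> 1"
  shows "AE w in lborel_n n. (\<Sum>i\<in>{1..n}. indicator (prism_cell n i) w :: real) = indicator (open_prism n) w"
proof -
  have "AE w in lborel_n n. \<forall>c\<in>{2..n}. w 1 \<noteq> w c"
    by (intro AE_finite_allI AE_coordinates_neq) auto
  then show ?thesis
  proof eventually_elim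
    case (elim w)
    show ?case
    proof (cases "w \<in> open_prism n")
      case False
      then have "w \<notin> prism_cell n i" if "i \<in> {1..n}" for i using prism_cell_subset[OF that] by auto
      then show ?thesis using False by (simp add: indicator_def)
    next
      case True
      then have w: "w \<in> wedge n 1 1" "0 < w 1" "w 1 < 1" "w \<in> space (lborel_n n)" by (auto simp: open_prism_def)
      \<comment> \<open>Off the walls, the indicator of cell i is the drop of this step function
        between i and i + 1, so the sum over the cells telescopes.\<close>
      define a where "a m = (if w 1 < wseq n 1 1 w m then 1 else 0 :: real)" for m
      have "indicator (prism_cell n i) w = a i - a (Suc i)" if i: "i \<in> {1..n}" for i
      proof -
        have "wseq n 1 1 w (Suc i) < wseq n 1 1 w i" using w(1) i by (simp add: wedge_def)
        moreover have "wseq n 1 1 w (Suc i) \<noteq> w 1"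
          using bspec[OF elim, of "Suc i"] i w by (cases "Suc i \<le> n") (auto simp: wseq_def)
        ultimately show ?thesis using w by (auto simp: prism_cell_def a_def indicator_def)
      qed
      then have "(\<Sum>i\<in>{1..n}. indicator (prism_cell n i) w) = (\<Sum>i\<in>{1..n}. a i - a (Suc i))"
        by (intro sum.cong) auto
      also have "\<dots> = a 1 - a (Suc n)"
        using sum_Suc_diff[of 1 n "\<lambda>i. - a i"] assms by simp
      also have "\<dots> = 1" using w assms by (simp add: a_def wseq_def)
      finally show ?thesis using True by simp
    qed
  qed
qed

text \<open>Fubini with theta outermost: at fixed theta the inner integral is a wedge integral with
  z = L(theta), and the Jacobian power L^(n - 1) is exactly the one that turns it into the transform
  of a partial fraction decomposition. The theta integral is then a residue.\<close>

lemma open_prism_integral: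
  assumes n: "n \<ge> 1" and b: "\<And>m. b m > 0"
  shows "(\<integral>w. indicator (open_prism n) w *\<^sub>R torus_fun n N p b w \<partial>lborel_n n) =
    (-1) ^ n * (\<Sum>k=1..n. loop_coeff p k * of_rat (pf_coeff N k (pf_prod (map b [1..<Suc n]))))"
proof -
  interpret product_sigma_finite "\<lambda>_::nat. lborel :: real measure" by (rule product_lborel)
  let ?bs = "map b [1..<Suc n]"
  let ?h = "\<lambda>\<theta>. two_pi_i * unit_loop \<theta> * (pf_exp (pf_prod ?bs) (loop_log p \<theta>) / (1 - exp
      (loop_log p \<theta>)) ^ N)"
  have ins: "{1..n} = insert 1 {Suc 1..n}" using n by auto
  define f where "f w = indicator (open_prism n) w *\<^sub>R torus_fun n N p b w" for w
  have "integrable (lborel_n n) f"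
    unfolding f_def by (intro torus_fun_integrable n open_prism_sets) auto
  then have fi: "integrable (PiM (insert 1 {Suc 1..n}) (\<lambda>_. lborel)) f" unfolding ins .
  have fy: "f (v(1 := \<theta>)) = (indicator {0<..<1} \<theta> * torus_coeff n N p \<theta>) *
      (indicator (wedge n 1 1) v *\<^sub>R exp (loop_log p \<theta> * of_real (wedge_form n b 1 1 v)))"
    if "v \<in> space (lborel_on {Suc 1..n})" for v \<theta>
  proof -
    have s: "wseq n 1 1 (v(1 := \<theta>)) m = wseq n 1 1 v m" for m by (simp add: wseq_def)
    have "v(1 := \<theta>) \<in> space (lborel_n n)"
      using that n unfolding ins by (auto simp: space_PiM PiE_iff extensional_def)
    then have "v(1 := \<theta>) \<in> open_prism n \<longleftrightarrow> v \<in> wedge n 1 1 \<and> 0 < \<theta>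
        \<and> \<theta> < 1"
      by (simp add: open_prism_def wedge_def s del: One_nat_def)
    moreover have "wedge_form n b 1 1 (v(1 := \<theta>)) = wedge_form n b 1 1 v"
      unfolding wedge_form_def s ..
    ultimately show ?thesis by (auto simp: f_def torus_fun_def indicator_def)
  qed
  have "(\<integral>w. f w \<partial>lborel_n n) = (\<integral>\<theta>. (\<integral>v. f (v(1 := \<theta>))
      \<partial>lborel_on {Suc 1..n}) \<partial>lborel)"
    using product_integral_insert_rev[OF _ _ fi] unfolding ins by simp
  also have "\<dots> = (\<integral>\<theta>. (indicator {0<..<1} \<theta> * torus_coeff n N p \<theta>) *
      wedge_int n b (loop_log p \<theta>) 1 1 \<partial>lborel)"
  proof (rule Bochner_Integration.integral_cong[OF refl])
    fix \<theta> :: real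
    have "(\<integral>v. f (v(1 := \<theta>)) \<partial>lborel_on {Suc 1..n}) =
      (\<integral>v. (indicator {0<..<1} \<theta> * torus_coeff n N p \<theta>) *
      (indicator (wedge n 1 1) v *\<^sub>R exp (loop_log p \<theta> *
          of_real (wedge_form n b 1 1 v))) \<partial>lborel_on {Suc 1..n})"
      by (intro Bochner_Integration.integral_cong refl fy)
    then show "(\<integral>v. f (v(1 := \<theta>)) \<partial>lborel_on {Suc 1..n}) =
      (indicator {0<..<1} \<theta> * torus_coeff n N p \<theta>) * wedge_int n b (loop_log p \<theta>) 1 1"
      unfolding wedge_int_def by (simp only: integral_mult_right_zero)
  qed
  also have "\<dots> = (\<integral>\<theta>. indicator {0<..<1} \<theta> *\<^sub>R ((-1) ^ n * (?h \<theta>)) \<partial>lborel)"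
  proof (rule Bochner_Integration.integral_cong[OF refl])
    fix \<theta> :: real
    have "loop_log p \<theta> ^ (n - 1) * wedge_int n b (loop_log p \<theta>) 1 1 =
        (-1) ^ n * pf_exp (pf_prod ?bs) (loop_log p \<theta>)"
      using wedge_int_eq_pf_exp[OF n, of 1 b "loop_log p \<theta>"] b n by (simp del: upt_Suc)
    then have "torus_coeff n N p \<theta> * wedge_int n b (loop_log p \<theta>) 1 1 =
      two_pi_i * unit_loop \<theta> * ((-1) ^ n * pf_exp (pf_prod ?bs) (loop_log p \<theta>)) / (1 - exp (loop_log p
          \<theta>)) ^ N"
      unfolding torus_coeff_def by (metis (no_types, lifting) mult.assoc times_divide_eq_left)
    then show "(indicator {0<..<1} \<theta> * torus_coeff n N p \<theta>) * wedge_int n b (loop_log p \<theta>) 1 1 =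
      indicator {0<..<1} \<theta> *\<^sub>R ((-1) ^ n * (?h \<theta>))"
      by (auto simp: indicator_def mult_ac simp del: upt_Suc)
  qed
  also have "\<dots> = (LBINT \<theta>:{0..1}. (-1) ^ n * (?h \<theta>))"
    by (rule integral_Ioo_Icc) simp
  also have "\<dots> = (-1) ^ n * (LBINT \<theta>:{0..1}. ?h \<theta>)"
    by (rule set_integral_mult_right)
  also have "(LBINT \<theta>:{0..1}. ?h \<theta>) =
      (\<Sum>k=1..n. loop_coeff p k * of_rat (pf_coeff N k (pf_prod ?bs)))"
  proof -
    have "1 \<le> l \<and> l \<le> n" if "(c, j, l) \<in> set (pf_prod ?bs)" for c j l
      using pf_prod_entries(1,2)[OF that] b n by auto
    then have "\<forall>(c, j, l)\<in>set (pf_prod ?bs). 1 \<le> l \<and> l \<le> n" by blast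
    from pf_exp_loop_integral[OF this, of p N] show ?thesis by (rule conjunct2)
  qed
  finally show ?thesis unfolding f_def .
qed

lemma prism_cells_integral:
  assumes n: "n \<ge> 1"
  shows "(\<Sum>i\<in>{1..n}. \<integral>w. indicator (prism_cell n i) w *\<^sub>R torus_fun n N p b w \<partial>lborel_n n) =
    (\<integral>w. indicator (open_prism n) w *\<^sub>R torus_fun n N p b w \<partial>lborel_n n)"
proof -
  have i: "integrable (lborel_n n) (\<lambda>w. indicator (prism_cell n i) w *\<^sub>R torus_fun n N p b w)" if "i
      \<in> {1..n}" for i
    using that by (intro torus_fun_integrable n open_prism_sets prism_cell_subset) auto
  have "(\<Sum>i\<in>{1..n}. \<integral>w. indicator (prism_cell n i) w *\<^sub>R torus_fun n N p b w \<partial>lborel_n n) =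
    (\<integral>w. (\<Sum>i\<in>{1..n}. indicator (prism_cell n i) w *\<^sub>R torus_fun n N p b w) \<partial>lborel_n n)"
    using i by (subst Bochner_Integration.integral_sum) auto
  also have "\<dots> = (\<integral>w. indicator (open_prism n) w *\<^sub>R torus_fun n N p b w \<partial>lborel_n n)"
  proof (rule integral_cong_AE)
    show "AE w in lborel_n n. (\<Sum>i\<in>{1..n}. indicator (prism_cell n i) w *\<^sub>R torus_fun n N p b w) =
        indicator (open_prism n) w *\<^sub>R torus_fun n N p b w"
      using AE_prism_cells[OF n] by eventually_elim (simp add: scaleR_sum_left[symmetric])
    show "(\<lambda>w. \<Sum>i\<in>{1..n}. indicator (prism_cell n i) w *\<^sub>R torus_fun n N p b w) \<in>
        borel_measurable (lborel_n n)"
      using i by (intro borel_measurable_sum) auto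
    show "(\<lambda>w. indicator (open_prism n) w *\<^sub>R torus_fun n N p b w) \<in> borel_measurable (lborel_n n)"
      using torus_fun_integrable[OF n open_prism_sets(1)[OF n]] by auto
  qed
  finally show ?thesis .
qed

text \<open>The integrand of a simplex is computed only over the open simplex; completeness makes it
  measurable from agreement almost everywhere.\<close>

lemma integral_completion_cong_AE:
  fixes f g :: "'a \<Rightarrow> complex"
  assumes g: "g \<in> borel_measurable M" and ae: "AE x in M. f x = g x"
  shows "integral\<^sup>L (completion M) f = integral\<^sup>L M g"
proof -
  have g': "g \<in> borel_measurable (completion M)" using g by (rule measurable_completion)
  have ae': "AE x in completion M. f x = g x" using ae by (rule AE_completion)
  have f': "f \<in> borel_measurable (completion M)"
  proof (rule measurableI)
    fix B :: "complex set" assume "B \<in> sets borel"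
    with g' have "g -` B \<inter> space (completion M) \<in> sets (completion M)" by (rule measurable_sets)
    then show "f -` B \<inter> space (completion M) \<in> sets (completion M)"
    proof (rule completion.in_sets_AE[rotated])
      show "AE x in completion M. (x \<in> g -` B \<inter> space (completion M)) = (x \<in> f -` B \<inter> space (completion M))"
        using ae' by eventually_elim auto
    qed auto
  qed auto
  have "integral\<^sup>L (completion M) f = integral\<^sup>L (completion M) g"
    by (rule integral_cong_AE[OF f' g' ae'])
  then show ?thesis using integral_completion[OF g] by simp
qed

section \<open>Change of variables on a single simplex of the prism\<close>

definition chart_interior :: "nat \<Rightarrow> (nat \<Rightarrow> real) set" where
  "chart_interior n = {t \<in> chart_simplex n. \<forall>k\<le>n. 0 < barycentric n t k}"

lemma tail_step: "m \<le> n \<Longrightarrow> tail n t m = t m + tail n t (Suc m)"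
  unfolding tail_def by (rule sum.atLeast_Suc_atMost)

lemma tail_barycentric:
  "1 \<le> m \<Longrightarrow> tail n (barycentric n t) m = tail n t m"
  "tail n (barycentric n t) 0 = 1"
proof -
  show *: "tail n (barycentric n t) m = tail n t m" if "1 \<le> m" for m
    unfolding tail_def using that by (intro sum.cong) (auto simp: barycentric_def)
  have "tail n (barycentric n t) 0 = barycentric n t 0 + tail n (barycentric n t) 1"
    using tail_step[of 0 n "barycentric n t"] by simp
  then show "tail n (barycentric n t) 0 = 1"
    using *[of 1] by (simp add: barycentric_def tail_def)
qed

lemma tail_update:
  assumes "j \<in> {1..n}"
  shows "tail n (barycentric n (t(j := s))) m =
    tail n (barycentric n t) m + (if 1 \<le> m \<and> m \<le> j then 1 else 0) * (s - t j)"
proof (cases "m = 0")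
  case False
  have "tail n (t(j := s)) m = tail n t m + (if m \<le> j then 1 else 0) * (s - t j)"
  proof (cases "m \<le> j")
    case True
    then have j: "j \<in> {m..n}" using assms by auto
    have "tail n (t(j := s)) m = s + (\<Sum>i\<in>{m..n} - {j}. t i)"
      unfolding tail_def by (subst sum.remove[OF _ j]) auto
    moreover have "tail n t m = t j + (\<Sum>i\<in>{m..n} - {j}. t i)"
      unfolding tail_def by (subst sum.remove[OF _ j]) auto
    ultimately show ?thesis using True by simp
  next
    case False
    then show ?thesis unfolding tail_def by (auto intro!: sum.cong)
  qed
  then show ?thesis using False by (simp add: tail_barycentric)
qed (simp add: tail_barycentric)

lemma prism_seq_shuffle:
  assumes "1 \<le> i" "i \<le> n" "1 \<le> m" "m \<le> Suc n"
  shows "prism_seq n i (barycentric n t) m = wseq n 1 1 (shuffle n i t) m"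
proof -
  consider "m = 1" | "1 < m" "m \<le> n" | "m = Suc n" using assms by linarith
  then show ?thesis
  proof cases
    case 2
    then show ?thesis using assms
      by (simp add: prism_seq_def wseq_def shuffle_def tail_barycentric)
  qed (use assms in \<open>auto simp: prism_seq_def wseq_def tail_barycentric\<close>)
qed

lemma shuffle_1: "1 \<le> i \<Longrightarrow> i \<le> n \<Longrightarrow> shuffle n i t 1 = tail n t i"
  by (simp add: shuffle_def)

text \<open>Consecutive tail sums differ by a barycentric coordinate. Inserting theta between S_i
  and S_(i+1) recovers all tail sums in order, so the strict inequalities of the cell say that all
  barycentric coordinates are positive.\<close>

lemma chart_interior_iff_cell:
  assumes i: "1 \<le> i" "i \<le> n" and t: "t \<in> space (lborel_n n)"
  shows "t \<in> chart_interior n \<longleftrightarrow> shuffle n i t \<in> prism_cell n i"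
proof -
  let ?b = "barycentric n t"
  let ?S = "prism_seq n i ?b"
  let ?T = "tail n ?b"
  have step: "?T k = ?b k + ?T (Suc k)" if "k \<le> n" for k using that by (rule tail_step)
  have sh: "shuffle n i t \<in> space (lborel_n n)"
    using shuffle_measure_preserving[OF i] measurable_space[OF _ t] unfolding measure_preserving_def by blast
  have Ti: "?T i = shuffle n i t 1" using i by (simp add: tail_barycentric shuffle_1 del: One_nat_def)
  have "shuffle n i t \<in> prism_cell n i \<longleftrightarrow> (\<forall>m\<in>{1..n}. ?S (Suc m) < ?S m) \<and> ?S
      (Suc i) < ?T i \<and> ?T i < ?S i"
    using sh i by (auto simp: prism_cell_def wedge_def Ti prism_seq_shuffle[OF i])
  also have "\<dots> \<longleftrightarrow> (\<forall>k\<le>n. 0 < ?b k)"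
  proof (intro iffI conjI ballI allI impI)
    fix k assume *: "(\<forall>m\<in>{1..n}. ?S (Suc m) < ?S m) \<and> ?S (Suc i) < ?T i \<and> ?T i < ?S i" and k: "k \<le> n"
    consider "Suc k < i" | "Suc k = i" | "k = i" | "i < k" using i by linarith
    then show "0 < ?b k"
    proof cases
      case 1
      then have "?S (Suc (Suc k)) < ?S (Suc k)" using * i by auto
      then show ?thesis using 1 step[OF k] by (simp add: prism_seq_def)
    next
      case 2
      then have "?T i < ?T k" using * by (auto simp: prism_seq_def)
      then show ?thesis using 2 step[OF k] by simp
    next
      case 3
      then have "?T (Suc i) < ?T i" using * by (auto simp: prism_seq_def)
      then show ?thesis using 3 step[OF k] by simp
    next
      case 4
      then have "?S (Suc k) < ?S k" using * k i by auto
      then show ?thesis using 4 step[OF k] by (simp add: prism_seq_def)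
    qed
  next
    assume b: "\<forall>k\<le>n. 0 < ?b k"
    have s: "?T (Suc k) < ?T k" if "k \<le> n" for k using step[OF that] b that by simp
    show "?S (Suc i) < ?T i" using s[of i] i by (simp add: prism_seq_def)
    show "?T i < ?S i" using s[of "i - 1"] i by (simp add: prism_seq_def)
    fix m assume m: "m \<in> {1..n}"
    show "?S (Suc m) < ?S m"
    proof (cases "m = i")
      case True
      have "?T (Suc i) < ?T i" "?T i < ?T (i - 1)" using s[of i] s[of "i - 1"] i by simp_all
      then have "?T (Suc i) < ?T (i - 1)" by (rule less_trans)
      then show ?thesis using True by (simp add: prism_seq_def)
    next
      case False
      then show ?thesis using s[of m] s[of "m - 1"] m by (auto simp: prism_seq_def)
    qed
  qed
  also have "\<dots> \<longleftrightarrow> t \<in> chart_interior n"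
  proof
    assume b: "\<forall>k\<le>n. 0 < ?b k"
    have "0 \<le> t j" if "j \<in> {1..n}" for j
      using b[rule_format, of j] that by (auto simp: barycentric_def)
    moreover have "(\<Sum>j\<in>{1..n}. t j) \<le> 1" using b[rule_format, of 0] by (simp add: barycentric_def)
    ultimately have "t \<in> chart_simplex n"
      using t by (auto simp: chart_simplex_def space_PiM PiE_iff)
    then show "t \<in> chart_interior n" using b by (simp add: chart_interior_def)
  qed (simp add: chart_interior_def)
  finally show ?thesis ..
qed

lemma AE_chart_interior:
  assumes "n \<ge> 1"
  shows "AE t in lborel_n n. t \<in> chart_simplex n \<longleftrightarrow> t \<in> chart_interior n"
proof -
  have "AE t in lborel_n n. \<forall>j\<in>{1..n}. t j \<noteq> 0"
    by (intro AE_finite_allI AE_PiM_lborel_neq) auto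
  \<comment> \<open>The oblique face of the chart is the preimage of the coordinate hyperplane
    \<open>w 1 = 1\<close> under \<open>shuffle n 1\<close>.\<close>
  moreover have "AE t in lborel_n n. tail n t 1 \<noteq> 1"
  proof -
    have mp: "measure_preserving n (shuffle n 1)" using assms by (intro shuffle_measure_preserving) auto
    have m: "{w \<in> space (lborel_n n). w 1 \<noteq> 1} \<in> sets (lborel_n n)"
      using assms by (intro borel_measurable_neq component_borel_measurable borel_measurable_const) auto
    have "AE w in lborel_n n. w 1 \<noteq> 1" by (rule AE_PiM_lborel_neq) (use assms in auto)
    then have "AE w in distr (lborel_n n) (lborel_n n) (shuffle n 1). w 1 \<noteq> 1"
      using mp unfolding measure_preserving_def by (simp only:)
    then have "AE t in lborel_n n. shuffle n 1 t 1 \<noteq> 1"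
      using mp m by (subst (asm) AE_distr_iff) (auto simp: measure_preserving_def)
    then show ?thesis by (simp only: shuffle_1[OF order_refl assms])
  qed
  ultimately show ?thesis
  proof eventually_elim
    case (elim t)
    have "0 < barycentric n t k" if t: "t \<in> chart_simplex n" and k: "k \<le> n" for k
    proof (cases "k = 0")
      case True
      then show ?thesis using t elim by (auto simp: barycentric_def chart_simplex_def tail_def)
    next
      case False
      then have "0 \<le> t k" "t k \<noteq> 0" using t elim k by (auto simp: chart_simplex_def PiE_iff)
      then show ?thesis using False k by (simp add: barycentric_def)
    qed
    then show ?case by (auto simp: chart_interior_def)
  qed
qed

text \<open>\<open>prism\<close> follows its formula only on the simplex, so a partial derivative
  requires a whole segment of the coordinate line inside it. The upper end is where the coordinate
  of vertex 0 is used up.\<close>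

lemma chart_interior_line:
  assumes t: "t \<in> chart_interior n" and j: "j \<in> {1..n}" and s: "0 < s" "s < t j + barycentric n t 0"
  shows "barycentric n (t(j := s)) \<in> standard_simplex n"
proof (rule barycentric_simplex)
  have tc: "t \<in> chart_simplex n" using t by (simp add: chart_interior_def)
  have "tail n (barycentric n (t(j := s))) 1 = tail n (barycentric n t) 1 + (s - t j)"
    using tail_update[OF j, of t s 1] j by simp
  then have "(\<Sum>i\<in>{1..n}. (t(j := s)) i) = (\<Sum>i\<in>{1..n}. t i) + (s - t j)"
    unfolding tail_barycentric(1)[OF order_refl] unfolding tail_def .
  also have "\<dots> \<le> 1" using s(2) by (simp add: barycentric_def)
  finally show "t(j := s) \<in> chart_simplex n"
    using tc j s by (auto simp: chart_simplex_def PiE_iff extensional_def)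
qed

lemma prism_partial_deriv:
  assumes i: "1 \<le> i" "i \<le> n" and t: "t \<in> chart_interior n" and j: "j \<in> {1..n}" and m: "m \<in> {1..n}"
  defines "b \<equiv> barycentric n t"
  defines "D \<equiv> \<lambda>m j. if 1 \<le> m \<and> m \<le> j then 1 else 0 :: complex"
  defines "dS \<equiv> \<lambda>m j. if m \<le> i then D (m - 1) j else D m j"
  shows "partial_deriv j (\<lambda>s. prism n p i (barycentric n s) m) t =
    prism_map n p i b m * ((dS m j - dS (Suc m) j) * loop_log p (tail n b i) +
      (of_real (prism_seq n i b m) - of_real (prism_seq n i b (Suc m))) *
      (two_pi_i * unit_loop (tail n b i)) * D i j)"
proof -
  let ?X = "prism_map n p i b m"
  define A where "A = complex_of_real (prism_seq n i b m - prism_seq n i b (Suc m))"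
  define B where "B = dS m j - dS (Suc m) j"
  define \<theta> where "\<theta> = complex_of_real (tail n b i)"
  define c where "c = two_pi_i * of_nat p"
  \<comment> \<open>Tail sums are affine along the line, so the component is the restriction of this
    entire function, to which the complex differentiation rules apply.\<close>
  define g where "g z = exp ((A + B * (z - of_real (t j))) *
      (c + exp (two_pi_i * (\<theta> + D i j * (z - of_real (t j))))))" for z :: complex
  have D: "D m j = of_real (if 1 \<le> m \<and> m \<le> j then 1 else 0)" for m by (simp add: D_def)
  have seq: "complex_of_real (prism_seq n i (barycentric n (t(j := s))) m) =
      of_real (prism_seq n i b m) + dS m j * (of_real s - of_real (t j))" for s m
    unfolding prism_seq_def tail_update[OF j] dS_def D b_def by simp
  have tl: "complex_of_real (tail n (barycentric n (t(j := s))) i) = \<theta> + D i j * (of_real s - of_real (t j))" for s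
    unfolding tail_update[OF j] D \<theta>_def b_def by simp
  have gs: "prism n p i (barycentric n (t(j := s))) m = g (of_real s)"
    if "s \<in> {0<..<t j + barycentric n t 0}" for s
  proof -
    have "barycentric n (t(j := s)) \<in> standard_simplex n"
      using chart_interior_line[OF t j] that by simp
    then have "prism n p i (barycentric n (t(j := s))) m = prism_map n p i (barycentric n (t(j := s))) m"
      by (simp add: prism_def)
    also have "\<dots> = g (of_real s)"
      using m unfolding prism_map_def loop_log_def unit_loop_def of_real_diff seq tl g_def A_def B_def c_def
      by (simp add: algebra_simps)
    finally show ?thesis .
  qed
  have X: "exp (A * (c + exp (two_pi_i * \<theta>))) = ?X"
    using m by (simp add: prism_map_def A_def c_def \<theta>_def loop_log_def unit_loop_def)
  have "(g has_field_derivative ?X * (B * (c + exp (two_pi_i * \<theta>)) +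
      A * (two_pi_i * exp (two_pi_i * \<theta>)) * D i j)) (at (of_real (t j)))"
    unfolding g_def by (auto intro!: derivative_eq_intros simp: X[symmetric] algebra_simps)
  then have "((\<lambda>s. g (of_real s)) has_vector_derivative ?X * (B * (c + exp (two_pi_i * \<theta>)) +
      A * (two_pi_i * exp (two_pi_i * \<theta>)) * D i j)) (at (t j))"
    by (rule has_vector_derivative_real_field)
  then have "((\<lambda>s. prism n p i (barycentric n (t(j := s))) m) has_vector_derivative
      ?X * (B * (c + exp (two_pi_i * \<theta>)) +
      A * (two_pi_i * exp (two_pi_i * \<theta>)) * D i j)) (at (t j))"
  proof (rule has_vector_derivative_transform_within_open)
    have "0 < barycentric n t j" "0 < barycentric n t 0" using t j by (auto simp: chart_interior_def)
    then show "t j \<in> {0<..<t j + barycentric n t 0}" using j by (simp add: barycentric_def)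
  qed (use gs in auto)
  then have "partial_deriv j (\<lambda>s. prism n p i (barycentric n s) m) t = ?X * (B * (c + exp (two_pi_i * \<theta>)) +
      A * (two_pi_i * exp (two_pi_i * \<theta>)) * D i j)"
    unfolding partial_deriv_def by (rule vector_derivative_at)
  then show ?thesis
    by (simp add: A_def B_def c_def \<theta>_def loop_log_def unit_loop_def)
qed

lemma prism_jacobian:
  assumes i: "1 \<le> i" "i \<le> n" and t: "t \<in> chart_interior n"
  defines "b \<equiv> barycentric n t"
  shows "jacobian_det n (prism n p i) t = (-1) ^ (i - 1) * (\<Prod>m\<in>{1..n}. prism_map n p i b m) *
    (two_pi_i * unit_loop (tail n b i)) * loop_log p (tail n b i) ^ (n - 1)"
proof -
  let ?D = "\<lambda>m j. if 1 \<le> m \<and> m \<le> j then 1 else 0 :: complex"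
  let ?dS = "\<lambda>m j. if m \<le> i then ?D (m - 1) j else ?D m j"
  let ?S = "\<lambda>m. complex_of_real (prism_seq n i b m)"
  let ?M = "Matrix.mat n n (\<lambda>(k, j). prism_map n p i b (Suc k) *
      ((?dS (Suc k) (Suc j) - ?dS (Suc (Suc k)) (Suc j)) * loop_log p (tail n b i) +
      (?S (Suc k) - ?S (Suc (Suc k))) * (two_pi_i * unit_loop (tail n b i)) * ?D i (Suc j)))"
  have "Matrix.mat n n (\<lambda>(k, j). partial_deriv (Suc j) (\<lambda>s. prism n p i (barycentric n s) (Suc k)) t) = ?M"
    (is "?J = _")
  proof (rule eq_matI)
    fix k j assume "k < dim_row ?M" "j < dim_col ?M"
    then have kj: "k < n" "j < n" by simp_all
    then have "Suc j \<in> {1..n}" "Suc k \<in> {1..n}" by auto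
    from prism_partial_deriv[OF i t this, of p] kj
    show "?J $$ (k, j) = ?M $$ (k, j)"
      unfolding b_def by (simp only: index_mat split_conv)
  qed simp_all
  moreover have "?S 1 = 1" "?S (Suc n) = 0"
    using prism_seq_ends[OF i, of b] by (simp_all add: b_def tail_barycentric)
  ultimately show ?thesis
    unfolding jacobian_det_def using prism_det[OF i, where S = ?S] by simp
qed

text \<open>The product of the x_m in the Jacobian raises each exponent e_m of a monomial to e_m +
  1, the same shift that integrating a monomial over the cube produces.\<close>

lemma prism_integrand:
  assumes i: "1 \<le> i" "i \<le> n" and t: "t \<in> chart_interior n"
  shows "form_coeff n P N (prism n p i (barycentric n t)) * jacobian_det n (prism n p i) t =
    (-1) ^ (i - 1) * (\<Sum>e\<in>keys P. of_rat (lookup P e) *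
      torus_fun n N p (\<lambda>m. Suc (lookup e m)) (shuffle n i t))"
proof -
  let ?b = "barycentric n t"
  let ?x = "prism_map n p i ?b"
  let ?L = "loop_log p (tail n ?b i)"
  let ?w = "shuffle n i t"
  have th: "tail n ?b i = ?w 1" using i by (simp add: tail_barycentric shuffle_1 del: One_nat_def)
  have bs: "?b \<in> standard_simplex n" using t barycentric_simplex by (simp add: chart_interior_def)
  then have pr: "prism n p i ?b = ?x" by (simp add: prism_def)
  have "(\<Prod>m\<in>{1..n}. ?x m) = exp ?L" using prism_map_prod[OF i] by (simp add: tail_barycentric)
  then have den: "1 - (\<Prod>m\<in>{1..n}. ?x m) = 1 - exp ?L" by simp
  have mono: "(\<Prod>m\<in>{1..n}. ?x m ^ e m) * (\<Prod>m\<in>{1..n}. ?x m) =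
      exp (?L * of_real (wedge_form n (\<lambda>m. Suc (e m)) 1 1 ?w))" for e :: "nat \<Rightarrow> nat"
  proof -
    have "(\<Prod>m\<in>{1..n}. ?x m ^ e m) * (\<Prod>m\<in>{1..n}. ?x m) = (\<Prod>m\<in>{1..n}. ?x m ^ Suc (e m))"
      by (simp add: prod.distrib mult.commute)
    also have "\<dots> = (\<Prod>m\<in>{1..n}. exp (?L * of_real (of_nat (Suc (e m)) *
        (wseq n 1 1 ?w m - wseq n 1 1 ?w (Suc m)))))"
    proof (rule prod.cong[OF refl])
      fix m assume m: "m \<in> {1..n}"
      have "?x m = exp (of_real (wseq n 1 1 ?w m - wseq n 1 1 ?w (Suc m)) * ?L)"
        using m i by (simp add: prism_map_def prism_seq_shuffle)
      then show "?x m ^ Suc (e m) = exp (?L * of_real (of_nat (Suc (e m)) * (wseq n 1 1 ?w m - wseq n 1 1 ?w (Suc m))))"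
        by (simp add: exp_of_nat_mult[symmetric] mult_ac del: power_Suc of_nat_Suc of_real_diff)
    qed
    also have "\<dots> = exp (?L * of_real (wedge_form n (\<lambda>m. Suc (e m)) 1 1 ?w))"
      by (simp add: wedge_form_def exp_sum[symmetric] sum_distrib_left del: of_nat_Suc of_real_diff)
    finally show ?thesis .
  qed
  have "form_coeff n P N (prism n p i ?b) * jacobian_det n (prism n p i) t =
    (-1) ^ (i - 1) * (\<Sum>e\<in>keys P. of_rat (lookup P e) *
      ((two_pi_i * unit_loop (tail n ?b i)) * ?L ^ (n - 1) / (1 - exp ?L) ^ N *
      ((\<Prod>m\<in>{1..n}. ?x m ^ lookup e m) * (\<Prod>m\<in>{1..n}. ?x m))))"
    unfolding form_coeff_def pr den prism_jacobian[OF i t] eval_rat_mpoly_def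
    by (simp add: sum_distrib_left sum_distrib_right sum_divide_distrib mult_ac)
  then show ?thesis unfolding mono unfolding torus_fun_def torus_coeff_def th .
qed

text \<open>\<open>shuffle\<close> preserves volume, but its orientation sign is present in the
  Jacobian; the sign of the simplex in the chain cancels it, so all cells enter with the same
  sign.\<close>

lemma simplex_integral_prism:
  assumes i: "1 \<le> i" "i \<le> n"
  shows "(-1) ^ (i - 1) * simplex_integral n P N (prism n p i) =
    (\<Sum>e\<in>keys P. of_rat (lookup P e) *
      (\<integral>w. indicator (prism_cell n i) w *\<^sub>R torus_fun n N p (\<lambda>m. Suc (lookup e m)) w
          \<partial>lborel_n n))"
proof -
  have n: "n \<ge> 1" using i by simp
  let ?c = "\<lambda>e. of_rat (lookup P e) :: complex"
  let ?h = "\<lambda>e w. indicator (prism_cell n i) w *\<^sub>R torus_fun n N p (\<lambda>m. Suc (lookup e m)) w"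
  define G where "G w = (-1) ^ (i - 1) * (\<Sum>e\<in>keys P. ?c e * ?h e w)" for w
  have hi: "integrable (lborel_n n) (?h e)" for e
    using i by (intro torus_fun_integrable n open_prism_sets prism_cell_subset) auto
  have G: "G \<in> borel_measurable (lborel_n n)"
    unfolding G_def[abs_def] by (intro borel_measurable_times borel_measurable_sum borel_measurable_const
      borel_measurable_integrable hi)
  have mp: "measure_preserving n (shuffle n i)" by (rule shuffle_measure_preserving[OF i])
  then have sh: "shuffle n i \<in> lborel_n n \<rightarrow>\<^sub>M lborel_n n" by (simp add: measure_preserving_def)
  have "AE t in lborel_n n. indicator (chart_simplex n) t *\<^sub>R
      (form_coeff n P N (prism n p i (barycentric n t)) * jacobian_det n (prism n p i) t) = G (shuffle n i t)"
    using AE_chart_interior[OF n] AE_space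
  proof eventually_elim
    case (elim t)
    show ?case
    proof (cases "t \<in> chart_interior n")
      case True
      then have "shuffle n i t \<in> prism_cell n i" using chart_interior_iff_cell[OF i elim(2)] by simp
      then show ?thesis using True elim(1) prism_integrand[OF i True] by (simp add: G_def)
    next
      case False
      then have "shuffle n i t \<notin> prism_cell n i" using chart_interior_iff_cell[OF i elim(2)] by simp
      then show ?thesis using False elim(1) by (simp add: G_def)
    qed
  qed
  then have "simplex_integral n P N (prism n p i) = (\<integral>t. G (shuffle n i t) \<partial>lborel_n n)"
    unfolding simplex_integral_def set_lebesgue_integral_def lebesgue_n_def
    by (rule integral_completion_cong_AE[OF measurable_compose[OF sh G]])
  also have "\<dots> = (\<integral>w. G w \<partial>distr (lborel_n n) (lborel_n n) (shuffle n i))"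
    by (rule integral_distr[OF sh G, symmetric])
  also have "\<dots> = (\<integral>w. G w \<partial>lborel_n n)" using mp unfolding measure_preserving_def by (simp only:)
  also have "\<dots> = (-1) ^ (i - 1) * (\<Sum>e\<in>keys P. ?c e * (\<integral>w. ?h e w \<partial>lborel_n n))"
  proof -
    have "(\<integral>w. (\<Sum>e\<in>keys P. ?c e * ?h e w) \<partial>lborel_n n) =
      (\<Sum>e\<in>keys P. \<integral>w. ?c e * ?h e w \<partial>lborel_n n)"
      by (intro Bochner_Integration.integral_sum integrable_mult_right hi)
    then show ?thesis unfolding G_def by (simp only: integral_mult_right_zero)
  qed
  finally show ?thesis by (simp add: mult.assoc[symmetric] flip: power_mult_distrib)
qed

lemma prism_loop_integral:
  assumes n: "n \<ge> 1"
  shows "(\<Sum>i\<in>{1..n}. (-1) ^ (i - 1) * simplex_integral n P N (prism n p i)) =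
    (-1) ^ n * (\<Sum>k=1..n. loop_coeff p k * of_rat (\<Sum>e\<in>keys P. lookup P e *
       pf_coeff N k (pf_prod (map (\<lambda>m. Suc (lookup e m)) [1..<Suc n]))))"
proof -
  let ?c = "\<lambda>e. of_rat (lookup P e) :: complex"
  let ?b = "\<lambda>e m. Suc (lookup e m)"
  let ?q = "\<lambda>e k. pf_coeff N k (pf_prod (map (?b e) [1..<Suc n]))"
  have "(\<Sum>i\<in>{1..n}. (-1) ^ (i - 1) * simplex_integral n P N (prism n p i)) =
    (\<Sum>i\<in>{1..n}. \<Sum>e\<in>keys P. ?c e * (\<integral>w. indicator (prism_cell n i) w *\<^sub>R torus_fun n
        N p (?b e) w \<partial>lborel_n n))"
    by (intro sum.cong simplex_integral_prism) auto
  also have "\<dots> = (\<Sum>e\<in>keys P. ?c e * (\<Sum>i\<in>{1..n}. \<integral>w. indicator (prism_cell n i) w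
      *\<^sub>R torus_fun n N p (?b e) w \<partial>lborel_n n))"
    by (subst sum.swap) (simp only: sum_distrib_left)
  also have "\<dots> = (\<Sum>e\<in>keys P. ?c e * ((-1) ^ n * (\<Sum>k=1..n. loop_coeff p k * of_rat (?q e k))))"
    by (simp only: prism_cells_integral[OF n] open_prism_integral[OF n] zero_less_Suc)
  also have "\<dots> = (-1) ^ n * (\<Sum>e\<in>keys P. \<Sum>k=1..n. loop_coeff p k * (?c e * of_rat (?q e k)))"
    by (simp only: sum_distrib_left mult_ac)
  also have "(\<Sum>e\<in>keys P. \<Sum>k=1..n. loop_coeff p k * (?c e * of_rat (?q e k))) =
     (\<Sum>k=1..n. loop_coeff p k * (\<Sum>e\<in>keys P. ?c e * of_rat (?q e k)))"
    by (subst sum.swap) (simp only: sum_distrib_left)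
  also have "\<dots> = (\<Sum>k=1..n. loop_coeff p k * of_rat (\<Sum>e\<in>keys P. lookup P e * ?q e k))"
    by (simp only: of_rat_sum of_rat_mult)
  finally show ?thesis .
qed

section \<open>Partial fraction coefficients of the form\<close>

lemma poly_split_power:
  "\<exists>B'. \<forall>X. poly B X = (\<Sum>r<l. coeff B r * X ^ r) + X ^ l * poly B' (X :: rat)"
proof (induction l arbitrary: B)
  case (Suc l)
  obtain a B0 where B: "B = pCons a B0" by (cases B) auto
  obtain B' where "\<And>X. poly B0 X = (\<Sum>r<l. coeff B0 r * X ^ r) + X ^ l * poly B' X" using Suc by blast
  then have "poly B X = (\<Sum>r<Suc l. coeff B r * X ^ r) + X ^ Suc l * poly B' X" for X
    unfolding B by (subst sum.lessThan_Suc_shift) (simp add: sum_distrib_left algebra_simps)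
  then show ?case by blast
qed auto

text \<open>The proper part of the product with the polynomial \<open>binom_poly N j\<close>: only
  powers r < l of m + j leave a denominator.\<close>

definition pf_mul :: "nat \<Rightarrow> pf_list \<Rightarrow> pf_list" where
  "pf_mul N d = concat (map (\<lambda>(c, j, l). map (\<lambda>r. (c * coeff (binom_poly N (int j)) r, j, l - r)) [0..<l]) d)"

lemma pf_mul_Cons:
  "pf_mul N ((c, j, l) # d) = map (\<lambda>r. (c * coeff (binom_poly N (int j)) r, j, l - r)) [0..<l] @ pf_mul N d"
  by (simp add: pf_mul_def)

lemma pf_sum_mul:
  assumes "k \<ge> 1"
  shows "pf_sum k (pf_mul N d) = pf_coeff N k d"
proof (induction d)
  case (Cons a d)
  obtain c j l where a: "a = (c, j, l)" by (cases a)
  have "pf_sum k (map (\<lambda>r. (c * coeff (binom_poly N (int j)) r, j, l - r)) [0..<l]) =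
    (\<Sum>r\<in>{0..<l}. if l - r = k then c * coeff (binom_poly N (int j)) r else 0)"
    by (simp add: pf_sum_def comp_def sum.distinct_set_conv_list[symmetric])
  also have "\<dots> = (\<Sum>r\<in>{0..<l}. if r = l - k \<and> k \<le> l then c * coeff (binom_poly N (int j)) (l - k) else 0)"
    using assms by (intro sum.cong) auto
  also have "\<dots> = (if k \<le> l then c * coeff (binom_poly N (int j)) (l - k) else 0)"
    using assms by (cases "k \<le> l") (auto simp: sum.delta)
  finally show ?case using Cons by (simp add: a pf_mul_Cons pf_coeff_def)
qed (simp add: pf_mul_def pf_coeff_def)

lemma pf_mul_entries:
  assumes "(c, j, k) \<in> set (pf_mul N d)" "\<forall>(c, j, l)\<in>set d. l \<le> n \<and> j \<ge> 1"
  shows "k \<ge> 1 \<and> j \<ge> 1 \<and> k \<le> n"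
  using assms by (fastforce simp: pf_mul_def)

text \<open>Expanded at m + j, the low powers of the binomial polynomial lower the exponent of a
  term, and the high powers cancel its denominator and go into Q.\<close>

lemma binom_pf_val:
  assumes "\<forall>(c, j, l)\<in>set d. j \<ge> 1"
  shows "\<exists>Q. \<forall>m. of_nat ((m + N) choose m) * pf_val d m = poly Q (of_nat m) + pf_val (pf_mul (Suc N) d) m"
  using assms
proof (induction d)
  case Nil
  show ?case by (intro exI[of _ 0]) (simp add: pf_mul_def)
next
  case (Cons a d)
  obtain c j l where a: "a = (c, j, l)" by (cases a)
  then have j: "j \<ge> 1" using Cons.prems by simp
  obtain Q where Q: "\<And>m. of_nat ((m + N) choose m) * pf_val d m = poly Q (of_nat m) + pf_val (pf_mul (Suc N) d) m"
    using Cons by auto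
  let ?B = "binom_poly (Suc N) (int j)"
  obtain B' where B': "\<And>X. poly ?B X = (\<Sum>r<l. coeff ?B r * X ^ r) + X ^ l * poly B' X"
    using poly_split_power by blast
  \<comment> \<open>B' is a polynomial in m + j; the composition rewrites it in m.\<close>
  define Q' where "Q' = smult c (pcompose B' [:of_nat j, 1:])"
  have "of_nat ((m + N) choose m) * (c / of_nat (m + j) ^ l) =
    poly Q' (of_nat m) + pf_val (map (\<lambda>r. (c * coeff ?B r, j, l - r)) [0..<l]) m" for m
  proof -
    let ?X = "of_nat (m + j) :: rat"
    have X: "?X \<noteq> 0" using j by (metis add_is_0 not_one_le_zero of_nat_eq_0_iff)
    have "of_nat ((m + N) choose m) = poly ?B ?X"
      using poly_binom_poly[of N "int j" m] by simp
    then have "of_nat ((m + N) choose m) * (c / ?X ^ l) =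
      (\<Sum>r<l. c * coeff ?B r * (?X ^ r / ?X ^ l)) + c * poly B' ?X"
    proof -
      have "(S + x ^ l * y) * (c / x ^ l) = S * (c / x ^ l) + c * y" if "x \<noteq> 0" for S x y :: rat
        using that by (simp add: field_simps)
      from this[OF X] have "(\<Sum>r<l. coeff ?B r * ?X ^ r) * (c / ?X ^ l) + c * poly B' ?X =
          of_nat ((m + N) choose m) * (c / ?X ^ l)"
        unfolding \<open>of_nat ((m + N) choose m) = poly ?B ?X\<close> B' by (simp only:)
      then show ?thesis by (simp add: sum_distrib_left sum_distrib_right sum_divide_distrib mult_ac del: of_nat_add)
    qed
    also have "(\<Sum>r<l. c * coeff ?B r * (?X ^ r / ?X ^ l)) = (\<Sum>r<l. c * coeff ?B r / ?X ^ (l - r))"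
      using X by (intro sum.cong refl) (simp add: power_diff divide_simps del: of_nat_add)
    also have "\<dots> = pf_val (map (\<lambda>r. (c * coeff ?B r, j, l - r)) [0..<l]) m"
      by (simp add: pf_val_def comp_def sum.distinct_set_conv_list[symmetric] atLeast0LessThan)
    also have "c * poly B' ?X = poly Q' (of_nat m)" by (simp add: Q'_def poly_pcompose add.commute)
    finally show ?thesis by simp
  qed
  then have "of_nat ((m + N) choose m) * pf_val (a # d) m =
      poly (Q' + Q) (of_nat m) + pf_val (pf_mul (Suc N) (a # d)) m" for m
    using Q[of m] by (simp add: a pf_mul_Cons distrib_left)
  then show ?case by blast
qed

lemma pf_scale:
  assumes "pf_bounded n d"
  shows "\<exists>d'. (\<forall>m. pf_val d' m = x * pf_val d m) \<and> (\<forall>k. pf_sum k d' = x * pf_sum k d) \<and>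
    (pf_bounded n d')"
proof (intro exI conjI allI)
  let ?d = "map (\<lambda>(c, j, k). (x * c, j, k)) d"
  show "pf_val ?d m = x * pf_val d m" for m
    by (induction d) (auto simp: distrib_left)
  show "pf_sum k ?d = x * pf_sum k d" for k
    by (induction d) (auto simp: distrib_left)
  show "pf_bounded n ?d" using assms by auto
qed

text \<open>The numbers a_k. The index k = 1 is included because it occurs in the loop integrals of
  an arbitrary form; for an integrable form it is the coefficient that convergence forces to
  vanish.\<close>

definition form_coeff_sum :: "nat \<Rightarrow> rat_mpoly \<Rightarrow> nat \<Rightarrow> nat \<Rightarrow> rat" where
  "form_coeff_sum n P N k = (\<Sum>e\<in>keys P. lookup P e *
     pf_coeff N k (pf_prod (map (\<lambda>m. Suc (lookup e m)) [1..<Suc n])))"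

lemma term_seq_partial_fractions:
  assumes n: "n \<ge> 1"
  shows "\<exists>Q d. (\<forall>m. term_seq n P N m = poly Q (of_nat m) + pf_val d m) \<and>
    (pf_bounded n d) \<and> (\<forall>k\<ge>1. pf_sum k d = form_coeff_sum n P (Suc N) k)"
proof -
  define bs where "bs e = map (\<lambda>m. Suc (lookup e m)) [1..<Suc n]" for e :: "nat \<Rightarrow>\<^sub>0 nat"
  let ?d = "\<lambda>e. pf_prod (bs e)"
  define f where "f e m = lookup P e * (of_nat ((m + N) choose m) *
     (\<Prod>i\<in>{1..n}. 1 / of_nat (m + Suc (lookup e i))))" for e m
  define g where "g e k = lookup P e * pf_coeff (Suc N) k (?d e)" for e k
  have single: "\<exists>Q d. (\<forall>m. f e m = poly Q (of_nat m) + pf_val d m) \<and>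
    (pf_bounded n d) \<and> (\<forall>k\<ge>1. pf_sum k d = g e k)" for e
  proof -
    have pos: "\<forall>b\<in>set (bs e). b > 0" by (auto simp: bs_def simp del: upt_Suc)
    have len: "length (bs e) = n" "bs e \<noteq> []" using n by (auto simp: bs_def simp del: upt_Suc)
    have ent: "\<forall>(c, j, l)\<in>set (?d e). l \<le> n \<and> j \<ge> 1"
      using pf_prod_entries[OF _ pos] len by fastforce
    then have "\<forall>(c, j, l)\<in>set (?d e). j \<ge> 1" by auto
    from binom_pf_val[OF this, of N] obtain Q where
      Q: "\<And>m. of_nat ((m + N) choose m) * pf_val (?d e) m = poly Q (of_nat m) + pf_val (pf_mul (Suc N) (?d e)) m"
      by blast
    have "pf_bounded n (pf_mul (Suc N) (?d e))"
      using pf_mul_entries[OF _ ent] by blast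
    from pf_scale[OF this, of "lookup P e"] obtain d where
      d: "\<And>m. pf_val d m = lookup P e * pf_val (pf_mul (Suc N) (?d e)) m"
      "\<And>k. pf_sum k d = lookup P e * pf_sum k (pf_mul (Suc N) (?d e))"
      "pf_bounded n d" by blast
    have "(\<Prod>i\<in>{1..n}. 1 / of_nat (m + Suc (lookup e i))) = pf_val (?d e) m" for m
    proof -
      have "(\<Prod>b\<leftarrow>bs e. 1 / of_nat (m + b)) =
        (\<Prod>i\<in>set [1..<Suc n]. 1 / (of_nat (m + Suc (lookup e i)) :: rat))"
        unfolding bs_def map_map by (subst prod.distinct_set_conv_list) (simp_all add: comp_def add_ac del: upt_Suc)
      also have "set [1..<Suc n] = {1..n}" by auto
      finally show ?thesis unfolding pf_val_prod[OF pos] ..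
    qed
    then have "f e m = poly (smult (lookup P e) Q) (of_nat m) + pf_val d m" for m
      unfolding f_def using Q[of m] by (simp add: d distrib_left)
    moreover have "pf_sum k d = g e k" if "k \<ge> 1" for k
      unfolding d g_def pf_sum_mul[OF that] ..
    ultimately show ?thesis using d(3) by blast
  qed
  have "\<exists>Q d. (\<forall>m. (\<Sum>e\<in>E. f e m) = poly Q (of_nat m) + pf_val d m) \<and>
    (pf_bounded n d) \<and> (\<forall>k\<ge>1. pf_sum k d = (\<Sum>e\<in>E. g e k))"
    if "finite E" for E
    using that
  proof (induction E rule: finite_induct)
    case empty
    show ?case by (intro exI[of _ 0] exI[of _ "[]"]) simp
  next
    case (insert e E)
    from single[of e] obtain Q1 d1 where 1: "\<And>m. f e m = poly Q1 (of_nat m) + pf_val d1 m"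
      "pf_bounded n d1" "\<And>k. k \<ge> 1 \<Longrightarrow> pf_sum k d1 = g e k" by blast
    from insert.IH obtain Q2 d2 where 2: "\<And>m. (\<Sum>e\<in>E. f e m) = poly Q2 (of_nat m) + pf_val d2 m"
      "pf_bounded n d2" "\<And>k. k \<ge> 1 \<Longrightarrow> pf_sum k d2 = (\<Sum>e\<in>E. g e k)" by blast
    show ?case
    proof (intro exI[of _ "Q1 + Q2"] exI[of _ "d1 @ d2"] conjI allI impI)
      show "(\<Sum>e\<in>insert e E. f e m) = poly (Q1 + Q2) (of_nat m) + pf_val (d1 @ d2) m" for m
        using insert.hyps by (simp add: 1(1) 2(1))
      show "pf_bounded n (d1 @ d2)" using 1(2) 2(2) by auto
      show "pf_sum k (d1 @ d2) = (\<Sum>e\<in>insert e E. g e k)" if "k \<ge> 1" for k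
        using insert.hyps by (simp add: 1(3)[OF that] 2(3)[OF that])
    qed
  qed
  from this[OF finite_keys[of P]] show ?thesis
    unfolding term_seq_def form_coeff_sum_def f_def g_def bs_def .
qed

lemma cube_integral_value:
  assumes n: "n \<ge> 1" and int: "integrable_form n P N"
  shows "\<exists>a0. cube_integral n P N = of_rat a0 + (\<Sum>k\<in>{2..n}. of_rat (form_coeff_sum n P N k) * zeta_val k)"
proof (cases N)
  case 0
  \<comment> \<open>A polynomial form has a rational integral; the convention
    \<open>binom_poly 0 j = 0\<close> makes all its zeta coefficients vanish.\<close>
  have "form_coeff_sum n P 0 k = 0" for k
  proof -
    have "pf_coeff 0 k d = 0" for d by (induction d) (auto simp: pf_coeff_def)
    then show ?thesis by (simp add: form_coeff_sum_def)
  qed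
  then show ?thesis unfolding 0 cube_integral_0 by auto
next
  case (Suc M)
  from term_seq_partial_fractions[OF n, of P M] obtain Q d where
    d: "\<And>m. term_seq n P M m = poly Q (of_nat m) + pf_val d m"
      "pf_bounded n d" "\<And>k. k \<ge> 1 \<Longrightarrow> pf_sum k d = form_coeff_sum n P N k"
    unfolding Suc by blast
  define r where "r i = 1 - 1 / real (Suc i)" for i
  have r: "0 \<le> r i" "r i < 1" "r i \<le> 1" for i by (simp_all add: r_def)
  have r1: "r \<longlonglongrightarrow> 1"
    unfolding r_def[abs_def] by real_asymp
  have "cube_integral n P N = (\<Sum>k=2..n. of_rat (pf_sum k d) * zeta_val k) + of_rat (\<Sum>(c, j,
      k)\<leftarrow>d. zeta_tail_const c j k)"
  proof (rule rational_sum_value[OF d(2) r(1,3) r1])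
    show "summable (\<lambda>m. r i ^ m * of_rat (poly Q (of_nat m) + pf_val d m))" for i
      using damped_cube_integral[OF r(1)[of i] r(2)[of i], where n = n and P = P and N = M] unfolding d(1) by (rule sums_summable)
    show "(\<lambda>i. suminf (\<lambda>m. r i ^ m * of_rat (poly Q (of_nat m) +
        pf_val d m))) \<longlonglongrightarrow> cube_integral n P N"
      using cube_integral_limit[OF n int[unfolded Suc] r(1,2) r1] unfolding d(1) Suc .
  qed
  also have "(\<Sum>k=2..n. of_rat (pf_sum k d) * zeta_val k) = (\<Sum>k=2..n. of_rat (form_coeff_sum n P N k) * zeta_val k)"
    by (intro sum.cong refl) (simp add: d(3))
  finally show ?thesis by (auto simp: add.commute)
qed

text \<open>
  The integral over the \<open>p\<close>-th prism is a polynomial in \<open>p\<close>; \<open>v\<close> is an inverse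
      Vandermonde matrix that
  extracts its coefficients.
\<close>

definition zeta_cycle :: "nat \<Rightarrow> (nat \<Rightarrow> nat \<Rightarrow> rat) \<Rightarrow> nat \<Rightarrow>
    rat_chain" where
  "zeta_cycle n v k = prism_chain n (\<lambda>p. - ((-1) ^ (n + k)) * fact (k - 1) * v (k - 1) p)"

lemma chain_integral_zeta_cycle:
  assumes k: "k \<in> {1..n}"
    and v: "\<And>q r. q < n \<Longrightarrow> r < n \<Longrightarrow> (\<Sum>p<n. v q p * of_nat p ^ r) = (if q =
        r then 1 else 0)"
  shows "chain_integral n P N (zeta_cycle n v k) = (two_pi_i) ^ k * of_rat (form_coeff_sum n P N k)"
proof -
  have n: "n \<ge> 1" using k by simp
  let ?A = "\<lambda>k. of_rat (form_coeff_sum n P N k) :: complex"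
  \<comment> \<open>The normalisation of the cycle: it cancels the sign \<open>(-1) ^ n\<close> of
    the prism integral together with the sign and the factorial in
    \<open>loop_coeff\<close>.\<close>
  let ?s = "- ((-1) ^ (n + k)) * fact (k - 1) :: complex"
  have fact: "of_rat (fact m) = (fact m :: complex)" for m by (metis of_nat_fact of_rat_of_nat_eq)
  have loop: "loop_coeff p l = - ((-1) ^ l) * (two_pi_i) ^ l / fact (l - 1) * of_nat p ^ (l - 1)" for p l
    by (simp add: loop_coeff_def)
  have delta: "(\<Sum>p<n. of_rat (v (k - 1) p) * of_nat p ^ (l - 1)) = (if l =
      k then 1 else 0 :: complex)" if l: "l \<in> {1..n}" for l
  proof -
    have "(\<Sum>p<n. of_rat (v (k - 1) p) * of_nat p ^ (l - 1)) = (of_rat (\<Sum>p<n. v (k - 1) p *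
        of_nat p ^ (l - 1)) :: complex)"
      by (simp add: of_rat_sum of_rat_mult of_rat_power)
    also have "(\<Sum>p<n. v (k - 1) p * of_nat p ^ (l - 1)) = (if k - 1 = l - 1 then 1 else 0)"
      using k l by (intro v) auto
    finally show ?thesis using k l by auto
  qed
  have "chain_integral n P N (zeta_cycle n v k) =
    (\<Sum>p<n. of_rat (- ((-1) ^ (n + k)) * fact (k - 1) * v (k - 1) p) * (\<Sum>i\<in>{1..n}. (-1) ^ (i - 1) *
        simplex_integral n P N (prism n p i)))"
    unfolding chain_integral_def zeta_cycle_def by (rule prism_chain_functional)
  also have "\<dots> = (\<Sum>p<n. \<Sum>l=1..n. ?s * (-1) ^ n * (- ((-1) ^ l) * (two_pi_i) ^ l / fact (l - 1) * ?A l) *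
      (of_rat (v (k - 1) p) * of_nat p ^ (l - 1)))"
    unfolding prism_loop_integral[OF n] form_coeff_sum_def[symmetric] loop sum_distrib_left
    by (intro sum.cong refl) (simp add: of_rat_mult of_rat_minus of_rat_power fact mult_ac)
  also have "\<dots> = (\<Sum>l=1..n. ?s * (-1) ^ n * (- ((-1) ^ l) * (two_pi_i) ^ l / fact (l - 1) * ?A l) *
      (\<Sum>p<n. of_rat (v (k - 1) p) * of_nat p ^ (l - 1)))"
    by (subst sum.swap) (simp only: sum_distrib_left)
  also have "\<dots> = (\<Sum>l=1..n. if l = k then ?s * (-1) ^ n * (- ((-1) ^ l) * (two_pi_i) ^ l / fact (l - 1) * ?A l) else 0)"
  proof (intro sum.cong refl)
    fix l assume "l \<in> {1..n}"
    from delta[OF this]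
    show "?s * (-1) ^ n * (- ((-1) ^ l) * (two_pi_i) ^ l / fact (l - 1) * ?A l) *
      (\<Sum>p<n. of_rat (v (k - 1) p) * of_nat p ^ (l - 1)) =
      (if l = k then ?s * (-1) ^ n * (- ((-1) ^ l) * (two_pi_i) ^ l / fact (l - 1) * ?A l) else 0)"
      by simp
  qed
  also have "\<dots> = ?s * (-1) ^ n * (- ((-1) ^ k) * (two_pi_i) ^ k / fact (k - 1) * ?A k)"
    using k by (simp add: sum.delta)
  also have "\<dots> = ((-1) ^ (n + k) * ((-1) ^ n * (-1) ^ k)) * ((two_pi_i) ^ k * ?A k)" by simp
  also have "(-1) ^ (n + k) * ((-1) ^ n * (-1) ^ k) = (1 :: complex)"
    by (simp flip: power_add power_mult_distrib)
  finally show ?thesis by simp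
qed

theorem theorem1p1:
  fixes n :: nat
  assumes "n \<ge> 1"
  shows "\<exists>\<sigma> :: nat \<Rightarrow> rat_chain.
    (\<forall>k\<in>{2..n}. relative_cycle n (\<sigma> k)) \<and>
    (\<forall>P\<in>rat_mpolys n. \<forall>N :: nat. integrable_form n P N \<longrightarrow>
      (\<exists>a :: nat \<Rightarrow> rat.
        cube_integral n P N = of_rat (a 0) + (\<Sum>k\<in>{2..n}. of_rat (a k) * zeta_val k) \<and>
        (\<forall>k\<in>{2..n}.
          of_rat (a k) = (2 * of_real pi * \<i>) powi (- int k) * chain_integral n P N (\<sigma> k))))"
proof -
  obtain v :: "nat \<Rightarrow> nat \<Rightarrow> rat" where
    v: "\<And>q r. q < n \<Longrightarrow> r < n \<Longrightarrow> (\<Sum>p<n. v q p * of_nat p ^ r) = (if q = r then 1 else 0)"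
    using inverse_vandermonde[of n] by blast
  show ?thesis
  proof (intro exI[of _ "zeta_cycle n v"] conjI ballI allI impI)
    show "relative_cycle n (zeta_cycle n v k)" for k
      unfolding zeta_cycle_def by (rule prism_chain_relative_cycle[OF assms])
    fix P N assume "integrable_form n P N"
    from cube_integral_value[OF assms this] obtain a0 where
      a0: "cube_integral n P N = of_rat a0 + (\<Sum>k\<in>{2..n}. of_rat (form_coeff_sum n P N k) * zeta_val k)" ..
    define a where "a k = (if k = 0 then a0 else form_coeff_sum n P N k)" for k
    show "\<exists>a :: nat \<Rightarrow> rat.
        cube_integral n P N = of_rat (a 0) + (\<Sum>k\<in>{2..n}. of_rat (a k) * zeta_val k) \<and>
        (\<forall>k\<in>{2..n}.
          of_rat (a k) = (2 * of_real pi * \<i>) powi (- int k) * chain_integral n P N (zeta_cycle n v k))"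
    proof (intro exI[of _ a] conjI ballI)
      show "cube_integral n P N = of_rat (a 0) + (\<Sum>k\<in>{2..n}. of_rat (a k) * zeta_val k)"
        unfolding a0 by (simp add: a_def)
      fix k assume k: "k \<in> {2..n}"
      then have "k \<in> {1..n}" by auto
      from chain_integral_zeta_cycle[OF this v, of P N] k
      show "of_rat (a k) = (2 * of_real pi * \<i>) powi (- int k) * chain_integral n P N (zeta_cycle n v k)"
        by (simp add: a_def power_int_minus)
    qed
  qed
qed

end
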